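(* Let $0\le\beta\le\alpha\le1$ with $\beta<1$, and let $(\chi,(\psi_i)_{i\in I_\ast})$ be a wave-packet scattering bank subordinate to the covering $\mathcal Q^{(\alpha,\beta)}$ which satisfies the energy localization conditions (E1) (with constant $r_{\rm gap}>0$) and (E2) (with constant $\theta\in(0,1)$). Then for every $0<s\le1$, $$\|U_nf\|_{\ell^2(L^2)}^2\le\frac{4}{r_{\rm gap}}\,\theta^{s(n-1)}\,\|f\|_{H^s}^2,\qquad n\in\mathbb N,\quad f\in H^s(\mathbb R^2).$$ Consequently, if $1-\beta<s\le1$, then there exists a constant $C>0$ such that $$\mathfrak E_{1-\beta}(f)\le C\,\|f\|_{H^s},\qquad f\in H^s(\mathbb R^2).$$
   Context: Notation: $\mathbb N=\{1,2,\dots\}$, $\mathbb N_0=\{0,1,2,\dots\}$; $\widehat f(\xi)=\int_{\mathbb R^2}e^{-2\pi \mathrm i x\cdot\xi}f(x)\,dx$; $\|f\|_{H^s}=\|(1+|\xi|^2)^{s/2}\widehat f\|_{L^2}$; $B_r(x_0)$ is the open ball. For a countable family $q=(q_p)_p$, $\|q\|_{\ell^2(L^2)}=(\sum_p\|q_p\|_{L^2}^2)^{1/2}$ and $\|q\|_{\ell^2(H^s)}=(\sum_p\|q_p\|_{H^s}^2)^{1/2}$. Covering. Fix $0\le\beta\le\alpha\le1$ and $\varepsilon_0\in(0,1/32)$. Let $Q=(-\varepsilon_0,1+\varepsilon_0)\times(-1-\varepsilon_0,1+\varepsilon_0)$. For $j\in\mathbb N$ let $m_j^{\max}=\lceil 2^{(1-\alpha)j-1}\rceil$,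 $\ell_j^{\max}=\lceil 10\cdot2^{(1-\beta)j}\rceil$, $A_j=\mathrm{diag}(2^{\alpha j},2^{\beta j})$, $c_{j,m}=(2^{j-1}+m2^{\alpha j},0)^\top$, and let $R_{j,\ell}$ be the rotation matrix by the angle $\theta_{j,\ell}=2\ell\cdot\frac{\pi}{10}2^{(\beta-1)j}$. Put $I_\ast=\{(j,m,\ell)\in\mathbb N\times\mathbb N_0\times\mathbb N_0: m\le m_j^{\max},\ \ell\le\ell_j^{\max}\}$, $I=\{0\}\cup I_\ast$, $Q_i=R_{j,\ell}(A_jQ+c_{j,m})$ for $i=(j,m,\ell)\in I_\ast$, and $Q_0=B_4(0)$. The covering is $\mathcal Q^{(\alpha,\beta)}=(Q_i)_{i\in I}$. Filter bank. A wave-packet scattering bank subordinate to $\mathcal Q^{(\alpha,\beta)}$ consists of $\chi\in L^1\cap L^2(\mathbb R^2)$ and $\psi_i\in L^1\cap L^2(\mathbb R^2)$, $i\in I_\ast$, with $m_i:=\widehat\psi_i$, such that $|\widehat\chi(\xi)|^2+\sum_{i\in I_\ast}|m_i(\xi)|^2=1$ for a.e. $\xi$, $\operatorname{supp}\widehat\chi\subset Q_0$ and $\operatorname{supp}m_i\subset Q_i$ for all $i\in I_\ast$. Scattering propagation. $U[e]f=f$ for the empty path $e$; for $p=(i_1,\dots,i_n)\in I_\ast^n$, $U[p]f=U[i_n]\cdots U[i_1]f$ with $U[i]g=|g*\psi_i|$; $U_nf=(U[p]f)_{p\in I_\ast^n}$ with $I_\ast^0=\{e\}$. For $0\le s\le1$,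 $\mathfrak E_s(f)=\sum_{n=0}^\infty\|U_nf\|_{\ell^2(H^s)}\in[0,\infty]$. Energy localization: (E1) for some $r_{\rm gap}>0$, $\sum_{i\in I_\ast}|m_i(\xi)|^2=0$ for $|\xi|<r_{\rm gap}$; (E2) there are $\theta\in(0,1)$ and points $\nu_i\in\mathbb R^2$, $i\in I_\ast$, such that $\operatorname{supp}m_i\subset\{\xi\in\mathbb R^2:|\xi-\nu_i|\le\theta|\xi|\}$ for every $i\in I_\ast$. *)

theory Defs
  imports "HOL-Analysis.Analysis"
begin

section \<open>Function spaces and the Fourier transform on the plane\<close>

text \<open>
  Functions on the plane are represented by everywhere defined, Borel measurable functions; every
  class modulo Lebesgue null sets contains such a representative. All norms take values in
  \<open>[0, \<infinity>]\<close>, so that infinite norms are not confused with small ones.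
\<close>

definition esqrt :: "ennreal \<Rightarrow> ennreal" where
  "esqrt x = (if x = \<infinity> then \<infinity> else ennreal (sqrt (enn2real x)))"

definition L2_norm :: "(real^2 \<Rightarrow> complex) \<Rightarrow> ennreal" where
  "L2_norm f = esqrt (\<integral>\<^sup>+ x. ennreal ((cmod (f x))\<^sup>2) \<partial>lborel)"

definition L1_space :: "(real^2 \<Rightarrow> complex) set" where
  "L1_space = {f. integrable lborel f}"

definition L2_space :: "(real^2 \<Rightarrow> complex) set" where
  "L2_space = {f \<in> borel_measurable lborel. L2_norm f < \<infinity>}"

definition fourier :: "(real^2 \<Rightarrow> complex) \<Rightarrow> real^2 \<Rightarrow> complex" where
  "fourier f \<xi> = (\<integral> x. exp (- 2 * pi * \<i> * complex_of_real (x \<bullet> \<xi>)) * f x \<partial>lborel)"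

text \<open>
  The integral defining \<^const>\<open>fourier\<close> need not converge for a function that is merely square
  integrable. Its transform is the \<open>L\<^sup>2\<close>-limit of the transforms of the truncations to the
  balls of radius \<open>N\<close>; this determines it up to a null set, on which no norm depends.
\<close>

definition fourier_L2 :: "(real^2 \<Rightarrow> complex) \<Rightarrow> real^2 \<Rightarrow> complex" where
  "fourier_L2 f = (SOME g. g \<in> L2_space \<and>
     (\<lambda>N::nat. L2_norm (\<lambda>\<xi>. fourier (\<lambda>x. indicator (cball 0 (real N)) x * f x) \<xi> - g \<xi>))
       \<longlonglongrightarrow> 0)"

definition Hs_norm :: "real \<Rightarrow> (real^2 \<Rightarrow> complex) \<Rightarrow> ennreal" where
  "Hs_norm s f =
     L2_norm (\<lambda>\<xi>. complex_of_real ((1 + (norm \<xi>)\<^sup>2) powr (s / 2)) * fourier_L2 f \<xi>)"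

text \<open>Only used for \<open>s \<ge> 0\<close>, where \<open>H\<^sup>s\<close> is contained in \<open>L\<^sup>2\<close>.\<close>

definition Hs_space :: "real \<Rightarrow> (real^2 \<Rightarrow> complex) set" where
  "Hs_space s = {f \<in> L2_space. Hs_norm s f < \<infinity>}"

text \<open>\<open>P\<close> is the index set of the family \<open>q\<close>, and \<open>N\<close> the norm of its members.\<close>

definition ell2_norm ::
  "'p set \<Rightarrow> ((real^2 \<Rightarrow> complex) \<Rightarrow> ennreal) \<Rightarrow> ('p \<Rightarrow> real^2 \<Rightarrow> complex) \<Rightarrow> ennreal" where
  "ell2_norm P N q = esqrt (\<Sum>\<^sub>\<infinity>p\<in>P. (N (q p))\<^sup>2)"

definition convol :: "(real^2 \<Rightarrow> complex) \<Rightarrow> (real^2 \<Rightarrow> complex) \<Rightarrow> real^2 \<Rightarrow> complex" where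
  "convol g h x = (\<integral> y. g y * h (x - y) \<partial>lborel)"

definition fsupport :: "(real^2 \<Rightarrow> complex) \<Rightarrow> (real^2) set" where
  "fsupport f = closure {\<xi>. f \<xi> \<noteq> 0}"


section \<open>The covering\<close>

type_synonym wp_index = "nat \<times> nat \<times> nat"

definition base_rect :: "real \<Rightarrow> (real^2) set" where
  "base_rect \<epsilon>0 = {x. - \<epsilon>0 < x $ 1 \<and> x $ 1 < 1 + \<epsilon>0 \<and> - 1 - \<epsilon>0 < x $ 2 \<and> x $ 2 < 1 + \<epsilon>0}"

definition m_max :: "real \<Rightarrow> nat \<Rightarrow> nat" where
  "m_max \<alpha> j = nat \<lceil>2 powr ((1 - \<alpha>) * real j - 1)\<rceil>"

definition l_max :: "real \<Rightarrow> nat \<Rightarrow> nat" where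
  "l_max \<beta> j = nat \<lceil>10 * 2 powr ((1 - \<beta>) * real j)\<rceil>"

definition I_star :: "real \<Rightarrow> real \<Rightarrow> wp_index set" where
  "I_star \<alpha> \<beta> = {(j, m, l). 1 \<le> j \<and> m \<le> m_max \<alpha> j \<and> l \<le> l_max \<beta> j}"

definition scal_mat :: "real \<Rightarrow> real \<Rightarrow> nat \<Rightarrow> real^2^2" where
  "scal_mat \<alpha> \<beta> j = vector [vector [2 powr (\<alpha> * real j), 0],
                            vector [0, 2 powr (\<beta> * real j)]]"

definition shift_vec :: "real \<Rightarrow> nat \<Rightarrow> nat \<Rightarrow> real^2" where
  "shift_vec \<alpha> j m = vector [2 powr (real j - 1) + real m * 2 powr (\<alpha> * real j), 0]"

definition rot_angle :: "real \<Rightarrow> nat \<Rightarrow> nat \<Rightarrow> real" where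
  "rot_angle \<beta> j l = 2 * real l * (pi / 10) * 2 powr ((\<beta> - 1) * real j)"

definition rot_mat :: "real \<Rightarrow> real^2^2" where
  "rot_mat t = vector [vector [cos t, - sin t], vector [sin t, cos t]]"

fun cover_set :: "real \<Rightarrow> real \<Rightarrow> real \<Rightarrow> wp_index \<Rightarrow> (real^2) set" where
  "cover_set \<alpha> \<beta> \<epsilon>0 (j, m, l) =
     (\<lambda>x. rot_mat (rot_angle \<beta> j l) *v (scal_mat \<alpha> \<beta> j *v x + shift_vec \<alpha> j m)) ` base_rect \<epsilon>0"

definition cover_set0 :: "(real^2) set" where
  "cover_set0 = ball 0 4"


section \<open>Filter banks and scattering propagation\<close>

text \<open>
  A filter family is a function on all triples; its values outside \<^const>\<open>I_star\<close> are
  unconstrained and never used. The low-pass filter is called \<open>\<phi>\<close>, since \<open>chi\<close> in Greek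
  is binder syntax for vectors. Sums of squares are taken in \<^typ>\<open>ennreal\<close>, where the
  unordered sum always exists.
\<close>

definition wave_packet_bank ::
  "real \<Rightarrow> real \<Rightarrow> real \<Rightarrow> (real^2 \<Rightarrow> complex) \<Rightarrow> (wp_index \<Rightarrow> real^2 \<Rightarrow> complex) \<Rightarrow> bool" where
  "wave_packet_bank \<alpha> \<beta> \<epsilon>0 \<phi> \<psi> \<longleftrightarrow>
     \<phi> \<in> L1_space \<inter> L2_space \<and>
     (\<forall>i\<in>I_star \<alpha> \<beta>. \<psi> i \<in> L1_space \<inter> L2_space) \<and>
     (AE \<xi> in lborel. ennreal ((cmod (fourier \<phi> \<xi>))\<^sup>2)
        + (\<Sum>\<^sub>\<infinity>i\<in>I_star \<alpha> \<beta>. ennreal ((cmod (fourier (\<psi> i) \<xi>))\<^sup>2)) = 1) \<and>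
     fsupport (fourier \<phi>) \<subseteq> cover_set0 \<and>
     (\<forall>i\<in>I_star \<alpha> \<beta>. fsupport (fourier (\<psi> i)) \<subseteq> cover_set \<alpha> \<beta> \<epsilon>0 i)"

definition energy_loc1 ::
  "real \<Rightarrow> real \<Rightarrow> (wp_index \<Rightarrow> real^2 \<Rightarrow> complex) \<Rightarrow> real \<Rightarrow> bool" where
  "energy_loc1 \<alpha> \<beta> \<psi> r_gap \<longleftrightarrow> 0 < r_gap \<and>
     (\<forall>\<xi>. norm \<xi> < r_gap \<longrightarrow>
        (\<Sum>\<^sub>\<infinity>i\<in>I_star \<alpha> \<beta>. ennreal ((cmod (fourier (\<psi> i) \<xi>))\<^sup>2)) = 0)"

definition energy_loc2 ::
  "real \<Rightarrow> real \<Rightarrow> (wp_index \<Rightarrow> real^2 \<Rightarrow> complex) \<Rightarrow> real \<Rightarrow> bool" where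
  "energy_loc2 \<alpha> \<beta> \<psi> \<theta> \<longleftrightarrow> 0 < \<theta> \<and> \<theta> < 1 \<and>
     (\<exists>\<nu> :: wp_index \<Rightarrow> real^2. \<forall>i\<in>I_star \<alpha> \<beta>.
        fsupport (fourier (\<psi> i)) \<subseteq> {\<xi>. norm (\<xi> - \<nu> i) \<le> \<theta> * norm \<xi>})"

definition U_step ::
  "(wp_index \<Rightarrow> real^2 \<Rightarrow> complex) \<Rightarrow> wp_index \<Rightarrow> (real^2 \<Rightarrow> complex) \<Rightarrow> real^2 \<Rightarrow> complex" where
  "U_step \<psi> i g = (\<lambda>x. complex_of_real (cmod (convol g (\<psi> i) x)))"

text \<open>The head of the list is the filter that is applied first.\<close>

primrec U_path ::
  "(wp_index \<Rightarrow> real^2 \<Rightarrow> complex) \<Rightarrow> wp_index list \<Rightarrow> (real^2 \<Rightarrow> complex) \<Rightarrow> real^2 \<Rightarrow> complex" where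
  "U_path \<psi> [] f = f"
| "U_path \<psi> (i # p) f = U_path \<psi> p (U_step \<psi> i f)"

definition paths :: "real \<Rightarrow> real \<Rightarrow> nat \<Rightarrow> wp_index list set" where
  "paths \<alpha> \<beta> n = {p. length p = n \<and> set p \<subseteq> I_star \<alpha> \<beta>}"

definition U_norm ::
  "real \<Rightarrow> real \<Rightarrow> (wp_index \<Rightarrow> real^2 \<Rightarrow> complex) \<Rightarrow> ((real^2 \<Rightarrow> complex) \<Rightarrow> ennreal) \<Rightarrow>
   nat \<Rightarrow> (real^2 \<Rightarrow> complex) \<Rightarrow> ennreal" where
  "U_norm \<alpha> \<beta> \<psi> N n f = ell2_norm (paths \<alpha> \<beta> n) N (\<lambda>p. U_path \<psi> p f)"

definition scat_energy ::
  "real \<Rightarrow> real \<Rightarrow> (wp_index \<Rightarrow> real^2 \<Rightarrow> complex) \<Rightarrow> real \<Rightarrow> (real^2 \<Rightarrow> complex) \<Rightarrow> ennreal" where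
  "scat_energy \<alpha> \<beta> \<psi> s f = (\<Sum>n. U_norm \<alpha> \<beta> \<psi> (Hs_norm s) n f)"

end

theory Submission
  imports Defs "HOL-Probability.Characteristic_Functions"
begin

text \<open>
  The decay is that of a single quantity, the homogeneous energy
  \<open>Q f = \<integral> \<bar>\<xi>\<bar>\<^sup>\<tau> \<bar>fourier_L2 f\<bar>\<^sup>2\<close> with \<open>0 < \<tau> < 2\<close>: each layer of the network contracts it by the
  factor \<open>\<theta>\<^sup>\<tau>\<close>.

  The contraction comes from the modulus. A Gaussian has a positive Fourier transform, so replacing a
  function by its modulus can only increase the Gaussian mean of its energy density, and multiplying
  by a character before taking the modulus shows that the Gaussian measuring the original function may
  be centered at any point \<open>\<nu>\<close> (\<open>gaussian_mean_le_modulus_L1\<close>). By Plancherel's theorem the defects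
  \<open>1 - exp (- \<pi> \<epsilon>\<^sup>2 \<bar>\<xi>\<bar>\<^sup>2)\<close> satisfy the opposite inequality (\<open>gaussian_defect_modulus_le\<close>). If the
  spectrum of the original function lies where \<open>\<bar>\<xi> - \<nu>\<bar> \<le> \<theta> \<bar>\<xi>\<bar>\<close>, as (E2) ensures for the output of
  a filter, then the defect of the modulus is bounded by a defect at the contracted frequency
  \<open>\<theta> \<xi>\<close>. For \<open>0 < \<tau> < 2\<close> the weight \<open>\<bar>\<xi>\<bar>\<^sup>\<tau>\<close> is a positive mixture of these defects over all
  \<open>\<epsilon> > 0\<close> (\<open>gaussian_mixture\<close>), and homogeneity turns \<open>\<theta> \<xi>\<close> into the factor \<open>\<theta>\<^sup>\<tau>\<close>
  (\<open>hom_energy_modulus_le\<close>). The filters do not amplify any frequency, so the estimate sums over a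
  layer (\<open>hom_energy_layer_le\<close>).

  By (E1) the filters pass no frequency below \<open>r_gap\<close>, and \<open>\<bar>\<xi>\<bar>\<^sup>\<tau> \<ge> r_gap\<^sup>\<tau>\<close> on all others; hence the
  \<open>L\<^sup>2\<close>-energy of the next layer is at most \<open>r_gap\<^bsup>-\<tau>\<^esup>\<close> times the homogeneous energy
  (\<open>L2_layer_le\<close>). The choice \<open>\<tau> = s\<close> gives the first claim, because the low-pass filter forces
  \<open>r_gap \<le> 4\<close>. The choice \<open>\<tau> = 2 (1 - \<beta>)\<close> makes the homogeneous and the \<open>L\<^sup>2\<close>-energies of the layers
  decay together, so the norms of order \<open>1 - \<beta>\<close> form a geometric series.

  The analytic foundation is the Fourier transform on \<open>L\<^sup>2\<close>: Plancherel's identity follows from the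
  same Gaussian means by letting \<open>\<epsilon>\<close> tend to \<open>0\<close>, and everything else is transported from
  integrable functions by approximation (\<open>fourier_L2_limit\<close>).
\<close>


section \<open>Square integrable functions on a measure space\<close>

text \<open>
  The \<open>L\<^sup>2\<close>-seminorm over an arbitrary measure space. Besides Lebesgue measure it is used for
  Lebesgue measure with a Gaussian density, where it inherits the limits taken in \<open>L\<^sup>2\<close>.
\<close>

definition L2norm_on :: "'a measure \<Rightarrow> ('a \<Rightarrow> complex) \<Rightarrow> ennreal" where
  "L2norm_on M f = esqrt (\<integral>\<^sup>+ x. ennreal ((cmod (f x))\<^sup>2) \<partial>M)"

lemma L2_norm_eq_L2norm_on: "L2_norm f = L2norm_on lborel f"
  by (simp add: L2_norm_def L2norm_on_def)

lemma esqrt_power2 [simp]: "(esqrt x)\<^sup>2 = x"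
  by (cases x) (auto simp: esqrt_def ennreal_power power2_eq_square ennreal_top_mult simp flip: ennreal_mult)

text \<open>
  Seminorms are compared through their squares, which are plain integrals; the square root enters
  only through this equivalence.
\<close>

lemma power2_le_iff_ennreal: "x\<^sup>2 \<le> y\<^sup>2 \<longleftrightarrow> x \<le> (y::ennreal)"
proof -
  have "x < y \<Longrightarrow> x\<^sup>2 < y\<^sup>2" for x y :: ennreal
    by (cases x; cases y) (auto simp: ennreal_power ennreal_less_iff power_strict_mono top_power_ennreal)
  then show ?thesis
    by (meson leD leI power_mono zero_le)
qed

lemma esqrt_unique: "x\<^sup>2 = y \<Longrightarrow> esqrt y = x"
  by (metis esqrt_power2 order_antisym power2_le_iff_ennreal order_refl)

lemma esqrt_le_iff: "esqrt x \<le> y \<longleftrightarrow> x \<le> y\<^sup>2"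
  by (metis esqrt_power2 power2_le_iff_ennreal)

lemma le_esqrt_iff: "y \<le> esqrt x \<longleftrightarrow> y\<^sup>2 \<le> x"
  by (metis esqrt_power2 power2_le_iff_ennreal)

lemma esqrt_mono: "x \<le> y \<Longrightarrow> esqrt x \<le> esqrt y"
  by (simp add: esqrt_le_iff)

lemma esqrt_eq_0_iff [simp]: "esqrt x = 0 \<longleftrightarrow> x = 0"
  by (metis esqrt_power2 esqrt_unique zero_power2)

lemma esqrt_less_top [simp]: "esqrt x < top \<longleftrightarrow> x < top"
  by (cases x) (auto simp: esqrt_def)

lemma L2norm_on_power2: "(L2norm_on M f)\<^sup>2 = (\<integral>\<^sup>+ x. ennreal ((cmod (f x))\<^sup>2) \<partial>M)"
  by (simp add: L2norm_on_def)

lemma L2norm_on_cong_AE: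
  assumes "AE x in M. f x = g x"
  shows "L2norm_on M f = L2norm_on M g"
  unfolding L2norm_on_def using assms by (intro arg_cong[where f=esqrt] nn_integral_cong_AE) auto

lemma L2norm_on_minus_commute: "L2norm_on M (\<lambda>x. f x - g x) = L2norm_on M (\<lambda>x. g x - f x)"
  by (simp add: L2norm_on_def norm_minus_commute)

text \<open>Minkowski's inequality: the cross term of the expanded square is bounded by Cauchy-Schwarz.\<close>

lemma L2norm_on_triangle:
  assumes [measurable]: "f \<in> borel_measurable M" "g \<in> borel_measurable M"
  shows "L2norm_on M (\<lambda>x. f x + g x) \<le> L2norm_on M f + L2norm_on M g"
proof -
  let ?a = "\<lambda>x. ennreal (cmod (f x))" and ?b = "\<lambda>x. ennreal (cmod (g x))"
  have cs: "(\<integral>\<^sup>+ x. ?a x * ?b x \<partial>M) \<le> L2norm_on M f * L2norm_on M g"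
    using Cauchy_Schwarz_nn_integral[of ?a M ?b]
    by (subst power2_le_iff_ennreal[symmetric])
       (simp add: power_mult_distrib L2norm_on_power2 ennreal_power)
  have "(\<integral>\<^sup>+ x. ennreal ((cmod (f x + g x))\<^sup>2) \<partial>M)
      \<le> (\<integral>\<^sup>+ x. ?a x ^ 2 + ?b x ^ 2 + 2 * (?a x * ?b x) \<partial>M)"
  proof (rule nn_integral_mono)
    fix x
    have "(cmod (f x + g x))\<^sup>2 \<le> (cmod (f x) + cmod (g x))\<^sup>2"
      by (intro power_mono norm_triangle_ineq) auto
    also have "\<dots> = (cmod (f x))\<^sup>2 + (cmod (g x))\<^sup>2 + 2 * (cmod (f x) * cmod (g x))"
      by (simp add: power2_sum)
    finally have "ennreal ((cmod (f x + g x))\<^sup>2) \<le> ennreal ((cmod (f x))\<^sup>2 + (cmod (g x))\<^sup>2 + 2 * (cmod (f x) * cmod (g x)))"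
      by (rule ennreal_leI)
    also have "\<dots> = ?a x ^ 2 + ?b x ^ 2 + 2 * (?a x * ?b x)"
      by (simp add: ennreal_power ennreal_mult ennreal_numeral)
    finally show "ennreal ((cmod (f x + g x))\<^sup>2) \<le> ?a x ^ 2 + ?b x ^ 2 + 2 * (?a x * ?b x)" .
  qed
  also have "\<dots> = (L2norm_on M f)\<^sup>2 + (L2norm_on M g)\<^sup>2 + 2 * (\<integral>\<^sup>+ x. ?a x * ?b x \<partial>M)"
    by (simp add: nn_integral_add nn_integral_cmult L2norm_on_power2 ennreal_power)
  also have "\<dots> \<le> (L2norm_on M f)\<^sup>2 + (L2norm_on M g)\<^sup>2 + 2 * (L2norm_on M f * L2norm_on M g)"
    by (intro add_left_mono mult_left_mono cs) auto
  also have "\<dots> = (L2norm_on M f + L2norm_on M g)\<^sup>2"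
    by (simp add: power2_eq_square algebra_simps mult_2)
  finally show ?thesis
    unfolding L2norm_on_def[of M "\<lambda>x. f x + g x"] by (simp add: esqrt_le_iff)
qed

lemma L2norm_on_triangle_diff:
  assumes [measurable]: "f \<in> borel_measurable M" "g \<in> borel_measurable M" "h \<in> borel_measurable M"
  shows "L2norm_on M (\<lambda>x. f x - h x) \<le> L2norm_on M (\<lambda>x. f x - g x) + L2norm_on M (\<lambda>x. g x - h x)"
  using L2norm_on_triangle[of "\<lambda>x. f x - g x" M "\<lambda>x. g x - h x"] by simp

lemma L2norm_on_mono:
  assumes "AE x in M. cmod (f x) \<le> cmod (g x)"
  shows "L2norm_on M f \<le> L2norm_on M g"
  unfolding L2norm_on_def using assms
  by (intro esqrt_mono nn_integral_mono_AE) (auto elim!: eventually_mono intro!: ennreal_leI power_mono)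

lemma L2norm_on_eq_0D:
  assumes [measurable]: "f \<in> borel_measurable M" and "L2norm_on M f = 0"
  shows "AE x in M. f x = 0"
  using assms(2) by (simp add: L2norm_on_def nn_integral_0_iff_AE)

text \<open>Finiteness of the limit makes the truncated subtraction in the lower bound continuous.\<close>

lemma L2norm_on_tendsto:
  assumes [measurable]: "\<And>n. F n \<in> borel_measurable M" "f \<in> borel_measurable M"
    and lim: "(\<lambda>n. L2norm_on M (\<lambda>x. F n x - f x)) \<longlonglongrightarrow> 0" and fin: "L2norm_on M f < \<infinity>"
  shows "(\<lambda>n. L2norm_on M (F n)) \<longlonglongrightarrow> L2norm_on M f"
proof (rule tendsto_sandwich)
  have "L2norm_on M f \<le> L2norm_on M (\<lambda>x. F n x - f x) + L2norm_on M (F n)" for n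
    using L2norm_on_triangle[of "\<lambda>x. f x - F n x" M "F n"] L2norm_on_minus_commute[of M f "F n"] by simp
  then show "\<forall>\<^sub>F n in sequentially. L2norm_on M f - L2norm_on M (\<lambda>x. F n x - f x) \<le> L2norm_on M (F n)"
    using fin by (intro always_eventually allI) (auto simp: ennreal_minus_le_iff)
  show "\<forall>\<^sub>F n in sequentially. L2norm_on M (F n) \<le> L2norm_on M f + L2norm_on M (\<lambda>x. F n x - f x)"
  proof (intro always_eventually allI)
    fix n show "L2norm_on M (F n) \<le> L2norm_on M f + L2norm_on M (\<lambda>x. F n x - f x)"
      using L2norm_on_triangle[of "\<lambda>x. F n x - f x" M f] by (simp add: add.commute)
  qed
  show "(\<lambda>n. L2norm_on M f - L2norm_on M (\<lambda>x. F n x - f x)) \<longlonglongrightarrow> L2norm_on M f"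
    using tendsto_diff_ennreal[OF tendsto_const lim, of "L2norm_on M f"] fin by simp
  show "(\<lambda>n. L2norm_on M f + L2norm_on M (\<lambda>x. F n x - f x)) \<longlonglongrightarrow> L2norm_on M f"
    using tendsto_add[OF tendsto_const lim, of "L2norm_on M f"] by simp
qed

lemma L2norm_on_limit_unique:
  assumes [measurable]: "\<And>n. F n \<in> borel_measurable M" "f \<in> borel_measurable M" "g \<in> borel_measurable M"
    and f: "(\<lambda>n. L2norm_on M (\<lambda>x. F n x - f x)) \<longlonglongrightarrow> 0"
    and g: "(\<lambda>n. L2norm_on M (\<lambda>x. F n x - g x)) \<longlonglongrightarrow> 0"
  shows "AE x in M. f x = g x"
proof -
  have "L2norm_on M (\<lambda>x. f x - g x) \<le> L2norm_on M (\<lambda>x. F n x - f x) + L2norm_on M (\<lambda>x. F n x - g x)" for n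
    using L2norm_on_triangle_diff[of f M "F n" g] L2norm_on_minus_commute[of M f "F n"] by simp
  moreover have "(\<lambda>n. L2norm_on M (\<lambda>x. F n x - f x) + L2norm_on M (\<lambda>x. F n x - g x)) \<longlonglongrightarrow> 0"
    using tendsto_add[OF f g] by simp
  ultimately have "L2norm_on M (\<lambda>x. f x - g x) \<le> 0"
    by (intro LIMSEQ_le_const[of _ 0]) auto
  then show ?thesis
    using L2norm_on_eq_0D[of "\<lambda>x. f x - g x" M] by simp
qed

lemma L2norm_on_tendsto_0_iff:
  "(\<lambda>n. L2norm_on M (F n)) \<longlonglongrightarrow> 0 \<longleftrightarrow> (\<lambda>n. \<integral>\<^sup>+ x. ennreal ((cmod (F n x))\<^sup>2) \<partial>M) \<longlonglongrightarrow> 0"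
  (is "_ \<longleftrightarrow> ?E \<longlonglongrightarrow> 0")
proof
  assume *: "?E \<longlonglongrightarrow> 0"
  show "(\<lambda>n. L2norm_on M (F n)) \<longlonglongrightarrow> 0"
  proof (rule order_tendstoI)
    fix e :: ennreal assume "0 < e"
    then have "0 < e\<^sup>2" by (metis esqrt_eq_0_iff esqrt_unique not_gr_zero)
    with * have "eventually (\<lambda>n. ?E n < e\<^sup>2) sequentially" by (rule order_tendstoD)
    then show "eventually (\<lambda>n. L2norm_on M (F n) < e) sequentially"
      unfolding L2norm_on_def by eventually_elim (metis le_esqrt_iff leD leI)
  qed auto
next
  assume "(\<lambda>n. L2norm_on M (F n)) \<longlonglongrightarrow> 0"
  then have "(\<lambda>n. L2norm_on M (F n) * L2norm_on M (F n)) \<longlonglongrightarrow> 0 * 0"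
    by (intro tendsto_mult_ennreal) auto
  then show "?E \<longlonglongrightarrow> 0"
    by (simp add: L2norm_on_power2 flip: power2_eq_square)
qed


text \<open>
  Riesz-Fischer. A subsequence with distances below \<open>2\<^sup>-\<^sup>k\<close> converges almost everywhere, because its
  increments are square summable even with weights \<open>2\<^sup>k\<close>; Fatou's lemma turns the pointwise limit into
  a limit in the seminorm.
\<close>

lemma L2norm_on_Cauchy_imp_limit:
  assumes [measurable]: "\<And>n::nat. F n \<in> borel_measurable M"
    and fin: "\<And>n. L2norm_on M (F n) < \<infinity>"
    and Cauchy: "\<And>e. 0 < e \<Longrightarrow> \<exists>N. \<forall>m\<ge>N. \<forall>n\<ge>N. L2norm_on M (\<lambda>x. F m x - F n x) \<le> e"
  shows "\<exists>g\<in>borel_measurable M. L2norm_on M g < \<infinity> \<and> (\<lambda>n. L2norm_on M (\<lambda>x. F n x - g x)) \<longlonglongrightarrow> 0"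
proof -
  define P where "P k N \<longleftrightarrow> (\<forall>m\<ge>N. \<forall>n\<ge>N. L2norm_on M (\<lambda>x. F m x - F n x) \<le> ennreal ((1/2)^k))" for k and N :: nat
  have "\<exists>N. P k N" for k
    using Cauchy[of "ennreal ((1/2)^k)"] by (auto simp: P_def)
  then obtain N where N: "\<And>k. P k (N k)" by metis
  define r where "r k = (\<Sum>j\<le>k. N j)" for k
  have Nr: "N k \<le> r k" for k
    unfolding r_def by (rule member_le_sum) auto
  have r_mono: "r k \<le> r (Suc k)" for k by (simp add: r_def)
  have P: "L2norm_on M (\<lambda>x. F m x - F n x) \<le> ennreal ((1/2)^k)" if "m \<ge> r k" "n \<ge> r k" for m n k
    using N[of k] that Nr[of k] unfolding P_def by (meson order_trans)
  define d where "d k x = cmod (F (r (Suc k)) x - F (r k) x)" for k x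
  have [measurable]: "d k \<in> borel_measurable M" for k unfolding d_def by simp
  have "(\<integral>\<^sup>+ x. (\<Sum>k. ennreal (2^k * (d k x)\<^sup>2)) \<partial>M) = (\<Sum>k. \<integral>\<^sup>+ x. ennreal (2^k * (d k x)\<^sup>2) \<partial>M)"
    by (rule nn_integral_suminf) simp
  also have "\<dots> \<le> (\<Sum>k. ennreal ((1/2)^k))"
  proof (rule suminf_le)
    fix k
    have "(\<integral>\<^sup>+ x. ennreal (2^k * (d k x)\<^sup>2) \<partial>M) = ennreal (2^k) * (L2norm_on M (\<lambda>x. F (r (Suc k)) x - F (r k) x))\<^sup>2"
      by (simp add: d_def L2norm_on_power2 ennreal_mult nn_integral_cmult)
    also have "\<dots> \<le> ennreal (2^k) * (ennreal ((1/2)^k))\<^sup>2"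
      by (intro mult_left_mono power_mono P) (auto simp: r_mono)
    also have "\<dots> = ennreal ((1/2)^k)"
      by (simp add: ennreal_power power2_eq_square flip: ennreal_mult power_mult_distrib)
    finally show "(\<integral>\<^sup>+ x. ennreal (2^k * (d k x)\<^sup>2) \<partial>M) \<le> ennreal ((1/2)^k)" .
  qed auto
  also have "\<dots> = ennreal (\<Sum>k. (1/2)^k)"
    by (intro suminf_ennreal2) auto
  also have "\<dots> < \<infinity>" by simp
  finally have "(\<integral>\<^sup>+ x. (\<Sum>k. ennreal (2^k * (d k x)\<^sup>2)) \<partial>M) \<noteq> \<infinity>" by simp
  then have "AE x in M. (\<Sum>k. ennreal (2^k * (d k x)\<^sup>2)) \<noteq> \<infinity>"
    by (intro nn_integral_PInf_AE) auto
  then have AE_conv: "AE x in M. convergent (\<lambda>k. F (r k) x)"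
  proof eventually_elim
    fix x assume fin_sum: "(\<Sum>k. ennreal (2^k * (d k x)\<^sup>2)) \<noteq> \<infinity>"
    have sq: "summable (\<lambda>k. 2^k * (d k x)\<^sup>2)"
      by (rule summable_suminf_not_top) (use fin_sum in auto)
    have "summable (\<lambda>k. 2^k * (d k x)\<^sup>2 + (1/2)^k :: real)"
      using sq by (intro summable_add) auto
    then have "summable (\<lambda>k. d k x)"
    proof (rule summable_comparison_test_ev[rotated])
      have "d k x \<le> 2^k * (d k x)\<^sup>2 + (1/2)^k" for k
      proof -
        have d: "d k x = (2^k * d k x) * (1/2)^k" by (simp flip: power_mult_distrib add: mult.assoc mult.left_commute)
        \<comment> \<open>Bounds \<open>d\<close> by its weighted square plus a geometric term, so that square summability with weights gives absolute summability.\<close>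
        have "y \<le> y\<^sup>2 + 1" if "0 \<le> y" for y :: real
          using zero_le_power2[of "y - 1"] that by (simp add: power2_diff)
        then have "2^k * d k x \<le> (2^k * d k x)\<^sup>2 + 1" by (simp add: d_def)
        then have "(2^k * d k x) * (1/2)^k \<le> ((2^k * d k x)\<^sup>2 + 1) * (1/2)^k"
          by (rule mult_right_mono) auto
        also have "\<dots> = 2^k * (d k x)\<^sup>2 + (1/2)^k"
          by (simp add: field_simps power2_eq_square)
        finally show ?thesis using d by simp
      qed
      then show "\<forall>\<^sub>F k in sequentially. norm (d k x) \<le> 2^k * (d k x)\<^sup>2 + (1/2)^k"
        by (simp add: d_def)
    qed
    then have "summable (\<lambda>k. F (r (Suc k)) x - F (r k) x)"
      unfolding d_def by (rule summable_norm_cancel)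
    then have "convergent (\<lambda>n. \<Sum>k<n. F (r (Suc k)) x - F (r k) x)"
      by (simp add: summable_iff_convergent)
    then show "convergent (\<lambda>k. F (r k) x)"
      by (simp add: sum_lessThan_telescope[of "\<lambda>k. F (r k) x"] convergent_diff_const_right_iff)
  qed
  define g where "g x = lim (\<lambda>k. F (r k) x)" for x
  have [measurable]: "g \<in> borel_measurable M"
    unfolding g_def by (rule borel_measurable_lim_metric) simp
  have AE_lim: "AE x in M. (\<lambda>k. F (r k) x) \<longlonglongrightarrow> g x"
    using AE_conv unfolding g_def by eventually_elim (simp add: convergent_LIMSEQ_iff)
  have close: "L2norm_on M (\<lambda>x. F m x - g x) \<le> ennreal ((1/2)^k)" if m: "m \<ge> r k" for m k
  proof -
    have "(\<integral>\<^sup>+ x. ennreal ((cmod (F m x - g x))\<^sup>2) \<partial>M)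
        = (\<integral>\<^sup>+ x. liminf (\<lambda>j. ennreal ((cmod (F m x - F (r j) x))\<^sup>2)) \<partial>M)"
      using AE_lim
    proof (intro nn_integral_cong_AE, eventually_elim)
      fix x assume "(\<lambda>k. F (r k) x) \<longlonglongrightarrow> g x"
      then have "(\<lambda>j. ennreal ((cmod (F m x - F (r j) x))\<^sup>2)) \<longlonglongrightarrow> ennreal ((cmod (F m x - g x))\<^sup>2)"
        by (intro tendsto_intros)
      from lim_imp_Liminf[OF sequentially_bot this]
      show "ennreal ((cmod (F m x - g x))\<^sup>2) = liminf (\<lambda>j. ennreal ((cmod (F m x - F (r j) x))\<^sup>2))"
        by (rule sym)
    qed
    also have "\<dots> \<le> liminf (\<lambda>j. \<integral>\<^sup>+ x. ennreal ((cmod (F m x - F (r j) x))\<^sup>2) \<partial>M)"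
      by (rule nn_integral_liminf) simp
    also have "\<dots> \<le> (ennreal ((1/2)^k))\<^sup>2"
    proof (rule Liminf_le)
      show "\<forall>\<^sub>F j in sequentially. (\<integral>\<^sup>+ x. ennreal ((cmod (F m x - F (r j) x))\<^sup>2) \<partial>M) \<le> (ennreal ((1/2)^k))\<^sup>2"
        using eventually_ge_at_top[of k]
      proof eventually_elim
        fix j assume "k \<le> j"
        then have "r k \<le> r j" using r_mono by (rule lift_Suc_mono_le[rotated])
        then show "(\<integral>\<^sup>+ x. ennreal ((cmod (F m x - F (r j) x))\<^sup>2) \<partial>M) \<le> (ennreal ((1/2)^k))\<^sup>2"
          unfolding L2norm_on_power2[symmetric] by (intro power_mono P m) auto
      qed
    qed simp
    finally show ?thesis
      by (simp add: L2norm_on_def esqrt_le_iff)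
  qed
  show ?thesis
  proof (intro bexI conjI)
    have "L2norm_on M g \<le> L2norm_on M (\<lambda>x. F (r 0) x - g x) + L2norm_on M (F (r 0))"
      using L2norm_on_triangle[of "\<lambda>x. g x - F (r 0) x" M "F (r 0)"] L2norm_on_minus_commute[of M g "F (r 0)"] by simp
    also have "\<dots> < \<infinity>"
      using close[of 0 "r 0"] fin[of "r 0"] by (auto simp: ennreal_add_less_top intro: le_less_trans)
    finally show "L2norm_on M g < \<infinity>" .
    show "(\<lambda>n. L2norm_on M (\<lambda>x. F n x - g x)) \<longlonglongrightarrow> 0"
    proof (rule order_tendstoI)
      fix e :: ennreal assume e: "0 < e"
      have "(\<lambda>k. ennreal ((1/2)^k)) \<longlonglongrightarrow> 0"
        by (subst ennreal_tendsto_0_iff) (auto intro: LIMSEQ_realpow_zero)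
      then have "eventually (\<lambda>k. ennreal ((1/2)^k) < e) sequentially"
        using e by (rule order_tendstoD)
      then obtain k where "ennreal ((1/2)^k) < e" by (auto simp: eventually_sequentially)
      then show "eventually (\<lambda>n. L2norm_on M (\<lambda>x. F n x - g x) < e) sequentially"
        using close[of k] by (auto simp: eventually_sequentially intro!: exI[of _ "r k"] intro: le_less_trans)
    qed auto
  qed fact
qed


section \<open>The Fourier transform of integrable functions\<close>

lemma nn_integral_lborel_affine:
  fixes f :: "'a::euclidean_space \<Rightarrow> ennreal"
  assumes [measurable]: "f \<in> borel_measurable borel" and "c \<noteq> 0"
  shows "(\<integral>\<^sup>+ x. f x \<partial>lborel) = ennreal (\<bar>c\<bar> ^ DIM('a)) * (\<integral>\<^sup>+ x. f (t + c *\<^sub>R x) \<partial>lborel)"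
  by (subst lborel_affine[OF \<open>c \<noteq> 0\<close>, of t])
     (simp add: nn_integral_density nn_integral_distr nn_integral_cmult)

lemma integrable_lborel_affine_iff:
  fixes f :: "'a::euclidean_space \<Rightarrow> 'b::{banach, second_countable_topology}"
  assumes [measurable]: "f \<in> borel_measurable borel" and "c \<noteq> 0"
  shows "integrable lborel (\<lambda>x. f (t + c *\<^sub>R x)) \<longleftrightarrow> integrable lborel f"
  using \<open>c \<noteq> 0\<close> unfolding integrable_iff_bounded
  by (subst (2) nn_integral_lborel_affine[where c=c and t=t]) (auto simp: ennreal_mult_less_top)

lemma integral_lborel_affine:
  fixes f :: "'a::euclidean_space \<Rightarrow> 'b::{banach, second_countable_topology}"
  assumes [measurable]: "f \<in> borel_measurable borel" and "c \<noteq> 0"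
  shows "(\<integral>x. f x \<partial>lborel) = (\<bar>c\<bar> ^ DIM('a)) *\<^sub>R (\<integral>x. f (t + c *\<^sub>R x) \<partial>lborel)"
  by (subst lborel_affine[OF \<open>c \<noteq> 0\<close>, of t])
     (simp add: integral_density integral_distr)

lemma nn_integral_lborel_shift:
  fixes f :: "'a::euclidean_space \<Rightarrow> ennreal"
  assumes "f \<in> borel_measurable borel"
  shows "(\<integral>\<^sup>+ x. f (x - a) \<partial>lborel) = (\<integral>\<^sup>+ x. f x \<partial>lborel)"
  using nn_integral_lborel_affine[OF assms, of 1 "-a"] by simp

lemma nn_integral_lborel_reflect:
  fixes f :: "'a::euclidean_space \<Rightarrow> ennreal"
  assumes "f \<in> borel_measurable borel"
  shows "(\<integral>\<^sup>+ x. f (a - x) \<partial>lborel) = (\<integral>\<^sup>+ x. f x \<partial>lborel)"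
  using nn_integral_lborel_affine[OF assms, of "-1" "a"] by simp

text \<open>
  The character through which the Fourier transform is defined, written out so that it unifies
  with the unfolded definition.
\<close>

abbreviation wave :: "real^2 \<Rightarrow> real^2 \<Rightarrow> complex" where
  "wave x \<xi> \<equiv> exp (- 2 * pi * \<i> * complex_of_real (x \<bullet> \<xi>))"

lemma cmod_wave [simp]: "cmod (wave x \<xi>) = 1"
  by (simp add: norm_exp_eq_Re)

lemma wave_add: "wave (x + y) \<xi> = wave x \<xi> * wave y \<xi>"
  by (simp add: inner_add_left distrib_left exp_add[symmetric] algebra_simps)

lemma borel_measurable_fourier [measurable]:
  assumes [measurable]: "f \<in> borel_measurable borel"
  shows "fourier f \<in> borel_measurable borel"
proof -
  have "(\<lambda>\<xi>. \<integral> x. wave x \<xi> * f x \<partial>lborel) \<in> borel_measurable borel"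
    by (rule lborel.borel_measurable_lebesgue_integral) measurable
  then show ?thesis by (simp add: fourier_def[abs_def])
qed

lemma integrable_wave_mult:
  assumes "integrable lborel f"
  shows "integrable lborel (\<lambda>x. wave x \<xi> * f x)"
proof (rule Bochner_Integration.integrable_bound[OF assms])
  have [measurable]: "f \<in> borel_measurable borel" using assms by auto
  show "(\<lambda>x. wave x \<xi> * f x) \<in> borel_measurable lborel" by measurable
qed (simp add: norm_mult)

lemma cmod_fourier_le: "cmod (fourier f \<xi>) \<le> (\<integral>x. cmod (f x) \<partial>lborel)"
proof -
  have "cmod (fourier f \<xi>) \<le> (\<integral>x. cmod (wave x \<xi> * f x) \<partial>lborel)"
    unfolding fourier_def by (rule integral_norm_bound)
  then show ?thesis by (simp add: norm_mult)
qed

lemma fourier_diff: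
  assumes "integrable lborel f" "integrable lborel g"
  shows "fourier (\<lambda>x. f x - g x) \<xi> = fourier f \<xi> - fourier g \<xi>"
  using integrable_wave_mult[OF assms(1), of \<xi>] integrable_wave_mult[OF assms(2), of \<xi>]
  by (simp add: fourier_def right_diff_distrib)

lemma integrable_pair_mult:
  fixes f g :: "real^2 \<Rightarrow> complex"
  assumes f: "integrable lborel f" and g: "integrable lborel g"
  shows "integrable (lborel \<Otimes>\<^sub>M lborel) (\<lambda>(x, y). f x * g y)"
proof (rule lborel_pair.Fubini_integrable)
  have [measurable]: "f \<in> borel_measurable borel" "g \<in> borel_measurable borel" using f g by auto
  show "(\<lambda>(x, y). f x * g y) \<in> borel_measurable (lborel \<Otimes>\<^sub>M lborel)" by measurable
  show "integrable lborel (\<lambda>x. \<integral> y. norm (case (x, y) of (x, y) \<Rightarrow> f x * g y) \<partial>lborel)"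
    using f by (simp add: norm_mult)
  show "AE x in lborel. integrable lborel (\<lambda>y. case (x, y) of (x, y) \<Rightarrow> f x * g y)"
    using g by simp
qed

text \<open>
  Both sides are the double integral of \<open>f x * g \<xi>\<close> against the symmetric kernel
  \<open>exp (- 2 \<pi> \<i> x \<bullet> \<xi>)\<close>.
\<close>

lemma fourier_multiplication_formula:
  assumes f: "integrable lborel f" and g: "integrable lborel g"
  shows "(\<integral>\<xi>. fourier f \<xi> * g \<xi> \<partial>lborel) = (\<integral>x. f x * fourier g x \<partial>lborel)"
proof -
  have [measurable]: "f \<in> borel_measurable borel" "g \<in> borel_measurable borel" using f g by auto
  have int: "integrable (lborel \<Otimes>\<^sub>M lborel) (\<lambda>(x, \<xi>). wave x \<xi> * f x * g \<xi>)"
    by (rule Bochner_Integration.integrable_bound[OF integrable_pair_mult[OF f g]])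
       (auto simp: norm_mult split_beta')
  have "(\<integral>\<xi>. fourier f \<xi> * g \<xi> \<partial>lborel) = (\<integral>\<xi>. (\<integral>x. wave x \<xi> * f x * g \<xi> \<partial>lborel) \<partial>lborel)"
    by (simp add: fourier_def)
  also have "\<dots> = (\<integral>x. (\<integral>\<xi>. wave x \<xi> * f x * g \<xi> \<partial>lborel) \<partial>lborel)"
    by (rule lborel_pair.Fubini_integral[OF int])
  also have "\<dots> = (\<integral>x. f x * fourier g x \<partial>lborel)"
    by (simp add: fourier_def inner_commute mult.assoc mult.left_commute flip: integral_mult_right_zero)
  finally show ?thesis .
qed

lemma integrable_convol_kernel:
  assumes f: "integrable lborel f" and g: "integrable lborel g"
  shows "integrable (lborel \<Otimes>\<^sub>M lborel) (\<lambda>(y :: real^2, x). f y * g (x - y) :: complex)"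
proof (rule lborel_pair.Fubini_integrable)
  have [measurable]: "f \<in> borel_measurable borel" "g \<in> borel_measurable borel" using f g by auto
  have s: "integrable lborel (\<lambda>x. g (x - y))" for y
    using integrable_lborel_affine_iff[of g 1 "-y"] g by simp
  have "(\<integral>x. norm (g (x - y)) \<partial>lborel) = (\<integral>x. norm (g x) \<partial>lborel)" for y
    using integral_lborel_affine[of "\<lambda>x. complex_of_real (norm (g x))" 1 "-y"] by simp
  then show "integrable lborel (\<lambda>y. \<integral> x. norm (case (y, x) of (y, x) \<Rightarrow> f y * g (x - y)) \<partial>lborel)"
    using f by (simp add: norm_mult)
  show "(\<lambda>(y, x). f y * g (x - y)) \<in> borel_measurable (lborel \<Otimes>\<^sub>M lborel)" by measurable
  show "AE y in lborel. integrable lborel (\<lambda>x. case (y, x) of (y, x) \<Rightarrow> f y * g (x - y))"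
    using s by simp
qed

lemma borel_measurable_convol [measurable]:
  assumes [measurable]: "f \<in> borel_measurable borel" "g \<in> borel_measurable borel"
  shows "convol f g \<in> borel_measurable borel"
proof -
  have "(\<lambda>x. \<integral> y. f y * g (x - y) \<partial>lborel) \<in> borel_measurable borel"
    by (rule lborel.borel_measurable_lebesgue_integral) measurable
  then show ?thesis by (simp add: convol_def[abs_def])
qed

lemma integrable_convol:
  assumes "integrable lborel f" "integrable lborel g"
  shows "integrable lborel (convol f g)"
  using lborel_pair.integrable_snd[OF integrable_convol_kernel[OF assms]]
  by (simp add: convol_def[abs_def])

lemma fourier_convol:
  assumes f: "integrable lborel f" and g: "integrable lborel g"
  shows "fourier (convol f g) \<xi> = fourier f \<xi> * fourier g \<xi>"
proof -
  have [measurable]: "f \<in> borel_measurable borel" "g \<in> borel_measurable borel" using f g by auto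
  have int: "integrable (lborel \<Otimes>\<^sub>M lborel) (\<lambda>(y, x). wave x \<xi> * (f y * g (x - y)))"
    by (rule Bochner_Integration.integrable_bound[OF integrable_convol_kernel[OF f g]])
       (auto simp: norm_mult split_beta')
  have shift: "(\<integral>x. wave x \<xi> * g (x - y) \<partial>lborel) = wave y \<xi> * fourier g \<xi>" for y
  proof -
    have "(\<integral>x. wave x \<xi> * g (x - y) \<partial>lborel) = (\<integral>x. wave (y + x) \<xi> * g x \<partial>lborel)"
      using integral_lborel_affine[of "\<lambda>x. wave x \<xi> * g (x - y)" 1 y] by simp
    also have "\<dots> = (\<integral>x. wave y \<xi> * (wave x \<xi> * g x) \<partial>lborel)"
      by (intro Bochner_Integration.integral_cong refl, subst wave_add) simp
    finally show ?thesis
      by (simp add: fourier_def)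
  qed
  have "fourier (convol f g) \<xi> = (\<integral>x. (\<integral>y. wave x \<xi> * (f y * g (x - y)) \<partial>lborel) \<partial>lborel)"
    by (simp add: fourier_def convol_def)
  also have "\<dots> = (\<integral>y. (\<integral>x. wave x \<xi> * (f y * g (x - y)) \<partial>lborel) \<partial>lborel)"
    by (rule lborel_pair.Fubini_integral[OF int])
  also have "\<dots> = (\<integral>y. f y * (\<integral>x. wave x \<xi> * g (x - y) \<partial>lborel) \<partial>lborel)"
    by (simp add: mult.left_commute)
  also have "\<dots> = (\<integral>y. wave y \<xi> * f y * fourier g \<xi> \<partial>lborel)"
    by (simp only: shift) (simp add: mult_ac)
  also have "\<dots> = fourier f \<xi> * fourier g \<xi>"
    by (simp add: fourier_def)
  finally show ?thesis .
qed

text \<open>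
  The characteristic function of the standard normal distribution, rescaled by
  \<open>x = \<epsilon> * sqrt (2 * pi) * y\<close>.
\<close>

lemma gaussian_fourier_real:
  fixes z \<epsilon> :: real
  assumes "0 < \<epsilon>"
  shows "has_bochner_integral lborel
           (\<lambda>y. exp (- 2 * pi * \<i> * complex_of_real (z * y)) * complex_of_real (exp (- pi * \<epsilon>\<^sup>2 * y\<^sup>2)))
           (complex_of_real (exp (- pi * z\<^sup>2 / \<epsilon>\<^sup>2) / \<epsilon>))"
proof -
  \<comment> \<open>The frequency that corresponds to \<open>z\<close> after the substitution \<open>x = c * y\<close>.\<close>
  define t where "t = - sqrt (2 * pi) * z / \<epsilon>"
  define c where "c = \<epsilon> * sqrt (2 * pi)"
  have c: "c \<noteq> 0" "\<bar>c\<bar> = c" using assms by (auto simp: c_def)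
  let ?h = "\<lambda>x. std_normal_density x *\<^sub>R iexp (t * x)"
  have int: "integrable lborel ?h"
  proof (rule Bochner_Integration.integrable_bound)
    show "integrable lborel std_normal_density" by (rule integrable_normal_density) simp
  qed (auto simp: normal_density_nonneg)
  have "(\<integral>x. ?h x \<partial>lborel) = char std_normal_distribution t"
    by (simp add: char_def integral_density normal_density_nonneg)
  also have "\<dots> = complex_of_real (exp (- pi * z\<^sup>2 / \<epsilon>\<^sup>2))"
    by (simp add: char_std_normal_distribution t_def power_divide power_mult_distrib)
  finally have "has_bochner_integral lborel ?h (complex_of_real (exp (- pi * z\<^sup>2 / \<epsilon>\<^sup>2)))"
    using int by (simp add: has_bochner_integral_iff)
  then have "has_bochner_integral lborel (\<lambda>y. ?h (0 + c * y)) (complex_of_real (exp (- pi * z\<^sup>2 / \<epsilon>\<^sup>2)) /\<^sub>R \<bar>c\<bar>)"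
    by (subst (asm) lborel_has_bochner_integral_real_affine_iff[of c _ _ 0]) (use c in auto)
  then have *: "has_bochner_integral lborel (\<lambda>y. complex_of_real (sqrt (2 * pi)) * ?h (c * y))
      (complex_of_real (sqrt (2 * pi)) * (complex_of_real (exp (- pi * z\<^sup>2 / \<epsilon>\<^sup>2)) /\<^sub>R c))"
    unfolding c(2) by (intro has_bochner_integral_mult_right) simp
  have tc: "t * (c * y) = - 2 * pi * z * y" for y
    using assms by (simp add: t_def c_def field_simps)
  have cc: "(c * y)\<^sup>2 / 2 = pi * \<epsilon>\<^sup>2 * y\<^sup>2" for y
    by (simp add: c_def power_mult_distrib)
  have "complex_of_real (sqrt (2 * pi)) * ?h (c * y) =
     exp (- 2 * pi * \<i> * complex_of_real (z * y)) * complex_of_real (exp (- pi * \<epsilon>\<^sup>2 * y\<^sup>2))" for y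
    unfolding std_normal_density_def tc minus_divide_left[symmetric] cc
    by (simp add: scaleR_conv_of_real mult_ac flip: exp_of_real)
  moreover have "complex_of_real (sqrt (2 * pi)) * (complex_of_real (exp (- pi * z\<^sup>2 / \<epsilon>\<^sup>2)) /\<^sub>R c)
     = complex_of_real (exp (- pi * z\<^sup>2 / \<epsilon>\<^sup>2) / \<epsilon>)"
    using assms by (simp add: c_def scaleR_conv_of_real field_simps)
  ultimately show ?thesis using * by simp
qed

text \<open>Both the Gaussian and the character factor over the coordinates.\<close>

lemma gaussian_fourier:
  fixes z :: "real^2"
  assumes "0 < \<epsilon>"
  shows "integrable lborel (\<lambda>x::real^2. complex_of_real (exp (- pi * \<epsilon>\<^sup>2 * (norm x)\<^sup>2)))"
    and "fourier (\<lambda>x. complex_of_real (exp (- pi * \<epsilon>\<^sup>2 * (norm x)\<^sup>2))) z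
           = complex_of_real (exp (- pi * (norm z)\<^sup>2 / \<epsilon>\<^sup>2) / \<epsilon>\<^sup>2)"
proof -
  interpret product_sigma_finite "\<lambda>_::real^2. lborel :: real measure" ..
  let ?f = "\<lambda>w (b::real^2) y. exp (- 2 * pi * \<i> * complex_of_real ((w \<bullet> b) * y)) * complex_of_real (exp (- pi * \<epsilon>\<^sup>2 * y\<^sup>2))"
  have f: "integrable lborel (?f w b)" "integral\<^sup>L lborel (?f w b) = complex_of_real (exp (- pi * (w \<bullet> b)\<^sup>2 / \<epsilon>\<^sup>2) / \<epsilon>)" for w b
    using gaussian_fourier_real[OF assms, of "w \<bullet> b"] by (auto simp: has_bochner_integral_iff)
  have nrm: "(norm x)\<^sup>2 = (\<Sum>b\<in>Basis. (x \<bullet> b)\<^sup>2)" for x :: "real^2"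
    by (subst power2_norm_eq_inner, subst euclidean_inner) (simp add: power2_eq_square)
  have prod: "(\<Prod>b\<in>Basis. ?f w b (x \<bullet> b)) = wave x w * complex_of_real (exp (- pi * \<epsilon>\<^sup>2 * (norm x)\<^sup>2))" for x w
    unfolding nrm sum_distrib_left exp_sum[OF finite_Basis] of_real_prod prod.distrib
    by (subst euclidean_inner[of x w])
       (simp add: sum_distrib_left exp_sum mult.commute)
  have comp: "(\<Sum>b\<in>Basis. g b *\<^sub>R b) \<bullet> a = g a" if "a \<in> Basis" for g and a :: "real^2"
    using that by (rule inner_sum_left_Basis)
  have pr: "(\<Prod>a\<in>Basis. ?f w a ((\<Sum>b\<in>Basis. g b *\<^sub>R b) \<bullet> a)) = (\<Prod>a\<in>Basis. ?f w a (g a))" for w g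
    by (rule prod.cong) (simp_all add: comp)
  have int: "integrable lborel (\<lambda>x. \<Prod>b\<in>Basis. ?f w b (x \<bullet> b))" for w
  proof -
    have "integrable (\<Pi>\<^sub>M b\<in>Basis. lborel) (\<lambda>g. \<Prod>a\<in>Basis. ?f w a (g a))"
      by (rule product_integrable_prod[OF finite_Basis f(1)])
    then show ?thesis
      unfolding lborel_eq[where 'a="real^2"]
      by (subst integrable_distr_eq; (simp only: pr)?) auto
  qed
  show "integrable lborel (\<lambda>x::real^2. complex_of_real (exp (- pi * \<epsilon>\<^sup>2 * (norm x)\<^sup>2)))"
    using int[of 0] unfolding prod by simp
  have "fourier (\<lambda>x. complex_of_real (exp (- pi * \<epsilon>\<^sup>2 * (norm x)\<^sup>2))) z = (\<integral>x. (\<Prod>b\<in>Basis. ?f z b (x \<bullet> b)) \<partial>lborel)"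
    by (simp only: fourier_def prod)
  also have "\<dots> = (\<integral>g. (\<Prod>a\<in>Basis. ?f z a (g a)) \<partial>(\<Pi>\<^sub>M b\<in>Basis. lborel))"
    unfolding lborel_eq[where 'a="real^2"] by (subst integral_distr; (simp only: pr)?) auto
  also have "\<dots> = (\<Prod>b\<in>Basis. integral\<^sup>L lborel (?f z b))"
    by (rule product_integral_prod[OF finite_Basis f(1)])
  also have "\<dots> = complex_of_real (\<Prod>b\<in>(Basis::(real^2) set). exp (- pi * (z \<bullet> b)\<^sup>2 / \<epsilon>\<^sup>2) / \<epsilon>)"
    unfolding f by simp
  also have "(\<Prod>b\<in>(Basis::(real^2) set). exp (- pi * (z \<bullet> b)\<^sup>2 / \<epsilon>\<^sup>2) / \<epsilon>) = exp (- pi * (norm z)\<^sup>2 / \<epsilon>\<^sup>2) / \<epsilon>\<^sup>2"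
    unfolding prod_dividef nrm by (simp add: sum_distrib_left sum_divide_distrib exp_sum flip: sum_negf)
  finally show "fourier (\<lambda>x. complex_of_real (exp (- pi * \<epsilon>\<^sup>2 * (norm x)\<^sup>2))) z
           = complex_of_real (exp (- pi * (norm z)\<^sup>2 / \<epsilon>\<^sup>2) / \<epsilon>\<^sup>2)" .
qed


section \<open>Continuity of translation in \<open>L\<^sup>1\<close>\<close>

lemma nn_integral_translate_diff_le:
  fixes u v :: "'a::euclidean_space \<Rightarrow> complex"
  assumes [measurable]: "u \<in> borel_measurable borel" "v \<in> borel_measurable borel"
  shows "(\<integral>\<^sup>+ x. ennreal (cmod (u (x - a) - u x)) \<partial>lborel)
      \<le> (\<integral>\<^sup>+ x. ennreal (cmod (v (x - a) - v x)) \<partial>lborel) + 2 * (\<integral>\<^sup>+ x. ennreal (cmod (u x - v x)) \<partial>lborel)"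
proof -
  have "(\<integral>\<^sup>+ x. ennreal (cmod (u (x - a) - u x)) \<partial>lborel)
      \<le> (\<integral>\<^sup>+ x. ennreal (cmod (u (x - a) - v (x - a))) + ennreal (cmod (v (x - a) - v x)) + ennreal (cmod (u x - v x)) \<partial>lborel)"
  proof (rule nn_integral_mono)
    fix x
    have "cmod (u (x - a) - u x) \<le> cmod (u (x - a) - v (x - a)) + cmod (v (x - a) - v x) + cmod (u x - v x)"
      by norm
    then show "ennreal (cmod (u (x - a) - u x)) \<le> ennreal (cmod (u (x - a) - v (x - a))) + ennreal (cmod (v (x - a) - v x)) + ennreal (cmod (u x - v x))"
      by (simp flip: ennreal_plus)
  qed
  also have "\<dots> = (\<integral>\<^sup>+ x. ennreal (cmod (v (x - a) - v x)) \<partial>lborel) + 2 * (\<integral>\<^sup>+ x. ennreal (cmod (u x - v x)) \<partial>lborel)"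
    using nn_integral_lborel_shift[of "\<lambda>x. ennreal (cmod (u x - v x))" a]
    by (simp add: nn_integral_add mult_2 ac_simps)
  finally show ?thesis .
qed

text \<open>Translation is an isometry, so continuity of translation passes to \<open>L\<^sup>1\<close>-limits.\<close>

lemma translate_tendsto_L1_approx:
  fixes u :: "'a::euclidean_space \<Rightarrow> complex"
  assumes [measurable]: "u \<in> borel_measurable borel"
    and approx: "\<And>e. 0 < e \<Longrightarrow> \<exists>v\<in>borel_measurable borel. (\<integral>\<^sup>+ x. ennreal (cmod (u x - v x)) \<partial>lborel) \<le> ennreal e \<and>
         (\<lambda>n. \<integral>\<^sup>+ x. ennreal (cmod (v (x - a n) - v x)) \<partial>lborel) \<longlonglongrightarrow> 0"
  shows "(\<lambda>n. \<integral>\<^sup>+ x. ennreal (cmod (u (x - a n) - u x)) \<partial>lborel) \<longlonglongrightarrow> 0"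
proof (rule order_tendstoI)
  fix e :: ennreal assume "0 < e"
  then obtain d where d: "0 < d" "ennreal d < e"
  proof -
    obtain e' where e': "0 < e'" "e' < e" using dense[OF \<open>0 < e\<close>] by blast
    then have "e' \<noteq> top" by auto
    then show ?thesis using that[of "enn2real e'"] e' by (simp add: enn2real_positive_iff less_top)
  qed
  then obtain v where [measurable]: "v \<in> borel_measurable borel"
    and v: "(\<integral>\<^sup>+ x. ennreal (cmod (u x - v x)) \<partial>lborel) \<le> ennreal (d / 4)"
    and lim: "(\<lambda>n. \<integral>\<^sup>+ x. ennreal (cmod (v (x - a n) - v x)) \<partial>lborel) \<longlonglongrightarrow> 0"
    using approx[of "d / 4"] by auto
  have "eventually (\<lambda>n. (\<integral>\<^sup>+ x. ennreal (cmod (v (x - a n) - v x)) \<partial>lborel) < ennreal (d / 2)) sequentially"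
    using d by (intro order_tendstoD(2)[OF lim]) auto
  then show "eventually (\<lambda>n. (\<integral>\<^sup>+ x. ennreal (cmod (u (x - a n) - u x)) \<partial>lborel) < e) sequentially"
  proof eventually_elim
    fix n assume n: "(\<integral>\<^sup>+ x. ennreal (cmod (v (x - a n) - v x)) \<partial>lborel) < ennreal (d / 2)"
    have "(\<integral>\<^sup>+ x. ennreal (cmod (u (x - a n) - u x)) \<partial>lborel) \<le> ennreal (d / 2) + 2 * ennreal (d / 4)"
      using n by (intro order_trans[OF nn_integral_translate_diff_le[of u v]] add_mono mult_left_mono v) auto
    also have "\<dots> = ennreal d"
      using d by (simp add: ennreal_numeral[symmetric] flip: ennreal_mult ennreal_plus del: ennreal_numeral)
    finally show "(\<integral>\<^sup>+ x. ennreal (cmod (u (x - a n) - u x)) \<partial>lborel) < e" using d by simp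
  qed
qed auto

text \<open>
  For an open set the indicator of \<open>U \<inter> (U + a n)\<close> tends to that of \<open>U\<close> at every point, while
  \<open>U + a n\<close> and \<open>U\<close> have the same measure. Hence the symmetric difference shrinks to measure zero.
\<close>

lemma translate_open_tendsto_L1:
  fixes U :: "'a::euclidean_space set"
  assumes "open U" "emeasure lborel U < \<infinity>" "a \<longlonglongrightarrow> 0"
  shows "(\<lambda>n. \<integral>\<^sup>+ x. ennreal (cmod (indicator U (x - a n) - indicator U x :: complex)) \<partial>lborel) \<longlonglongrightarrow> 0"
proof -
  have [measurable]: "U \<in> sets borel" using assms by auto
  let ?I = "indicator U :: 'a \<Rightarrow> real"
  have int: "integrable lborel ?I" using assms by auto
  have ints: "integrable lborel (\<lambda>x. ?I (x - a n))" for n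
    using integrable_lborel_affine_iff[of ?I 1 "- a n"] int by simp
  have eq_s: "(\<integral>x. ?I (x - a n) \<partial>lborel) = (\<integral>x. ?I x \<partial>lborel)" for n
    using integral_lborel_affine[of ?I 1 "- a n"] by simp
  have intp: "integrable lborel (\<lambda>x. ?I (x - a n) * ?I x)" for n
    by (rule Bochner_Integration.integrable_bound[OF int]) (auto split: split_indicator)
  have "(\<lambda>n. \<integral>x. ?I (x - a n) * ?I x \<partial>lborel) \<longlonglongrightarrow> (\<integral>x. ?I x \<partial>lborel)"
  proof (rule integral_dominated_convergence[OF _ _ int])
    show "AE x in lborel. (\<lambda>n. ?I (x - a n) * ?I x) \<longlonglongrightarrow> ?I x"
    proof (rule AE_I2, cases)
      fix x assume x: "x \<in> U"
      have "(\<lambda>n. x - a n) \<longlonglongrightarrow> x - 0" by (intro tendsto_intros assms)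
      then have "eventually (\<lambda>n. x - a n \<in> U) sequentially"
        using assms x by (simp add: topological_tendstoD)
      then have "eventually (\<lambda>n. ?I (x - a n) * ?I x = ?I x) sequentially"
        by eventually_elim simp
      then show "(\<lambda>n. ?I (x - a n) * ?I x) \<longlonglongrightarrow> ?I x" by (rule tendsto_eventually)
    qed simp
  qed (auto split: split_indicator)
  then have lim: "(\<lambda>n. 2 * (\<integral>x. ?I x \<partial>lborel) - 2 * (\<integral>x. ?I (x - a n) * ?I x \<partial>lborel)) \<longlonglongrightarrow> 2 * (\<integral>x. ?I x \<partial>lborel) - 2 * (\<integral>x. ?I x \<partial>lborel)"
    by (intro tendsto_intros)
  have "(\<integral>\<^sup>+ x. ennreal (cmod (indicator U (x - a n) - indicator U x :: complex)) \<partial>lborel)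
      = ennreal (2 * (\<integral>x. ?I x \<partial>lborel) - 2 * (\<integral>x. ?I (x - a n) * ?I x \<partial>lborel))" for n
  proof -
    have "cmod (indicator U (x - a n) - indicator U x :: complex) = ?I (x - a n) + ?I x - 2 * (?I (x - a n) * ?I x)" for x
      by (auto split: split_indicator)
    then have "(\<integral>\<^sup>+ x. ennreal (cmod (indicator U (x - a n) - indicator U x :: complex)) \<partial>lborel)
      = (\<integral>\<^sup>+ x. ennreal (?I (x - a n) + ?I x - 2 * (?I (x - a n) * ?I x)) \<partial>lborel)" by simp
    also have "\<dots> = ennreal (\<integral>x. ?I (x - a n) + ?I x - 2 * (?I (x - a n) * ?I x) \<partial>lborel)"
      using int ints[of n] intp[of n]
      by (intro nn_integral_eq_integral) (auto split: split_indicator)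
    also have "(\<integral>x. ?I (x - a n) + ?I x - 2 * (?I (x - a n) * ?I x) \<partial>lborel)
        = 2 * (\<integral>x. ?I x \<partial>lborel) - 2 * (\<integral>x. ?I (x - a n) * ?I x \<partial>lborel)"
      using int ints[of n] intp[of n] eq_s[of n]
      by (simp del: Bochner_Integration.integral_indicator integral_indicator)
    finally show ?thesis .
  qed
  then show ?thesis using tendsto_ennrealI[OF lim] by simp
qed

text \<open>
  By linearity and density only indicators of sets of finite measure matter, and outer regularity
  replaces such a set by an open one.
\<close>

lemma translate_tendsto_L1:
  fixes u :: "'a::euclidean_space \<Rightarrow> complex"
  assumes "integrable lborel u" and a: "a \<longlonglongrightarrow> 0"
  shows "(\<lambda>n. \<integral>\<^sup>+ x. ennreal (cmod (u (x - a n) - u x)) \<partial>lborel) \<longlonglongrightarrow> 0"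
  using assms(1)
proof induction
  case (base A c)
  then have [measurable]: "A \<in> sets borel" by simp
  show ?case
  proof (rule translate_tendsto_L1_approx)
    fix e :: real assume "0 < e"
    define d where "d = e / (cmod c + 1)"
    have "0 < cmod c + 1" by (simp add: add_nonneg_pos)
    then have d: "0 < d" "cmod c * d \<le> e" using \<open>0 < e\<close> by (auto simp: d_def field_simps)
    obtain U where U: "open U" "A \<subseteq> U" "emeasure lborel (U - A) < d"
      using outer_regular_lborel[of A d] d by auto
    have [measurable]: "U \<in> sets borel" using U by auto
    have "emeasure lborel U = emeasure lborel (A \<union> (U - A))"
      using U by (intro arg_cong[where f="emeasure lborel"]) auto
    also have "\<dots> \<le> emeasure lborel A + emeasure lborel (U - A)"
      by (rule emeasure_subadditive) auto
    also have "\<dots> < \<infinity>" using base U(3) by (auto simp: less_top[symmetric] top_unique)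
    finally have finU: "emeasure lborel U < \<infinity>" .
    show "\<exists>v\<in>borel_measurable borel. (\<integral>\<^sup>+ x. ennreal (cmod (indicator A x *\<^sub>R c - v x)) \<partial>lborel) \<le> ennreal e \<and>
         (\<lambda>n. \<integral>\<^sup>+ x. ennreal (cmod (v (x - a n) - v x)) \<partial>lborel) \<longlonglongrightarrow> 0"
    proof (intro bexI conjI)
      have "cmod (indicator A x *\<^sub>R c - indicator U x *\<^sub>R c) = cmod c * indicator (U - A) x" for x
        using U(2) by (auto split: split_indicator)
      then have "(\<integral>\<^sup>+ x. ennreal (cmod (indicator A x *\<^sub>R c - indicator U x *\<^sub>R c)) \<partial>lborel)
          = (\<integral>\<^sup>+ x. ennreal (cmod c) * indicator (U - A) x \<partial>lborel)"
        by (simp add: ennreal_mult ennreal_indicator)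
      also have "\<dots> = ennreal (cmod c) * emeasure lborel (U - A)"
        by (simp add: nn_integral_cmult)
      also have "\<dots> \<le> ennreal (cmod c) * ennreal d"
        using U(3) by (intro mult_left_mono) auto
      also have "\<dots> = ennreal (cmod c * d)"
        using d(1) by (intro ennreal_mult[symmetric]) auto
      also have "\<dots> \<le> ennreal e"
        using d(2) by (rule ennreal_leI)
      finally show "(\<integral>\<^sup>+ x. ennreal (cmod (indicator A x *\<^sub>R c - indicator U x *\<^sub>R c)) \<partial>lborel) \<le> ennreal e" .
      have eq: "cmod (indicator U (x - a n) *\<^sub>R c - indicator U x *\<^sub>R c) = cmod c * cmod (indicator U (x - a n) - indicator U x :: complex)" for x n
        by (auto split: split_indicator)
      have "(\<lambda>n. ennreal (cmod c) * (\<integral>\<^sup>+ x. ennreal (cmod (indicator U (x - a n) - indicator U x :: complex)) \<partial>lborel)) \<longlonglongrightarrow> ennreal (cmod c) * 0"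
        by (intro tendsto_mult_ennreal tendsto_const translate_open_tendsto_L1 U finU a) auto
      then show "(\<lambda>n. \<integral>\<^sup>+ x. ennreal (cmod (indicator U (x - a n) *\<^sub>R c - indicator U x *\<^sub>R c)) \<partial>lborel) \<longlonglongrightarrow> 0"
        unfolding eq by (simp add: ennreal_mult nn_integral_cmult)
    qed simp
  qed simp
next
  case (add f g)
  then have [measurable]: "f \<in> borel_measurable borel" "g \<in> borel_measurable borel" by auto
  let ?D = "\<lambda>u n. \<integral>\<^sup>+ x. ennreal (cmod (u (x - a n) - u x :: complex)) \<partial>lborel"
  have le: "?D (\<lambda>x. f x + g x) n \<le> ?D f n + ?D g n" for n
  proof -
    have "?D (\<lambda>x. f x + g x) n
      \<le> (\<integral>\<^sup>+ x. ennreal (cmod (f (x - a n) - f x)) + ennreal (cmod (g (x - a n) - g x)) \<partial>lborel)"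
    proof (rule nn_integral_mono)
      fix x
      have "cmod (f (x - a n) + g (x - a n) - (f x + g x)) \<le> cmod (f (x - a n) - f x) + cmod (g (x - a n) - g x)"
        by (rule norm_diff_triangle_ineq)
      then show "ennreal (cmod (f (x - a n) + g (x - a n) - (f x + g x))) \<le> ennreal (cmod (f (x - a n) - f x)) + ennreal (cmod (g (x - a n) - g x))"
        by (subst ennreal_plus[symmetric], simp, simp, intro ennreal_leI)
    qed
    also have "\<dots> = ?D f n + ?D g n" by (rule nn_integral_add) auto
    finally show ?thesis .
  qed
  have "(\<lambda>n. ?D f n + ?D g n) \<longlonglongrightarrow> 0"
    using tendsto_add[OF add.IH] by simp
  then show ?case
    by (rule tendsto_sandwich[OF _ _ tendsto_const, rotated 2]) (simp_all add: le)
next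
  case (lim f s)
  then have [measurable]: "f \<in> borel_measurable borel" "\<And>i. s i \<in> borel_measurable borel" by auto
  show ?case
  proof (rule translate_tendsto_L1_approx)
    fix e :: real assume "0 < e"
    have "(\<lambda>i. (\<integral>\<^sup>+x. norm (f x - s i x) \<partial>lborel)) \<longlonglongrightarrow> 0"
    proof (rule nn_integral_dominated_convergence_norm)
      show "AE x in lborel. norm (s j x) \<le> 2 * norm (f x)" for j
        using lim.hyps(3) by simp
      show "AE x in lborel. (\<lambda>i. s i x) \<longlonglongrightarrow> f x"
        using lim.hyps(2) by simp
      have "integrable lborel (\<lambda>x. 2 * norm (f x))" using lim.hyps(4) by simp
      then show "(\<integral>\<^sup>+ x. ennreal (2 * norm (f x)) \<partial>lborel) < \<infinity>"
        unfolding integrable_iff_bounded by simp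
    qed auto
    then have "eventually (\<lambda>i. (\<integral>\<^sup>+x. norm (f x - s i x) \<partial>lborel) < ennreal e) sequentially"
      using \<open>0 < e\<close> by (intro order_tendstoD) auto
    then obtain i where "(\<integral>\<^sup>+x. norm (f x - s i x) \<partial>lborel) < ennreal e"
      by (auto simp: eventually_sequentially)
    then show "\<exists>v\<in>borel_measurable borel. (\<integral>\<^sup>+ x. ennreal (cmod (f x - v x)) \<partial>lborel) \<le> ennreal e \<and>
         (\<lambda>n. \<integral>\<^sup>+ x. ennreal (cmod (v (x - a n) - v x)) \<partial>lborel) \<longlonglongrightarrow> 0"
      using lim.IH by (intro bexI[of _ "s i"]) auto
  qed simp
qed


section \<open>Gaussian means and Plancherel's identity\<close>

lemma borel_measurable_cnj [measurable (raw)]: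
  "f \<in> borel_measurable M \<Longrightarrow> (\<lambda>x. cnj (f x)) \<in> borel_measurable M"
  by (rule borel_measurable_continuous_on[of cnj]) (auto intro: continuous_intros)

text \<open>The autocorrelation of \<open>u\<close>; its Fourier transform is the energy density \<open>\<bar>fourier u\<bar>\<^sup>2\<close>.\<close>

definition autocorr :: "(real^2 \<Rightarrow> complex) \<Rightarrow> real^2 \<Rightarrow> complex" where
  "autocorr u = convol u (\<lambda>x. cnj (u (- x)))"

lemma autocorr_eq: "autocorr u z = (\<integral>y. u y * cnj (u (y - z)) \<partial>lborel)"
  by (simp add: autocorr_def convol_def)

lemma integrable_cnj_reflect:
  fixes u :: "real^2 \<Rightarrow> complex"
  assumes "integrable lborel u"
  shows "integrable lborel (\<lambda>x. cnj (u (- x)))"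
proof -
  have [measurable]: "u \<in> borel_measurable borel" using assms by auto
  have "integrable lborel (\<lambda>x. u (- x))"
    using integrable_lborel_affine_iff[of u "-1" 0] assms by simp
  then show ?thesis by simp
qed

lemma integrable_autocorr: "integrable lborel u \<Longrightarrow> integrable lborel (autocorr u)"
  unfolding autocorr_def by (intro integrable_convol integrable_cnj_reflect)

lemma fourier_autocorr:
  assumes "integrable lborel u"
  shows "fourier (autocorr u) \<xi> = complex_of_real ((cmod (fourier u \<xi>))\<^sup>2)"
proof -
  have [measurable]: "u \<in> borel_measurable borel" using assms by auto
  have w: "wave (- x) \<xi> = cnj (wave x \<xi>)" for x
    by (simp add: exp_cnj)
  have "fourier (\<lambda>x. cnj (u (- x))) \<xi> = (\<integral>x. wave (- x) \<xi> * cnj (u x) \<partial>lborel)"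
    using integral_lborel_affine[of "\<lambda>x. wave x \<xi> * cnj (u (- x))" "-1" 0]
    by (simp add: fourier_def)
  also have "\<dots> = (\<integral>x. cnj (wave x \<xi> * u x) \<partial>lborel)"
    by (intro Bochner_Integration.integral_cong refl) (simp only: w complex_cnj_mult)
  also have "\<dots> = cnj (fourier u \<xi>)"
    unfolding fourier_def by (rule Bochner_Integration.integral_cnj)
  finally show ?thesis
    unfolding autocorr_def fourier_convol[OF assms integrable_cnj_reflect[OF assms]]
    by (simp only: complex_norm_square)
qed

abbreviation gauss :: "real \<Rightarrow> real^2 \<Rightarrow> real" where
  "gauss \<epsilon> x \<equiv> exp (- pi * \<epsilon>\<^sup>2 * (norm x)\<^sup>2)"

lemma integral_gauss_1: "(\<integral>x. gauss 1 x \<partial>lborel) = 1"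
proof -
  have "complex_of_real (\<integral>x. gauss 1 x \<partial>lborel) = fourier (\<lambda>x. complex_of_real (gauss 1 x)) 0"
    by (simp add: fourier_def)
  also have "\<dots> = 1" by (subst gaussian_fourier(2)) auto
  finally show ?thesis using of_real_eq_1_iff by blast
qed

text \<open>
  The multiplication formula, applied to the autocorrelation and the Gaussian, moves the mean to the
  physical side, where the transform of the Gaussian is a positive bump of width \<open>\<epsilon>\<close>. The substitution
  \<open>z \<mapsto> \<epsilon> z\<close> then makes the weight independent of \<open>\<epsilon>\<close>.
\<close>

lemma gaussian_mean:
  assumes u: "integrable lborel u" and \<epsilon>: "0 < \<epsilon>"
  shows "complex_of_real (\<integral>\<xi>. (cmod (fourier u \<xi>))\<^sup>2 * gauss \<epsilon> \<xi> \<partial>lborel)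
       = (\<integral>z. autocorr u (\<epsilon> *\<^sub>R z) * complex_of_real (gauss 1 z) \<partial>lborel)"
proof -
  have [measurable]: "autocorr u \<in> borel_measurable borel" using integrable_autocorr[OF u] by auto
  have "complex_of_real (\<integral>\<xi>. (cmod (fourier u \<xi>))\<^sup>2 * gauss \<epsilon> \<xi> \<partial>lborel)
      = (\<integral>\<xi>. fourier (autocorr u) \<xi> * complex_of_real (gauss \<epsilon> \<xi>) \<partial>lborel)"
    by (simp add: fourier_autocorr[OF u] flip: of_real_mult del: of_real_power)
  also have "\<dots> = (\<integral>z. autocorr u z * fourier (\<lambda>\<xi>. complex_of_real (gauss \<epsilon> \<xi>)) z \<partial>lborel)"
    by (rule fourier_multiplication_formula[OF integrable_autocorr[OF u] gaussian_fourier(1)[OF \<epsilon>]])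
  also have "\<dots> = (\<integral>z. autocorr u z * complex_of_real (exp (- pi * (norm z)\<^sup>2 / \<epsilon>\<^sup>2) / \<epsilon>\<^sup>2) \<partial>lborel)"
    by (simp only: gaussian_fourier(2)[OF \<epsilon>])
  also have "\<dots> = (\<epsilon>\<^sup>2) *\<^sub>R (\<integral>z. autocorr u (\<epsilon> *\<^sub>R z) * complex_of_real (exp (- pi * (norm (\<epsilon> *\<^sub>R z))\<^sup>2 / \<epsilon>\<^sup>2) / \<epsilon>\<^sup>2) \<partial>lborel)"
    using integral_lborel_affine[of "\<lambda>z. autocorr u z * complex_of_real (exp (- pi * (norm z)\<^sup>2 / \<epsilon>\<^sup>2) / \<epsilon>\<^sup>2)" \<epsilon> 0] \<epsilon>
    by simp
  also have "\<dots> = (\<integral>z. (\<epsilon>\<^sup>2) *\<^sub>R (autocorr u (\<epsilon> *\<^sub>R z) * complex_of_real (exp (- pi * (norm (\<epsilon> *\<^sub>R z))\<^sup>2 / \<epsilon>\<^sup>2) / \<epsilon>\<^sup>2)) \<partial>lborel)"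
    by simp
  also have "\<dots> = (\<integral>z. autocorr u (\<epsilon> *\<^sub>R z) * complex_of_real (gauss 1 z) \<partial>lborel)"
    using \<epsilon> by (intro Bochner_Integration.integral_cong refl) (simp add: power_mult_distrib scaleR_conv_of_real[where 'a=complex])
  finally show ?thesis .
qed

lemma integrable_gauss: "0 < \<epsilon> \<Longrightarrow> integrable lborel (gauss \<epsilon>)"
  using gaussian_fourier(1)[of \<epsilon>] complex_of_real_integrable_eq by blast

lemma integrable_fourier_gauss:
  assumes u: "integrable lborel u" and \<epsilon>: "0 < \<epsilon>"
  shows "integrable lborel (\<lambda>\<xi>. (cmod (fourier u \<xi>))\<^sup>2 * gauss \<epsilon> \<xi>)"
proof (rule Bochner_Integration.integrable_bound)
  have [measurable]: "u \<in> borel_measurable borel" using u by auto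
  let ?B = "\<integral>x. cmod (u x) \<partial>lborel"
  show "integrable lborel (\<lambda>\<xi>. ?B\<^sup>2 * gauss \<epsilon> \<xi>)"
    using integrable_gauss[OF \<epsilon>] by simp
  show "(\<lambda>\<xi>. (cmod (fourier u \<xi>))\<^sup>2 * gauss \<epsilon> \<xi>) \<in> borel_measurable lborel" by measurable
  show "AE \<xi> in lborel. norm ((cmod (fourier u \<xi>))\<^sup>2 * gauss \<epsilon> \<xi>) \<le> norm (?B\<^sup>2 * gauss \<epsilon> \<xi>)"
    by (auto intro!: mult_right_mono power_mono cmod_fourier_le)
qed

text \<open>
  Since the transform of a Gaussian is positive, its mean is an integral of the autocorrelation
  against a positive weight, and passing to \<open>\<bar>u\<bar>\<close> can only increase the autocorrelation. In other
  words, taking the modulus moves energy towards low frequencies.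
\<close>

lemma gaussian_mean_le_modulus:
  assumes u: "integrable lborel u" and \<epsilon>: "0 < \<epsilon>"
  shows "(\<integral>\<xi>. (cmod (fourier u \<xi>))\<^sup>2 * gauss \<epsilon> \<xi> \<partial>lborel)
      \<le> (\<integral>\<xi>. (cmod (fourier (\<lambda>x. complex_of_real (cmod (u x))) \<xi>))\<^sup>2 * gauss \<epsilon> \<xi> \<partial>lborel)"
proof -
  have [measurable]: "u \<in> borel_measurable borel" using u by auto
  let ?h = "\<lambda>x. complex_of_real (cmod (u x))"
  have h: "integrable lborel ?h" using u by simp
  define r where "r z = (\<integral>y. cmod (u y) * cmod (u (y - z)) \<partial>lborel)" for z
  have h_autocorr: "autocorr ?h z = complex_of_real (r z)" for z
    unfolding r_def autocorr_eq complex_cnj_complex_of_real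
    by (simp only: of_real_mult[symmetric] integral_complex_of_real)
  have le: "cmod (autocorr u z) \<le> r z" for z
  proof -
    have "cmod (autocorr u z) \<le> (\<integral>y. cmod (u y * cnj (u (y - z))) \<partial>lborel)"
      unfolding autocorr_eq by (rule integral_norm_bound)
    then show ?thesis
      by (simp add: norm_mult r_def)
  qed
  have [measurable]: "(\<lambda>z. complex_of_real (r z)) \<in> borel_measurable borel"
    using integrable_autocorr[OF h] unfolding h_autocorr[abs_def, symmetric] by auto
  have int: "integrable lborel (\<lambda>z. complex_of_real (r (\<epsilon> *\<^sub>R z)) * complex_of_real (gauss 1 z))"
  proof (rule Bochner_Integration.integrable_bound)
    show "integrable lborel (\<lambda>z. complex_of_real (r (\<epsilon> *\<^sub>R z)))"
      using integrable_lborel_affine_iff[of "autocorr ?h" \<epsilon> 0] integrable_autocorr[OF h] \<epsilon>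
      by (simp add: h_autocorr[abs_def])
    show "AE z in lborel. norm (complex_of_real (r (\<epsilon> *\<^sub>R z)) * complex_of_real (gauss 1 z)) \<le> norm (complex_of_real (r (\<epsilon> *\<^sub>R z)))"
      by (simp add: norm_mult mult_right_le_one_le)
  qed measurable
  have int': "integrable lborel (\<lambda>z. r (\<epsilon> *\<^sub>R z) * gauss 1 z)"
    using int unfolding of_real_mult[symmetric] by (simp only: complex_of_real_integrable_eq)
  have "(\<integral>\<xi>. (cmod (fourier u \<xi>))\<^sup>2 * gauss \<epsilon> \<xi> \<partial>lborel)
      \<le> cmod (\<integral>z. autocorr u (\<epsilon> *\<^sub>R z) * complex_of_real (gauss 1 z) \<partial>lborel)"
    unfolding gaussian_mean[OF u \<epsilon>, symmetric] norm_of_real by (rule abs_ge_self)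
  also have "\<dots> \<le> (\<integral>z. cmod (autocorr u (\<epsilon> *\<^sub>R z) * complex_of_real (gauss 1 z)) \<partial>lborel)"
    by (rule integral_norm_bound)
  also have "\<dots> \<le> (\<integral>z. r (\<epsilon> *\<^sub>R z) * gauss 1 z \<partial>lborel)"
  proof (rule integral_mono_AE'[OF int'])
    show "AE z in lborel. cmod (autocorr u (\<epsilon> *\<^sub>R z) * complex_of_real (gauss 1 z)) \<le> r (\<epsilon> *\<^sub>R z) * gauss 1 z"
      using le by (simp add: norm_mult mult_right_mono)
    have "0 \<le> r z" for z by (simp add: r_def)
    then show "AE z in lborel. 0 \<le> r (\<epsilon> *\<^sub>R z) * gauss 1 z" by simp
  qed
  also have "\<dots> = (\<integral>\<xi>. (cmod (fourier ?h \<xi>))\<^sup>2 * gauss \<epsilon> \<xi> \<partial>lborel)"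
    using gaussian_mean[OF h \<epsilon>]
    by (simp only: h_autocorr of_real_mult[symmetric] integral_complex_of_real of_real_eq_iff)
  finally show ?thesis .
qed

text \<open>Pairing the bounded function \<open>u\<close> with the \<open>L\<^sup>1\<close>-small difference of \<open>u\<close> and its translate.\<close>

lemma autocorr_tendsto_0:
  assumes u: "integrable lborel u" and B: "\<And>x. cmod (u x) \<le> B" and a: "a \<longlonglongrightarrow> 0"
  shows "(\<lambda>n. autocorr u (a n)) \<longlonglongrightarrow> autocorr u 0"
proof -
  have [measurable]: "u \<in> borel_measurable borel" using u by auto
  have B0: "0 \<le> B" using B[of 0] norm_ge_zero order_trans by blast
  have prod_le: "cmod (u y) * cmod (u (y - z)) \<le> B * cmod (u y)" for y z
    using mult_right_mono[OF B norm_ge_zero, of "y - z" "u y"] by (simp only: mult.commute)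
  have int: "integrable lborel (\<lambda>y. u y * cnj (u (y - z)))" for z
  proof (rule Bochner_Integration.integrable_bound)
    show "integrable lborel (\<lambda>y. B * cmod (u y))" using u by simp
    show "AE y in lborel. norm (u y * cnj (u (y - z))) \<le> norm (B * cmod (u y))"
      using prod_le B0 by (simp add: norm_mult)
  qed measurable
  have le: "ennreal (cmod (autocorr u (a n) - autocorr u 0))
     \<le> ennreal B * (\<integral>\<^sup>+ y. ennreal (cmod (u (y - a n) - u y)) \<partial>lborel)" for n
  proof -
    have cd: "cnj (u (y - a n) - u y) = cnj (u (y - a n)) - cnj (u (y - 0))" for y by simp
    have i: "integrable lborel (\<lambda>y. u y * cnj (u (y - a n) - u y))"
      unfolding cd right_diff_distrib by (intro Bochner_Integration.integrable_diff int)
    have "autocorr u (a n) - autocorr u 0 = (\<integral>y. u y * cnj (u (y - a n) - u y) \<partial>lborel)"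
      unfolding cd right_diff_distrib autocorr_eq
      by (rule Bochner_Integration.integral_diff[symmetric]) (rule int)+
    then have "ennreal (cmod (autocorr u (a n) - autocorr u 0)) = ennreal (cmod (\<integral>y. u y * cnj (u (y - a n) - u y) \<partial>lborel))"
      by (rule arg_cong)
    also have "\<dots> \<le> (\<integral>\<^sup>+ y. ennreal (cmod (u y * cnj (u (y - a n) - u y))) \<partial>lborel)"
      by (rule integral_norm_bound_ennreal[OF i])
    also have "\<dots> \<le> (\<integral>\<^sup>+ y. ennreal B * ennreal (cmod (u (y - a n) - u y)) \<partial>lborel)"
    proof (rule nn_integral_mono)
      fix y
      have "cmod (u y * cnj (u (y - a n) - u y)) = cmod (u y) * cmod (u (y - a n) - u y)"
        by (simp only: norm_mult complex_mod_cnj)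
      also have "\<dots> \<le> B * cmod (u (y - a n) - u y)"
        by (intro mult_right_mono B) simp
      finally have "ennreal (cmod (u y * cnj (u (y - a n) - u y))) \<le> ennreal (B * cmod (u (y - a n) - u y))"
        by (rule ennreal_leI)
      then show "ennreal (cmod (u y * cnj (u (y - a n) - u y))) \<le> ennreal B * ennreal (cmod (u (y - a n) - u y))"
        using B0 by (simp only: ennreal_mult[OF _ norm_ge_zero])
    qed
    finally show ?thesis by (simp add: nn_integral_cmult)
  qed
  have "(\<lambda>n. ennreal B * (\<integral>\<^sup>+ y. ennreal (cmod (u (y - a n) - u y)) \<partial>lborel)) \<longlonglongrightarrow> ennreal B * 0"
    by (intro tendsto_mult_ennreal tendsto_const translate_tendsto_L1 u a) auto
  then have "(\<lambda>n. ennreal B * (\<integral>\<^sup>+ y. ennreal (cmod (u (y - a n) - u y)) \<partial>lborel)) \<longlonglongrightarrow> 0"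
    by simp
  then have "(\<lambda>n. ennreal (cmod (autocorr u (a n) - autocorr u 0))) \<longlonglongrightarrow> 0"
    by (rule tendsto_sandwich[OF _ _ tendsto_const, rotated 2]) (simp_all add: le)
  then have "(\<lambda>n. cmod (autocorr u (a n) - autocorr u 0)) \<longlonglongrightarrow> 0"
    by (simp add: ennreal_tendsto_0_iff)
  then show ?thesis
    by (rule LIM_zero_cancel[OF tendsto_norm_zero_cancel])
qed

text \<open>
  Let \<open>\<epsilon>\<close> tend to \<open>0\<close> in the Gaussian mean: the frequency side increases to the full energy of
  the transform, and the physical side tends to the autocorrelation at the origin, which is the energy
  of \<open>u\<close>. Boundedness of \<open>u\<close> is what makes the autocorrelation continuous there.
\<close>

lemma Plancherel_bounded:
  assumes u: "integrable lborel u" and B: "\<And>x. cmod (u x) \<le> B"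
  shows "L2norm_on lborel (fourier u) = L2norm_on lborel u"
proof -
  have [measurable]: "u \<in> borel_measurable borel" using u by auto
  have [measurable]: "autocorr u \<in> borel_measurable borel" using integrable_autocorr[OF u] by auto
  have B0: "0 \<le> B" using B[of 0] norm_ge_zero order_trans by blast
  \<comment> \<open>A sequence of parameters decreasing to \<open>0\<close>, which makes the Gaussians increase to \<open>1\<close>.\<close>
  define e where "e n = inverse (real (Suc n))" for n
  have e_pos: "0 < e n" and e_le: "m \<le> n \<Longrightarrow> e n \<le> e m" for m n by (auto simp: e_def field_simps)
  have e_lim: "e \<longlonglongrightarrow> 0" unfolding e_def by (rule LIMSEQ_inverse_real_of_nat)
  let ?L = "\<lambda>n. \<integral>\<xi>. (cmod (fourier u \<xi>))\<^sup>2 * gauss (e n) \<xi> \<partial>lborel"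
  have prod_le: "cmod (u y) * cmod (u z) \<le> B * cmod (u y)" for y z
    using mult_right_mono[OF B norm_ge_zero, of z "u y"] by (simp only: mult.commute)
  have int_B: "integrable lborel (\<lambda>y. B * cmod (u y))" using u by simp
  have int_sq: "integrable lborel (\<lambda>x. (cmod (u x))\<^sup>2)"
  proof (rule Bochner_Integration.integrable_bound[OF int_B])
    show "AE y in lborel. norm ((cmod (u y))\<^sup>2) \<le> norm (B * cmod (u y))"
      using prod_le B0 by (simp add: power2_eq_square)
  qed measurable
  have A0: "autocorr u 0 = complex_of_real (\<integral>x. (cmod (u x))\<^sup>2 \<partial>lborel)"
    by (simp only: autocorr_eq diff_zero complex_norm_square[symmetric] integral_complex_of_real)
  have A_le: "cmod (autocorr u z) \<le> B * (\<integral>y. cmod (u y) \<partial>lborel)" for z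
  proof -
    have "cmod (autocorr u z) \<le> (\<integral>y. cmod (u y * cnj (u (y - z))) \<partial>lborel)"
      unfolding autocorr_eq by (rule integral_norm_bound)
    also have "\<dots> \<le> (\<integral>y. B * cmod (u y) \<partial>lborel)"
    proof (rule integral_mono_AE'[OF int_B])
      show "AE y in lborel. cmod (u y * cnj (u (y - z))) \<le> B * cmod (u y)"
        using prod_le by (simp add: norm_mult)
    qed (use B0 in simp)
    finally show ?thesis by simp
  qed
  have "(\<lambda>n. \<integral>z. autocorr u (e n *\<^sub>R z) * complex_of_real (gauss 1 z) \<partial>lborel)
      \<longlonglongrightarrow> (\<integral>z. autocorr u 0 * complex_of_real (gauss 1 z) \<partial>lborel)"
  proof (rule integral_dominated_convergence[where w="\<lambda>z. B * (\<integral>y. cmod (u y) \<partial>lborel) * gauss 1 z"])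
    show "AE z in lborel. (\<lambda>n. autocorr u (e n *\<^sub>R z) * complex_of_real (gauss 1 z)) \<longlonglongrightarrow> autocorr u 0 * complex_of_real (gauss 1 z)"
    proof (intro AE_I2 tendsto_mult tendsto_const autocorr_tendsto_0[OF u B])
      fix z :: "real^2"
      show "(\<lambda>n. e n *\<^sub>R z) \<longlonglongrightarrow> 0"
        using tendsto_scaleR[OF e_lim tendsto_const, of z] by simp
    qed
    show "integrable lborel (\<lambda>z. B * (\<integral>y. cmod (u y) \<partial>lborel) * gauss 1 z)"
      using integrable_gauss[of 1] by simp
    show "AE z in lborel. norm (autocorr u (e n *\<^sub>R z) * complex_of_real (gauss 1 z)) \<le> B * (\<integral>y. cmod (u y) \<partial>lborel) * gauss 1 z" for n
      using A_le by (auto simp: norm_mult intro!: mult_right_mono)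
  qed measurable
  also have "(\<integral>z. autocorr u 0 * complex_of_real (gauss 1 z) \<partial>lborel) = autocorr u 0"
    using integral_gauss_1 by simp
  finally have "(\<lambda>n. complex_of_real (?L n)) \<longlonglongrightarrow> complex_of_real (\<integral>x. (cmod (u x))\<^sup>2 \<partial>lborel)"
    unfolding gaussian_mean[OF u e_pos] A0 .
  then have "?L \<longlonglongrightarrow> (\<integral>x. (cmod (u x))\<^sup>2 \<partial>lborel)"
    by (simp only: tendsto_of_real_iff)
  then have "(\<lambda>n. ennreal (?L n)) \<longlonglongrightarrow> ennreal (\<integral>x. (cmod (u x))\<^sup>2 \<partial>lborel)"
    by (rule tendsto_ennrealI)
  moreover have "ennreal (\<integral>x. (cmod (u x))\<^sup>2 \<partial>lborel) = (\<integral>\<^sup>+x. ennreal ((cmod (u x))\<^sup>2) \<partial>lborel)"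
    using int_sq by (simp add: nn_integral_eq_integral)
  moreover have "ennreal (?L n) = (\<integral>\<^sup>+\<xi>. ennreal ((cmod (fourier u \<xi>))\<^sup>2 * gauss (e n) \<xi>) \<partial>lborel)" for n
    using integrable_fourier_gauss[OF u e_pos] by (simp add: nn_integral_eq_integral)
  ultimately have lim1: "(\<lambda>n. \<integral>\<^sup>+\<xi>. ennreal ((cmod (fourier u \<xi>))\<^sup>2 * gauss (e n) \<xi>) \<partial>lborel) \<longlonglongrightarrow> (\<integral>\<^sup>+x. ennreal ((cmod (u x))\<^sup>2) \<partial>lborel)"
    by simp
  have "(\<lambda>n. \<integral>\<^sup>+\<xi>. ennreal ((cmod (fourier u \<xi>))\<^sup>2 * gauss (e n) \<xi>) \<partial>lborel) \<longlonglongrightarrow> (\<integral>\<^sup>+x. ennreal ((cmod (fourier u x))\<^sup>2) \<partial>lborel)"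
  proof (rule nn_integral_LIMSEQ)
    show "incseq (\<lambda>n \<xi>. ennreal ((cmod (fourier u \<xi>))\<^sup>2 * gauss (e n) \<xi>))"
      by (auto simp: incseq_def le_fun_def intro!: ennreal_leI mult_left_mono mult_right_mono power_mono e_le less_imp_le[OF e_pos])
    fix \<xi> :: "real^2"
    have "(\<lambda>n. (cmod (fourier u \<xi>))\<^sup>2 * gauss (e n) \<xi>) \<longlonglongrightarrow> (cmod (fourier u \<xi>))\<^sup>2 * gauss 0 \<xi>"
      by (intro tendsto_intros e_lim)
    then show "(\<lambda>n. ennreal ((cmod (fourier u \<xi>))\<^sup>2 * gauss (e n) \<xi>)) \<longlonglongrightarrow> ennreal ((cmod (fourier u \<xi>))\<^sup>2)"
      using tendsto_ennrealI by fastforce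
  qed measurable
  from LIMSEQ_unique[OF this lim1] show ?thesis
    by (simp add: L2norm_on_def)
qed


section \<open>The Fourier transform on \<open>L\<^sup>2\<close>\<close>

text \<open>The form in which dominated convergence is applied to truncations, for which \<open>\<bar>F n - f\<bar> \<le> \<bar>f\<bar>\<close>.\<close>

lemma L2norm_on_dominated_tendsto_0:
  assumes [measurable]: "\<And>n. F n \<in> borel_measurable M" "f \<in> borel_measurable M"
    and fin: "L2norm_on M f < \<infinity>"
    and le: "\<And>n x. cmod (F n x - f x) \<le> cmod (f x)"
    and lim: "\<And>x. (\<lambda>n. F n x) \<longlonglongrightarrow> f x"
  shows "(\<lambda>n. L2norm_on M (\<lambda>x. F n x - f x)) \<longlonglongrightarrow> 0"
proof -
  have "(\<lambda>n. \<integral>\<^sup>+ x. ennreal ((cmod (F n x - f x))\<^sup>2) \<partial>M) \<longlonglongrightarrow> (\<integral>\<^sup>+ x. 0 \<partial>M)"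
  proof (rule nn_integral_dominated_convergence[where w="\<lambda>x. ennreal ((cmod (f x))\<^sup>2)"])
    show "AE x in M. ennreal ((cmod (F n x - f x))\<^sup>2) \<le> ennreal ((cmod (f x))\<^sup>2)" for n
      using le by (simp add: power_mono)
    show "(\<integral>\<^sup>+ x. ennreal ((cmod (f x))\<^sup>2) \<partial>M) < \<infinity>"
      using fin by (simp add: L2norm_on_def)
    show "AE x in M. (\<lambda>n. ennreal ((cmod (F n x - f x))\<^sup>2)) \<longlonglongrightarrow> 0"
    proof (rule AE_I2)
      fix x
      have "(\<lambda>n. (cmod (F n x - f x))\<^sup>2) \<longlonglongrightarrow> (cmod (f x - f x))\<^sup>2"
        by (intro tendsto_intros lim)
      then show "(\<lambda>n. ennreal ((cmod (F n x - f x))\<^sup>2)) \<longlonglongrightarrow> 0"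
        by (subst ennreal_tendsto_0_iff) auto
    qed
  qed measurable
  then show ?thesis by (simp add: L2norm_on_tendsto_0_iff)
qed

lemma L2norm_on_Fatou:
  assumes [measurable]: "\<And>n. F n \<in> borel_measurable M"
    and lim: "\<And>x. (\<lambda>n. F n x) \<longlonglongrightarrow> f x"
    and le: "\<forall>\<^sub>F n in sequentially. L2norm_on M (F n) \<le> c"
  shows "L2norm_on M f \<le> c"
proof -
  have "(\<integral>\<^sup>+ x. ennreal ((cmod (f x))\<^sup>2) \<partial>M) = (\<integral>\<^sup>+ x. liminf (\<lambda>n. ennreal ((cmod (F n x))\<^sup>2)) \<partial>M)"
  proof (rule nn_integral_cong)
    fix x
    have "(\<lambda>n. ennreal ((cmod (F n x))\<^sup>2)) \<longlonglongrightarrow> ennreal ((cmod (f x))\<^sup>2)"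
      by (intro tendsto_intros lim)
    from lim_imp_Liminf[OF sequentially_bot this]
    show "ennreal ((cmod (f x))\<^sup>2) = liminf (\<lambda>n. ennreal ((cmod (F n x))\<^sup>2))" by (rule sym)
  qed
  also have "\<dots> \<le> liminf (\<lambda>n. \<integral>\<^sup>+ x. ennreal ((cmod (F n x))\<^sup>2) \<partial>M)"
    by (rule nn_integral_liminf) simp
  also have "\<dots> \<le> c\<^sup>2"
    using le by (intro Liminf_le) (auto elim!: eventually_mono simp: L2norm_on_def esqrt_le_iff)
  finally show ?thesis by (simp add: L2norm_on_def esqrt_le_iff)
qed

text \<open>
  The functions are cut off where they exceed \<open>n\<close>. The transforms of the cut-offs converge pointwise by
  integrability, and in \<open>L\<^sup>2\<close> because Plancherel's identity applies to differences of cut-offs.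
\<close>

lemma Plancherel_L1_L2:
  assumes u: "integrable lborel u" and fin: "L2norm_on lborel u < \<infinity>"
  shows "L2norm_on lborel (fourier u) = L2norm_on lborel u"
proof -
  have [measurable]: "u \<in> borel_measurable borel" using u by auto
  define U where "U n x = (if cmod (u x) \<le> real n then u x else 0)" for n x
  have [measurable]: "U n \<in> borel_measurable borel" for n unfolding U_def by measurable
  have U: "integrable lborel (U n)" for n
    by (rule Bochner_Integration.integrable_bound[OF u]) (auto simp: U_def)
  have U_eq: "L2norm_on lborel (fourier (U n)) = L2norm_on lborel (U n)" for n
    by (rule Plancherel_bounded[OF U, of _ "real n"]) (auto simp: U_def)
  have U_le: "L2norm_on lborel (U n) \<le> L2norm_on lborel u" for n
    by (rule L2norm_on_mono) (auto simp: U_def)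
  have U_lim: "(\<lambda>n. U n x) \<longlonglongrightarrow> u x" for x
  proof (rule tendsto_eventually)
    obtain N where "cmod (u x) \<le> real N" using real_arch_simple by blast
    show "\<forall>\<^sub>F n in sequentially. U n x = u x"
      using eventually_ge_at_top[of N]
      by eventually_elim (use \<open>cmod (u x) \<le> real N\<close> in \<open>auto simp: U_def\<close>)
  qed
  have F_lim: "(\<lambda>n. fourier (U n) \<xi>) \<longlonglongrightarrow> fourier u \<xi>" for \<xi>
    unfolding fourier_def
  proof (rule integral_dominated_convergence[where w="\<lambda>x. cmod (u x)"])
    show "AE x in lborel. (\<lambda>n. wave x \<xi> * U n x) \<longlonglongrightarrow> wave x \<xi> * u x"
      by (intro AE_I2 tendsto_mult tendsto_const U_lim)
    show "AE x in lborel. norm (wave x \<xi> * U n x) \<le> cmod (u x)" for n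
      by (auto simp: norm_mult U_def)
  qed (use u in auto)
  have lim: "(\<lambda>n. L2norm_on lborel (\<lambda>x. U n x - u x)) \<longlonglongrightarrow> 0"
    by (rule L2norm_on_dominated_tendsto_0[OF _ _ fin]) (auto simp: U_def intro: U_lim[unfolded U_def])
  \<comment> \<open>Fatou over \<open>n\<close>: the cut-offs satisfy \<open>\<bar>U m - U n\<bar> \<le> \<bar>U m - u\<bar>\<close> for \<open>m \<le> n\<close>.\<close>
  have F_le: "L2norm_on lborel (\<lambda>x. fourier (U m) x - fourier u x) \<le> L2norm_on lborel (\<lambda>x. U m x - u x)" for m
  proof (rule L2norm_on_Fatou)
    show "(\<lambda>n. fourier (U m) x - fourier (U n) x) \<longlonglongrightarrow> fourier (U m) x - fourier u x" for x
      by (intro tendsto_intros F_lim)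
    show "\<forall>\<^sub>F n in sequentially. L2norm_on lborel (\<lambda>x. fourier (U m) x - fourier (U n) x) \<le> L2norm_on lborel (\<lambda>x. U m x - u x)"
      using eventually_ge_at_top[of m]
    proof eventually_elim
      fix n assume "m \<le> n"
      have "L2norm_on lborel (\<lambda>x. fourier (U m) x - fourier (U n) x) = L2norm_on lborel (fourier (\<lambda>x. U m x - U n x))"
        by (intro arg_cong[where f="L2norm_on lborel"] ext fourier_diff[OF U U, symmetric])
      also have "\<dots> = L2norm_on lborel (\<lambda>x. U m x - U n x)"
      proof (rule Plancherel_bounded)
        show "integrable lborel (\<lambda>x. U m x - U n x)" by (intro Bochner_Integration.integrable_diff U)
        show "cmod (U m x - U n x) \<le> real n" for x using \<open>m \<le> n\<close> by (auto simp: U_def)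
      qed
      also have "\<dots> \<le> L2norm_on lborel (\<lambda>x. U m x - u x)"
        using \<open>m \<le> n\<close> by (intro L2norm_on_mono) (auto simp: U_def)
      finally show "L2norm_on lborel (\<lambda>x. fourier (U m) x - fourier (U n) x) \<le> L2norm_on lborel (\<lambda>x. U m x - u x)" .
    qed
  qed measurable
  have "L2norm_on lborel (fourier u) \<le> L2norm_on lborel u"
    by (rule L2norm_on_Fatou[OF _ F_lim]) (auto simp: U_eq U_le)
  then have fin': "L2norm_on lborel (fourier u) < \<infinity>" using fin by simp
  have "(\<lambda>n. L2norm_on lborel (\<lambda>x. fourier (U n) x - fourier u x)) \<longlonglongrightarrow> 0"
    by (rule tendsto_sandwich[OF _ _ tendsto_const lim]) (simp_all add: F_le)
  then have "(\<lambda>n. L2norm_on lborel (fourier (U n))) \<longlonglongrightarrow> L2norm_on lborel (fourier u)"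
    by (intro L2norm_on_tendsto fin') auto
  moreover have "(\<lambda>n. L2norm_on lborel (U n)) \<longlonglongrightarrow> L2norm_on lborel u"
    by (rule L2norm_on_tendsto[OF _ _ lim fin]) auto
  ultimately show ?thesis
    unfolding U_eq by (rule LIMSEQ_unique)
qed

lemma L2norm_on_fourier_diff:
  assumes "integrable lborel u" "L2norm_on lborel u < \<infinity>" "integrable lborel v" "L2norm_on lborel v < \<infinity>"
  shows "L2norm_on lborel (\<lambda>x. fourier u x - fourier v x) = L2norm_on lborel (\<lambda>x. u x - v x)"
proof -
  have [measurable]: "u \<in> borel_measurable borel" "v \<in> borel_measurable borel" using assms by auto
  have "L2norm_on lborel (\<lambda>x. u x - v x) \<le> L2norm_on lborel u + L2norm_on lborel v"
    using L2norm_on_triangle[of u lborel "\<lambda>x. - v x"] by (simp add: L2norm_on_def)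
  also have "\<dots> < \<infinity>" using assms by simp
  finally have "L2norm_on lborel (fourier (\<lambda>x. u x - v x)) = L2norm_on lborel (\<lambda>x. u x - v x)"
    using assms by (intro Plancherel_L1_L2) auto
  moreover have "fourier (\<lambda>x. u x - v x) = (\<lambda>x. fourier u x - fourier v x)"
    using fourier_diff[OF assms(1,3)] by (rule ext)
  ultimately show ?thesis by simp
qed

text \<open>The truncations through which the transform of a square integrable function is defined.\<close>

definition trunc :: "nat \<Rightarrow> (real^2 \<Rightarrow> complex) \<Rightarrow> real^2 \<Rightarrow> complex" where
  "trunc N f x = indicator (cball 0 (real N)) x * f x"

lemma borel_measurable_trunc [measurable]:
  "f \<in> borel_measurable borel \<Longrightarrow> trunc N f \<in> borel_measurable borel"
  unfolding trunc_def[abs_def]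
  by (intro borel_measurable_times borel_measurable_indicator borel_closed) auto

lemma L2_space_iff: "f \<in> L2_space \<longleftrightarrow> f \<in> borel_measurable borel \<and> L2norm_on lborel f < \<infinity>"
  by (simp add: L2_space_def L2_norm_eq_L2norm_on)

text \<open>From \<open>\<bar>f\<bar> \<le> 1 + \<bar>f\<bar>\<^sup>2\<close>.\<close>

lemma integrable_if_L2norm_on_bounded_support:
  fixes f :: "real^2 \<Rightarrow> complex"
  assumes [measurable]: "f \<in> borel_measurable borel" "A \<in> sets borel"
    and fin: "L2norm_on lborel f < \<infinity>" "emeasure lborel A < \<infinity>"
  shows "integrable lborel (\<lambda>x. indicator A x * f x)"
proof (rule Bochner_Integration.integrable_bound)
  have "integrable lborel (\<lambda>x. (cmod (f x))\<^sup>2)"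
    using fin by (simp add: integrable_iff_bounded L2norm_on_def)
  moreover have "integrable lborel (indicator A :: real^2 \<Rightarrow> real)" using fin by auto
  ultimately show "integrable lborel (\<lambda>x. indicator A x + (cmod (f x))\<^sup>2)" by (rule Bochner_Integration.integrable_add[rotated])
  have "y \<le> 1 + y\<^sup>2" if "0 \<le> y" for y :: real
    using zero_le_power2[of "y - 1"] that by (simp add: power2_diff)
  then show "AE x in lborel. norm (indicator A x * f x) \<le> norm (indicator A x + (cmod (f x))\<^sup>2)"
    by (auto split: split_indicator)
qed measurable

lemma trunc_L2:
  assumes "f \<in> L2_space"
  shows integrable_trunc: "integrable lborel (trunc N f)"
    and L2norm_on_trunc: "L2norm_on lborel (trunc N f) < \<infinity>"
    and trunc_tendsto: "(\<lambda>N. L2norm_on lborel (\<lambda>x. trunc N f x - f x)) \<longlonglongrightarrow> 0"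
proof -
  have [measurable]: "f \<in> borel_measurable borel" and fin: "L2norm_on lborel f < \<infinity>"
    using assms by (auto simp: L2_space_iff)
  show "integrable lborel (trunc N f)"
    unfolding trunc_def by (rule integrable_if_L2norm_on_bounded_support) (use fin emeasure_lborel_cball_finite in auto)
  have "L2norm_on lborel (trunc N f) \<le> L2norm_on lborel f"
    by (rule L2norm_on_mono) (auto simp: trunc_def split: split_indicator)
  then show "L2norm_on lborel (trunc N f) < \<infinity>" using fin by simp
  show "(\<lambda>N. L2norm_on lborel (\<lambda>x. trunc N f x - f x)) \<longlonglongrightarrow> 0"
  proof (rule L2norm_on_dominated_tendsto_0)
    fix x :: "real^2"
    obtain N where N: "norm x \<le> real N" using real_arch_simple by blast
    show "(\<lambda>n. trunc n f x) \<longlonglongrightarrow> f x"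
    proof (rule tendsto_eventually)
      show "\<forall>\<^sub>F n in sequentially. trunc n f x = f x"
        using eventually_ge_at_top[of N] by eventually_elim (use N in \<open>auto simp: trunc_def split: split_indicator\<close>)
    qed
    show "cmod (trunc n f x - f x) \<le> cmod (f x)" for n
      by (auto simp: trunc_def split: split_indicator)
  qed (use fin in auto)
qed

text \<open>
  The transforms of the truncations form a Cauchy sequence by Plancherel's identity, so the choice
  in the definition of the transform is made from a nonempty set.
\<close>

lemma fourier_L2_spec:
  assumes "f \<in> L2_space"
  shows fourier_L2_in_L2: "fourier_L2 f \<in> L2_space"
    and fourier_L2_trunc_limit: "(\<lambda>N. L2norm_on lborel (\<lambda>\<xi>. fourier (trunc N f) \<xi> - fourier_L2 f \<xi>)) \<longlonglongrightarrow> 0"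
proof -
  have [measurable]: "f \<in> borel_measurable borel" and fin: "L2norm_on lborel f < \<infinity>"
    using assms by (auto simp: L2_space_iff)
  note tr = trunc_L2[OF assms]
  have "\<exists>g\<in>borel_measurable lborel. L2norm_on lborel g < \<infinity> \<and> (\<lambda>N. L2norm_on lborel (\<lambda>x. fourier (trunc N f) x - g x)) \<longlonglongrightarrow> 0"
  proof (rule L2norm_on_Cauchy_imp_limit)
    show "L2norm_on lborel (fourier (trunc n f)) < \<infinity>" for n
      using Plancherel_L1_L2[OF tr(1,2)] tr(2) by simp
    fix e :: ennreal assume "0 < e"
    then have "0 < e / 2" by (simp add: ennreal_zero_less_divide)
    then have "\<forall>\<^sub>F N in sequentially. L2norm_on lborel (\<lambda>x. trunc N f x - f x) < e / 2"
      by (rule order_tendstoD(2)[OF tr(3)])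
    then obtain N where N: "\<And>n. n \<ge> N \<Longrightarrow> L2norm_on lborel (\<lambda>x. trunc n f x - f x) < e / 2"
      by (auto simp: eventually_sequentially)
    show "\<exists>N. \<forall>m\<ge>N. \<forall>n\<ge>N. L2norm_on lborel (\<lambda>x. fourier (trunc m f) x - fourier (trunc n f) x) \<le> e"
    proof (intro exI allI impI)
      fix m n assume mn: "N \<le> m" "N \<le> n"
      have "L2norm_on lborel (\<lambda>x. fourier (trunc m f) x - fourier (trunc n f) x) = L2norm_on lborel (\<lambda>x. trunc m f x - trunc n f x)"
        by (rule L2norm_on_fourier_diff[OF tr(1,2) tr(1,2)])
      also have "\<dots> \<le> L2norm_on lborel (\<lambda>x. trunc m f x - f x) + L2norm_on lborel (\<lambda>x. f x - trunc n f x)"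
        by (rule L2norm_on_triangle_diff) auto
      also have "\<dots> = L2norm_on lborel (\<lambda>x. trunc m f x - f x) + L2norm_on lborel (\<lambda>x. trunc n f x - f x)"
        by (simp only: L2norm_on_minus_commute[of lborel f "trunc n f"])
      also have "\<dots> \<le> e / 2 + e / 2"
        by (intro add_mono less_imp_le N mn)
      also have "\<dots> = e" by (cases e) (auto simp: divide_ennreal ennreal_top_divide simp flip: ennreal_plus ennreal_numeral)
      finally show "L2norm_on lborel (\<lambda>x. fourier (trunc m f) x - fourier (trunc n f) x) \<le> e" .
    qed
  qed measurable
  then have "\<exists>g. g \<in> L2_space \<and>
     (\<lambda>N::nat. L2_norm (\<lambda>\<xi>. fourier (\<lambda>x. indicator (cball 0 (real N)) x * f x) \<xi> - g \<xi>)) \<longlonglongrightarrow> 0"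
    by (auto simp: L2_space_iff L2_norm_eq_L2norm_on trunc_def[abs_def])
  from someI_ex[OF this] show "fourier_L2 f \<in> L2_space"
    "(\<lambda>N. L2norm_on lborel (\<lambda>\<xi>. fourier (trunc N f) \<xi> - fourier_L2 f \<xi>)) \<longlonglongrightarrow> 0"
    by (auto simp: fourier_L2_def L2_norm_eq_L2norm_on trunc_def[abs_def])
qed

text \<open>
  Any approximation by functions in \<open>L\<^sup>1 \<inter> L\<^sup>2\<close> computes the transform. Thus identities for
  integrable functions pass to \<open>L\<^sup>2\<close> without reference to the chosen truncations.
\<close>

lemma fourier_L2_limit:
  assumes f: "f \<in> L2_space"
    and F: "\<And>n. integrable lborel (F n)" "\<And>n. L2norm_on lborel (F n) < \<infinity>"
    and lim: "(\<lambda>n. L2norm_on lborel (\<lambda>x. F n x - f x)) \<longlonglongrightarrow> 0"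
  shows "(\<lambda>n. L2norm_on lborel (\<lambda>\<xi>. fourier (F n) \<xi> - fourier_L2 f \<xi>)) \<longlonglongrightarrow> 0"
proof -
  have [measurable]: "f \<in> borel_measurable borel" "fourier_L2 f \<in> borel_measurable borel"
    "\<And>n. F n \<in> borel_measurable borel"
    using f fourier_L2_in_L2[OF f] F(1) by (auto simp: L2_space_iff)
  note tr = trunc_L2[OF f]
  have le: "L2norm_on lborel (\<lambda>\<xi>. fourier (F n) \<xi> - fourier_L2 f \<xi>)
     \<le> L2norm_on lborel (\<lambda>x. F n x - f x) + L2norm_on lborel (\<lambda>x. trunc n f x - f x)
       + L2norm_on lborel (\<lambda>\<xi>. fourier (trunc n f) \<xi> - fourier_L2 f \<xi>)" for n
  proof -
    have "L2norm_on lborel (\<lambda>\<xi>. fourier (F n) \<xi> - fourier_L2 f \<xi>)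
      \<le> L2norm_on lborel (\<lambda>\<xi>. fourier (F n) \<xi> - fourier (trunc n f) \<xi>) + L2norm_on lborel (\<lambda>\<xi>. fourier (trunc n f) \<xi> - fourier_L2 f \<xi>)"
      by (rule L2norm_on_triangle_diff) auto
    also have "L2norm_on lborel (\<lambda>\<xi>. fourier (F n) \<xi> - fourier (trunc n f) \<xi>) = L2norm_on lborel (\<lambda>x. F n x - trunc n f x)"
      by (rule L2norm_on_fourier_diff[OF F tr(1,2)])
    also have "\<dots> \<le> L2norm_on lborel (\<lambda>x. F n x - f x) + L2norm_on lborel (\<lambda>x. f x - trunc n f x)"
      by (rule L2norm_on_triangle_diff) auto
    finally show ?thesis
      by (simp only: L2norm_on_minus_commute[of lborel f "trunc n f"]) (simp add: add_right_mono)
  qed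
  have "(\<lambda>n. L2norm_on lborel (\<lambda>x. F n x - f x) + L2norm_on lborel (\<lambda>x. trunc n f x - f x)
       + L2norm_on lborel (\<lambda>\<xi>. fourier (trunc n f) \<xi> - fourier_L2 f \<xi>)) \<longlonglongrightarrow> 0 + 0 + 0"
    by (rule tendsto_add[OF tendsto_add[OF lim tr(3)] fourier_L2_trunc_limit[OF f]])
  then have "(\<lambda>n. L2norm_on lborel (\<lambda>x. F n x - f x) + L2norm_on lborel (\<lambda>x. trunc n f x - f x)
       + L2norm_on lborel (\<lambda>\<xi>. fourier (trunc n f) \<xi> - fourier_L2 f \<xi>)) \<longlonglongrightarrow> 0" by simp
  then show ?thesis
    by (rule tendsto_sandwich[OF _ _ tendsto_const, rotated 2]) (simp_all add: le)
qed

lemma Plancherel: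
  assumes f: "f \<in> L2_space"
  shows "L2norm_on lborel (fourier_L2 f) = L2norm_on lborel f"
proof (rule LIMSEQ_unique)
  have [measurable]: "f \<in> borel_measurable borel" "fourier_L2 f \<in> borel_measurable borel"
    and fin: "L2norm_on lborel f < \<infinity>" "L2norm_on lborel (fourier_L2 f) < \<infinity>"
    using f fourier_L2_in_L2[OF f] by (auto simp: L2_space_iff)
  note tr = trunc_L2[OF f]
  show "(\<lambda>N. L2norm_on lborel (fourier (trunc N f))) \<longlonglongrightarrow> L2norm_on lborel (fourier_L2 f)"
    by (rule L2norm_on_tendsto[OF _ _ fourier_L2_trunc_limit[OF f] fin(2)]) auto
  show "(\<lambda>N. L2norm_on lborel (fourier (trunc N f))) \<longlonglongrightarrow> L2norm_on lborel f"
    unfolding Plancherel_L1_L2[OF tr(1,2)] by (rule L2norm_on_tendsto[OF _ _ tr(3) fin(1)]) auto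
qed


section \<open>Modulus and convolution on the Fourier side\<close>

lemma fourier_modulate: "fourier (\<lambda>x. wave x \<nu> * u x) \<xi> = fourier u (\<xi> + \<nu>)"
proof -
  have "wave x (\<xi> + \<nu>) = wave x \<xi> * wave x \<nu>" for x
    by (simp add: inner_add_right distrib_left exp_add[symmetric] algebra_simps)
  then have "wave x \<xi> * (wave x \<nu> * u x) = wave x (\<xi> + \<nu>) * u x" for x
    by (simp only: mult.assoc)
  then show ?thesis unfolding fourier_def by (simp only:)
qed

lemma L2norm_on_density_power2:
  assumes [measurable]: "w \<in> borel_measurable borel" "f \<in> borel_measurable borel"
  shows "(L2norm_on (density lborel w) f)\<^sup>2 = (\<integral>\<^sup>+ x. w x * ennreal ((cmod (f x))\<^sup>2) \<partial>lborel)"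
  by (simp add: L2norm_on_power2 nn_integral_density)

lemma L2norm_on_density_le:
  assumes [measurable]: "w \<in> borel_measurable borel" "f \<in> borel_measurable borel"
    and le: "\<And>x. w x \<le> 1"
  shows "L2norm_on (density lborel w) f \<le> L2norm_on lborel f"
  using le mult_right_mono[OF le]
  by (subst power2_le_iff_ennreal[symmetric])
     (auto simp: L2norm_on_density_power2 L2norm_on_power2[of lborel] intro!: nn_integral_mono)

text \<open>
  Multiplying \<open>u\<close> by a character shifts its transform by \<open>\<nu>\<close> and leaves its modulus unchanged, so the
  center of the Gaussian on the left is arbitrary. This freedom is what condition (E2) exploits.
\<close>

lemma gaussian_mean_le_modulus_L1:
  assumes u: "integrable lborel u" and \<epsilon>: "0 < \<epsilon>"
  shows "(\<integral>\<^sup>+ \<xi>. ennreal (gauss \<epsilon> (\<xi> - \<nu>)) * ennreal ((cmod (fourier u \<xi>))\<^sup>2) \<partial>lborel)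
      \<le> (\<integral>\<^sup>+ \<xi>. ennreal (gauss \<epsilon> \<xi>) * ennreal ((cmod (fourier (\<lambda>x. complex_of_real (cmod (u x))) \<xi>))\<^sup>2) \<partial>lborel)"
    (is "?L \<le> ?R")
proof -
  have [measurable]: "u \<in> borel_measurable borel" using u by auto
  let ?h = "\<lambda>x. complex_of_real (cmod (u x))" and ?v = "\<lambda>x. wave x \<nu> * u x"
  have v: "integrable lborel ?v" using u by (rule integrable_wave_mult)
  have h: "integrable lborel ?h" using u by simp
  have vh: "(\<lambda>x. complex_of_real (cmod (?v x))) = ?h" by (simp add: norm_mult)
  have "?L = (\<integral>\<^sup>+ \<xi>. ennreal (gauss \<epsilon> \<xi>) * ennreal ((cmod (fourier u (\<xi> + \<nu>)))\<^sup>2) \<partial>lborel)"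
    using nn_integral_lborel_shift[of "\<lambda>\<xi>. ennreal (gauss \<epsilon> (\<xi> - \<nu>)) * ennreal ((cmod (fourier u \<xi>))\<^sup>2)" "- \<nu>"] by simp
  also have "\<dots> = (\<integral>\<^sup>+ \<xi>. ennreal ((cmod (fourier ?v \<xi>))\<^sup>2 * gauss \<epsilon> \<xi>) \<partial>lborel)"
    unfolding fourier_modulate by (simp add: ennreal_mult mult.commute)
  also have "\<dots> = ennreal (\<integral>\<xi>. (cmod (fourier ?v \<xi>))\<^sup>2 * gauss \<epsilon> \<xi> \<partial>lborel)"
    by (rule nn_integral_eq_integral[OF integrable_fourier_gauss[OF v \<epsilon>]]) simp
  also have "\<dots> \<le> ennreal (\<integral>\<xi>. (cmod (fourier ?h \<xi>))\<^sup>2 * gauss \<epsilon> \<xi> \<partial>lborel)"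
    using gaussian_mean_le_modulus[OF v \<epsilon>] unfolding vh by (rule ennreal_leI)
  also have "\<dots> = (\<integral>\<^sup>+ \<xi>. ennreal ((cmod (fourier ?h \<xi>))\<^sup>2 * gauss \<epsilon> \<xi>) \<partial>lborel)"
    by (rule nn_integral_eq_integral[OF integrable_fourier_gauss[OF h \<epsilon>], symmetric]) simp
  also have "\<dots> = ?R"
    by (simp add: ennreal_mult mult.commute)
  finally show ?thesis .
qed

lemma modulus_in_L2:
  assumes "u \<in> L2_space"
  shows "(\<lambda>x. complex_of_real (cmod (u x))) \<in> L2_space"
proof -
  have [measurable]: "u \<in> borel_measurable borel" using assms by (simp add: L2_space_iff)
  show ?thesis using assms by (simp add: L2_space_iff L2norm_on_def)
qed

lemma L2norm_on_density_fourier_trunc_tendsto: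
  assumes u: "u \<in> L2_space" and [measurable]: "w \<in> borel_measurable borel" and le: "\<And>x. w x \<le> 1"
  shows "(\<lambda>N. L2norm_on (density lborel w) (fourier (trunc N u))) \<longlonglongrightarrow> L2norm_on (density lborel w) (fourier_L2 u)"
proof -
  have [measurable]: "u \<in> borel_measurable borel" "fourier_L2 u \<in> borel_measurable borel"
    using u fourier_L2_in_L2[OF u] by (auto simp: L2_space_iff)
  have dle: "L2norm_on (density lborel w) f \<le> L2norm_on lborel f" if "f \<in> borel_measurable borel" for f
    by (rule L2norm_on_density_le) (use that le in auto)
  show ?thesis
  proof (rule L2norm_on_tendsto)
    show "(\<lambda>n. L2norm_on (density lborel w) (\<lambda>x. fourier (trunc n u) x - fourier_L2 u x)) \<longlonglongrightarrow> 0"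
      by (rule tendsto_sandwich[OF _ _ tendsto_const fourier_L2_trunc_limit[OF u]]) (simp_all add: dle)
    show "L2norm_on (density lborel w) (fourier_L2 u) < \<infinity>"
      using dle[of "fourier_L2 u"] fourier_L2_in_L2[OF u] by (auto simp: L2_space_iff intro: le_less_trans)
  qed auto
qed

lemma gaussian_mean_le_modulus_L2:
  assumes u: "u \<in> L2_space" and \<epsilon>: "0 < \<epsilon>"
  defines "h \<equiv> (\<lambda>x. complex_of_real (cmod (u x)))"
  shows "(\<integral>\<^sup>+ \<xi>. ennreal (gauss \<epsilon> (\<xi> - \<nu>)) * ennreal ((cmod (fourier_L2 u \<xi>))\<^sup>2) \<partial>lborel)
      \<le> (\<integral>\<^sup>+ \<xi>. ennreal (gauss \<epsilon> \<xi>) * ennreal ((cmod (fourier_L2 h \<xi>))\<^sup>2) \<partial>lborel)"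
proof -
  have h: "h \<in> L2_space" unfolding h_def by (rule modulus_in_L2[OF u])
  have [measurable]: "u \<in> borel_measurable borel" "fourier_L2 u \<in> borel_measurable borel"
    "h \<in> borel_measurable borel" "fourier_L2 h \<in> borel_measurable borel"
    using u fourier_L2_in_L2[OF u] h fourier_L2_in_L2[OF h] by (auto simp: L2_space_iff)
  have trh: "trunc N h = (\<lambda>x. complex_of_real (cmod (trunc N u x)))" for N
    by (auto simp: trunc_def h_def norm_mult split: split_indicator)
  have "L2norm_on (density lborel (\<lambda>\<xi>. ennreal (gauss \<epsilon> (\<xi> - \<nu>)))) (fourier_L2 u)
      \<le> L2norm_on (density lborel (\<lambda>\<xi>. ennreal (gauss \<epsilon> \<xi>))) (fourier_L2 h)"
  proof (rule LIMSEQ_le)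
    show "(\<lambda>N. L2norm_on (density lborel (\<lambda>\<xi>. ennreal (gauss \<epsilon> (\<xi> - \<nu>)))) (fourier (trunc N u))) \<longlonglongrightarrow>
        L2norm_on (density lborel (\<lambda>\<xi>. ennreal (gauss \<epsilon> (\<xi> - \<nu>)))) (fourier_L2 u)"
      by (rule L2norm_on_density_fourier_trunc_tendsto[OF u]) auto
    show "(\<lambda>N. L2norm_on (density lborel (\<lambda>\<xi>. ennreal (gauss \<epsilon> \<xi>))) (fourier (trunc N h))) \<longlonglongrightarrow>
        L2norm_on (density lborel (\<lambda>\<xi>. ennreal (gauss \<epsilon> \<xi>))) (fourier_L2 h)"
      by (rule L2norm_on_density_fourier_trunc_tendsto[OF h]) auto
    have "L2norm_on (density lborel (\<lambda>\<xi>. ennreal (gauss \<epsilon> (\<xi> - \<nu>)))) (fourier (trunc N u))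
      \<le> L2norm_on (density lborel (\<lambda>\<xi>. ennreal (gauss \<epsilon> \<xi>))) (fourier (trunc N h))" for N
      using gaussian_mean_le_modulus_L1[OF integrable_trunc[OF u] \<epsilon>, of \<nu> N]
      by (subst power2_le_iff_ennreal[symmetric]) (simp add: L2norm_on_density_power2 trh)
    then show "\<exists>N. \<forall>n\<ge>N. L2norm_on (density lborel (\<lambda>\<xi>. ennreal (gauss \<epsilon> (\<xi> - \<nu>)))) (fourier (trunc n u))
      \<le> L2norm_on (density lborel (\<lambda>\<xi>. ennreal (gauss \<epsilon> \<xi>))) (fourier (trunc n h))" by blast
  qed
  then show ?thesis
    by (subst (asm) power2_le_iff_ennreal[symmetric]) (simp add: L2norm_on_density_power2)
qed

text \<open>
  The function and its modulus have the same total energy by Plancherel's theorem; a lower bound for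
  the Gaussian mean of the modulus is therefore an upper bound for the complementary mean.
\<close>

lemma gaussian_defect_modulus_le:
  assumes u: "u \<in> L2_space" and \<epsilon>: "0 < \<epsilon>"
  defines "h \<equiv> (\<lambda>x. complex_of_real (cmod (u x)))"
  shows "(\<integral>\<^sup>+ \<xi>. ennreal (1 - gauss \<epsilon> \<xi>) * ennreal ((cmod (fourier_L2 h \<xi>))\<^sup>2) \<partial>lborel)
      \<le> (\<integral>\<^sup>+ \<xi>. ennreal (1 - gauss \<epsilon> (\<xi> - \<nu>)) * ennreal ((cmod (fourier_L2 u \<xi>))\<^sup>2) \<partial>lborel)"
proof -
  have h: "h \<in> L2_space" unfolding h_def by (rule modulus_in_L2[OF u])
  have split: "(\<integral>\<^sup>+ \<xi>. ennreal (1 - gauss \<epsilon> (\<xi> - a)) * ennreal ((cmod (fourier_L2 v \<xi>))\<^sup>2) \<partial>lborel)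
     + (\<integral>\<^sup>+ \<xi>. ennreal (gauss \<epsilon> (\<xi> - a)) * ennreal ((cmod (fourier_L2 v \<xi>))\<^sup>2) \<partial>lborel) = (L2norm_on lborel v)\<^sup>2"
    if v: "v \<in> L2_space" for v a
  proof -
    have [measurable]: "fourier_L2 v \<in> borel_measurable borel"
      using fourier_L2_in_L2[OF v] by (auto simp: L2_space_iff)
    have "ennreal (1 - gauss \<epsilon> (\<xi> - a)) + ennreal (gauss \<epsilon> (\<xi> - a)) = 1" for \<xi>
      by (subst ennreal_plus[symmetric]) auto
    then show ?thesis
      unfolding Plancherel[OF v, symmetric] L2norm_on_power2
      by (subst nn_integral_add[symmetric]) (simp_all flip: distrib_right)
  qed
  let ?Gu = "\<integral>\<^sup>+ \<xi>. ennreal (gauss \<epsilon> (\<xi> - \<nu>)) * ennreal ((cmod (fourier_L2 u \<xi>))\<^sup>2) \<partial>lborel"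
  let ?Gh = "\<integral>\<^sup>+ \<xi>. ennreal (gauss \<epsilon> \<xi>) * ennreal ((cmod (fourier_L2 h \<xi>))\<^sup>2) \<partial>lborel"
  let ?Du = "\<integral>\<^sup>+ \<xi>. ennreal (1 - gauss \<epsilon> (\<xi> - \<nu>)) * ennreal ((cmod (fourier_L2 u \<xi>))\<^sup>2) \<partial>lborel"
  let ?Dh = "\<integral>\<^sup>+ \<xi>. ennreal (1 - gauss \<epsilon> \<xi>) * ennreal ((cmod (fourier_L2 h \<xi>))\<^sup>2) \<partial>lborel"
  have eq_h: "?Dh + ?Gh = (L2norm_on lborel h)\<^sup>2" using split[OF h, of 0] by simp
  have "?Gh + ?Dh = ?Gu + ?Du"
    using split[OF u, of \<nu>] eq_h by (simp add: add.commute L2norm_on_def h_def)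
  also have "\<dots> \<le> ?Gh + ?Du"
    using gaussian_mean_le_modulus_L2[OF u \<epsilon>, of \<nu>] unfolding h_def by (rule add_right_mono)
  finally have le: "?Gh + ?Dh \<le> ?Gh + ?Du" .
  have "?Gh \<le> (L2norm_on lborel h)\<^sup>2" unfolding eq_h[symmetric] by simp
  also have "\<dots> < top" using h by (simp add: L2_space_iff power_less_top_ennreal)
  finally show ?thesis using le by (auto simp: ennreal_add_left_cancel_le)
qed

lemma L2norm_on_mult_bounded:
  assumes [measurable]: "f \<in> borel_measurable M" and B: "\<And>x. cmod (m x) \<le> B"
  shows "L2norm_on M (\<lambda>x. f x * m x) \<le> ennreal B * L2norm_on M f"
proof (subst power2_le_iff_ennreal[symmetric])
  have B0: "0 \<le> B" using B norm_ge_zero order_trans by blast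
  have "(L2norm_on M (\<lambda>x. f x * m x))\<^sup>2 \<le> (\<integral>\<^sup>+ x. ennreal (B\<^sup>2) * ennreal ((cmod (f x))\<^sup>2) \<partial>M)"
    unfolding L2norm_on_power2
  proof (rule nn_integral_mono)
    fix x
    have "(cmod (f x * m x))\<^sup>2 = (cmod (m x))\<^sup>2 * (cmod (f x))\<^sup>2"
      by (simp add: norm_mult power_mult_distrib mult.commute)
    also have "\<dots> \<le> B\<^sup>2 * (cmod (f x))\<^sup>2"
      by (intro mult_right_mono power_mono B) auto
    finally have "ennreal ((cmod (f x * m x))\<^sup>2) \<le> ennreal (B\<^sup>2 * (cmod (f x))\<^sup>2)" by (rule ennreal_leI)
    then show "ennreal ((cmod (f x * m x))\<^sup>2) \<le> ennreal (B\<^sup>2) * ennreal ((cmod (f x))\<^sup>2)"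
      by (simp only: ennreal_mult zero_le_power2)
  qed
  also have "\<dots> = (ennreal B * L2norm_on M f)\<^sup>2"
    using B0 by (simp add: nn_integral_cmult L2norm_on_power2 power_mult_distrib ennreal_power)
  finally show "(L2norm_on M (\<lambda>x. f x * m x))\<^sup>2 \<le> (ennreal B * L2norm_on M f)\<^sup>2" .
qed

lemma cmod_convol_le:
  "ennreal (cmod (convol f g x)) \<le> (\<integral>\<^sup>+ y. ennreal (cmod (f y)) * ennreal (cmod (g (x - y))) \<partial>lborel)"
proof (cases "integrable lborel (\<lambda>y. f y * g (x - y))")
  case True
  then show ?thesis
    using integral_norm_bound_ennreal[OF True] by (simp add: convol_def norm_mult ennreal_mult)
qed (simp add: convol_def not_integrable_integral_eq)

text \<open>Cauchy-Schwarz with the kernel split as \<open>\<bar>g\<bar> = sqrt \<bar>g\<bar> * sqrt \<bar>g\<bar>\<close>, followed by Tonelli.\<close>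

lemma Young_L2_L1:
  assumes [measurable]: "f \<in> borel_measurable borel" and g: "integrable lborel g"
  shows "L2norm_on lborel (convol f g) \<le> ennreal (\<integral>x. cmod (g x) \<partial>lborel) * L2norm_on lborel f"
proof (subst power2_le_iff_ennreal[symmetric])
  have [measurable]: "g \<in> borel_measurable borel" using g by auto
  define A where "A = (\<integral>\<^sup>+ x. ennreal (cmod (g x)) \<partial>lborel)"
  have A: "A = ennreal (\<integral>x. cmod (g x) \<partial>lborel)"
    unfolding A_def using g by (intro nn_integral_eq_integral) auto
  have pt: "ennreal ((cmod (convol f g x))\<^sup>2)
      \<le> (\<integral>\<^sup>+ y. ennreal ((cmod (f y))\<^sup>2) * ennreal (cmod (g (x - y))) \<partial>lborel) * A" for x
  proof -
    let ?s = "\<lambda>y. ennreal (sqrt (cmod (g (x - y))))"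
    have ss: "?s y * ?s y = ennreal (cmod (g (x - y)))" for y
      by (simp flip: ennreal_mult)
    have "ennreal ((cmod (convol f g x))\<^sup>2) = (ennreal (cmod (convol f g x)))\<^sup>2"
      by (simp add: ennreal_power)
    also have "\<dots> \<le> (\<integral>\<^sup>+ y. (ennreal (cmod (f y)) * ?s y) * ?s y \<partial>lborel)\<^sup>2"
      using cmod_convol_le[of f g x] by (intro power_mono) (simp_all add: mult.assoc ss)
    also have "\<dots> \<le> (\<integral>\<^sup>+ y. (ennreal (cmod (f y)) * ?s y)\<^sup>2 \<partial>lborel) * (\<integral>\<^sup>+ y. (?s y)\<^sup>2 \<partial>lborel)"
      by (rule Cauchy_Schwarz_nn_integral) measurable
    also have "(\<integral>\<^sup>+ y. (?s y)\<^sup>2 \<partial>lborel) = A"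
      using nn_integral_lborel_reflect[of "\<lambda>y. ennreal (cmod (g y))" x]
      by (simp add: power2_eq_square ss A_def)
    also have "(\<integral>\<^sup>+ y. (ennreal (cmod (f y)) * ?s y)\<^sup>2 \<partial>lborel) = (\<integral>\<^sup>+ y. ennreal ((cmod (f y))\<^sup>2) * ennreal (cmod (g (x - y))) \<partial>lborel)"
      by (simp add: power_mult_distrib power2_eq_square[of "?s _"] ss ennreal_power)
    finally show ?thesis .
  qed
  have "(L2norm_on lborel (convol f g))\<^sup>2 \<le> (\<integral>\<^sup>+ x. (\<integral>\<^sup>+ y. ennreal ((cmod (f y))\<^sup>2) * ennreal (cmod (g (x - y))) \<partial>lborel) * A \<partial>lborel)"
    unfolding L2norm_on_power2 by (intro nn_integral_mono pt)
  also have "\<dots> = (\<integral>\<^sup>+ x. (\<integral>\<^sup>+ y. ennreal ((cmod (f y))\<^sup>2) * ennreal (cmod (g (x - y))) \<partial>lborel) \<partial>lborel) * A"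
    by (rule nn_integral_multc) measurable
  also have "(\<integral>\<^sup>+ x. (\<integral>\<^sup>+ y. ennreal ((cmod (f y))\<^sup>2) * ennreal (cmod (g (x - y))) \<partial>lborel) \<partial>lborel)
      = (\<integral>\<^sup>+ y. (\<integral>\<^sup>+ x. ennreal ((cmod (f y))\<^sup>2) * ennreal (cmod (g (x - y))) \<partial>lborel) \<partial>lborel)"
    by (rule lborel_pair.Fubini') measurable
  also have "\<dots> = (\<integral>\<^sup>+ y. ennreal ((cmod (f y))\<^sup>2) * A \<partial>lborel)"
    using nn_integral_lborel_shift[of "\<lambda>y. ennreal (cmod (g y))"]
    by (simp add: nn_integral_cmult A_def)
  also have "\<dots> = (L2norm_on lborel f)\<^sup>2 * A"
    by (simp add: nn_integral_multc L2norm_on_power2)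
  finally show "(L2norm_on lborel (convol f g))\<^sup>2 \<le> (ennreal (\<integral>x. cmod (g x) \<partial>lborel) * L2norm_on lborel f)\<^sup>2"
    unfolding A by (simp add: power2_eq_square mult_ac)
qed

lemma integrable_L2_mult:
  assumes [measurable]: "f \<in> borel_measurable borel" "g \<in> borel_measurable borel"
    and fin: "L2norm_on lborel f < \<infinity>" "L2norm_on lborel g < \<infinity>"
  shows "integrable lborel (\<lambda>y. f y * g (x - y) :: complex)"
proof (rule integrableI_bounded)
  have "(\<integral>\<^sup>+ y. ennreal (cmod (f y)) * ennreal (cmod (g (x - y))) \<partial>lborel)\<^sup>2
    \<le> (\<integral>\<^sup>+ y. (ennreal (cmod (f y)))\<^sup>2 \<partial>lborel) * (\<integral>\<^sup>+ y. (ennreal (cmod (g (x - y))))\<^sup>2 \<partial>lborel)"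
    by (rule Cauchy_Schwarz_nn_integral) measurable
  also have "\<dots> = (L2norm_on lborel f)\<^sup>2 * (L2norm_on lborel g)\<^sup>2"
    using nn_integral_lborel_reflect[of "\<lambda>y. ennreal ((cmod (g y))\<^sup>2)" x]
    by (simp add: L2norm_on_power2 ennreal_power)
  also have "\<dots> < top" using fin by (simp add: ennreal_mult_less_top power_less_top_ennreal)
  finally show "(\<integral>\<^sup>+ y. ennreal (norm (f y * g (x - y))) \<partial>lborel) < \<infinity>"
    by (simp add: norm_mult ennreal_mult power_less_top_ennreal)
qed measurable

text \<open>
  Truncate \<open>g\<close>: the convolutions converge by Young's inequality, their transforms are products by
  the integrable case, and the factor \<open>fourier \<psi>\<close> is bounded.
\<close>

lemma fourier_L2_convol:
  assumes g: "g \<in> L2_space" and \<psi>: "\<psi> \<in> L1_space \<inter> L2_space"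
  shows convol_in_L2: "convol g \<psi> \<in> L2_space"
    and "AE \<xi> in lborel. fourier_L2 (convol g \<psi>) \<xi> = fourier_L2 g \<xi> * fourier \<psi> \<xi>"
proof -
  have \<psi>1: "integrable lborel \<psi>" using \<psi> by (auto simp: L1_space_def)
  have [measurable]: "g \<in> borel_measurable borel" "fourier_L2 g \<in> borel_measurable borel" "\<psi> \<in> borel_measurable borel"
    and fin: "L2norm_on lborel g < \<infinity>" "L2norm_on lborel \<psi> < \<infinity>"
    using g \<psi> fourier_L2_in_L2[OF g] by (auto simp: L2_space_iff)
  let ?B = "\<integral>x. cmod (\<psi> x) \<partial>lborel"
  have young: "L2norm_on lborel (convol f \<psi>) < \<infinity>" if [measurable]: "f \<in> borel_measurable borel" and "L2norm_on lborel f < \<infinity>" for f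
    using that(2) by (intro le_less_trans[OF Young_L2_L1[OF _ \<psi>1]]) (auto simp: ennreal_mult_less_top)
  show u: "convol g \<psi> \<in> L2_space"
    using young[of g] fin by (simp add: L2_space_iff)
  have [measurable]: "fourier_L2 (convol g \<psi>) \<in> borel_measurable borel"
    using fourier_L2_in_L2[OF u] by (simp add: L2_space_iff)
  note tr = trunc_L2[OF g]
  have diff: "convol (trunc N g) \<psi> x - convol g \<psi> x = convol (\<lambda>x. trunc N g x - g x) \<psi> x" for N x
    unfolding convol_def left_diff_distrib
    by (rule Bochner_Integration.integral_diff[symmetric]) (intro integrable_L2_mult fin tr; simp)+
  have "(\<lambda>N. L2norm_on lborel (\<lambda>x. convol (trunc N g) \<psi> x - convol g \<psi> x)) \<longlonglongrightarrow> 0"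
  proof (rule tendsto_sandwich[OF _ _ tendsto_const])
    show "\<forall>\<^sub>F N in sequentially. L2norm_on lborel (\<lambda>x. convol (trunc N g) \<psi> x - convol g \<psi> x) \<le> ennreal ?B * L2norm_on lborel (\<lambda>x. trunc N g x - g x)"
      unfolding diff by (intro always_eventually allI Young_L2_L1 \<psi>1) auto
    have "(\<lambda>N. ennreal ?B * L2norm_on lborel (\<lambda>x. trunc N g x - g x)) \<longlonglongrightarrow> ennreal ?B * 0"
      by (intro tendsto_mult_ennreal tendsto_const tr) auto
    then show "(\<lambda>N. ennreal ?B * L2norm_on lborel (\<lambda>x. trunc N g x - g x)) \<longlonglongrightarrow> 0" by simp
  qed simp
  then have lim1: "(\<lambda>N. L2norm_on lborel (\<lambda>\<xi>. fourier (convol (trunc N g) \<psi>) \<xi> - fourier_L2 (convol g \<psi>) \<xi>)) \<longlonglongrightarrow> 0"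
    by (intro fourier_L2_limit[OF u] integrable_convol tr \<psi>1 young) auto
  have lim2: "(\<lambda>N. L2norm_on lborel (\<lambda>\<xi>. fourier (convol (trunc N g) \<psi>) \<xi> - fourier_L2 g \<xi> * fourier \<psi> \<xi>)) \<longlonglongrightarrow> 0"
  proof (rule tendsto_sandwich[OF _ _ tendsto_const])
    have "L2norm_on lborel (\<lambda>\<xi>. fourier (convol (trunc N g) \<psi>) \<xi> - fourier_L2 g \<xi> * fourier \<psi> \<xi>)
        \<le> ennreal ?B * L2norm_on lborel (\<lambda>\<xi>. fourier (trunc N g) \<xi> - fourier_L2 g \<xi>)" for N
      unfolding fourier_convol[OF tr(1) \<psi>1] left_diff_distrib[symmetric]
      by (rule L2norm_on_mult_bounded) (auto intro: cmod_fourier_le)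
    then show "\<forall>\<^sub>F N in sequentially. L2norm_on lborel (\<lambda>\<xi>. fourier (convol (trunc N g) \<psi>) \<xi> - fourier_L2 g \<xi> * fourier \<psi> \<xi>)
        \<le> ennreal ?B * L2norm_on lborel (\<lambda>\<xi>. fourier (trunc N g) \<xi> - fourier_L2 g \<xi>)" by simp
    have "(\<lambda>N. ennreal ?B * L2norm_on lborel (\<lambda>\<xi>. fourier (trunc N g) \<xi> - fourier_L2 g \<xi>)) \<longlonglongrightarrow> ennreal ?B * 0"
      by (intro tendsto_mult_ennreal tendsto_const fourier_L2_trunc_limit g) auto
    then show "(\<lambda>N. ennreal ?B * L2norm_on lborel (\<lambda>\<xi>. fourier (trunc N g) \<xi> - fourier_L2 g \<xi>)) \<longlonglongrightarrow> 0" by simp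
  qed simp
  show "AE \<xi> in lborel. fourier_L2 (convol g \<psi>) \<xi> = fourier_L2 g \<xi> * fourier \<psi> \<xi>"
    by (rule L2norm_on_limit_unique[OF _ _ _ lim1 lim2]) auto
qed


section \<open>Homogeneous energy of a modulus\<close>

text \<open>
  The density \<open>\<epsilon>\<^bsup>-1-\<tau>\<^esup>\<close> on the half line, which turns the scaling \<open>\<rho> \<mapsto> t * \<rho>\<close> into the factor
  \<open>t powr \<tau>\<close>.
\<close>

definition scale_weight :: "real \<Rightarrow> real \<Rightarrow> real" where
  "scale_weight \<tau> \<epsilon> = (if 0 < \<epsilon> then \<epsilon> powr (- 1 - \<tau>) else 0)"

lemma borel_measurable_scale_weight [measurable]: "scale_weight \<tau> \<in> borel_measurable borel"
  unfolding scale_weight_def[abs_def] by measurable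

lemma scale_weight_nonneg: "0 \<le> scale_weight \<tau> \<epsilon>"
  by (simp add: scale_weight_def)

definition mixture_const :: "real \<Rightarrow> ennreal" where
  "mixture_const \<tau> = (\<integral>\<^sup>+ \<epsilon>. ennreal (scale_weight \<tau> \<epsilon> * (1 - exp (- pi * \<epsilon>\<^sup>2))) \<partial>lborel)"

text \<open>
  The factor \<open>1 - exp (- \<pi> \<epsilon>\<^sup>2)\<close> is at most \<open>\<pi> \<epsilon>\<^sup>2\<close>, which makes the integral converge at \<open>0\<close> exactly
  for \<open>\<tau> < 2\<close>, and at most \<open>1\<close>, which suffices at infinity for \<open>\<tau> > 0\<close>.
\<close>

lemma mixture_const_finite:
  assumes "0 < \<tau>" "\<tau> < 2"
  shows "mixture_const \<tau> < top"
proof -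
  have restrict: "((\<lambda>x. indicator S x * f x) has_integral I) UNIV" if "(f has_integral I) S"
    for S :: "real set" and f :: "real \<Rightarrow> real" and I
  proof -
    have "(\<lambda>x. indicator S x * f x) = (\<lambda>x. if x \<in> S then f x else 0)" by auto
    then show ?thesis using that by (simp only: has_integral_restrict_UNIV)
  qed
  have "mixture_const \<tau> \<le> (\<integral>\<^sup>+ \<epsilon>. ennreal pi * ennreal (indicator {0..1} \<epsilon> * \<epsilon> powr (1 - \<tau>)) + ennreal (indicator {1..} \<epsilon> * \<epsilon> powr (- 1 - \<tau>)) \<partial>lborel)"
    unfolding mixture_const_def
  proof (rule nn_integral_mono)
    fix \<epsilon> :: real
    have "scale_weight \<tau> \<epsilon> * (1 - exp (- pi * \<epsilon>\<^sup>2)) \<le> pi * (indicator {0..1} \<epsilon> * \<epsilon> powr (1 - \<tau>)) + indicator {1..} \<epsilon> * \<epsilon> powr (- 1 - \<tau>)"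
    proof (cases "0 < \<epsilon> \<and> \<epsilon> \<le> 1")
      case True
      have "1 - exp (- pi * \<epsilon>\<^sup>2) \<le> pi * \<epsilon>\<^sup>2"
        using exp_ge_add_one_self[of "- pi * \<epsilon>\<^sup>2"] by linarith
      then have "\<epsilon> powr (- 1 - \<tau>) * (1 - exp (- pi * \<epsilon>\<^sup>2)) \<le> \<epsilon> powr (- 1 - \<tau>) * (pi * \<epsilon>\<^sup>2)"
        by (rule mult_left_mono) simp
      also have "\<dots> = pi * \<epsilon> powr (1 - \<tau>)"
        using True powr_add[of \<epsilon> "- 1 - \<tau>" 2] by (simp add: powr_numeral)
      finally show ?thesis
        using True by (simp add: scale_weight_def add_increasing2)
    next
      case False
      then show ?thesis
        by (cases "0 < \<epsilon>") (auto simp: scale_weight_def mult_left_le)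
    qed
    then have "ennreal (scale_weight \<tau> \<epsilon> * (1 - exp (- pi * \<epsilon>\<^sup>2))) \<le> ennreal (pi * (indicator {0..1} \<epsilon> * \<epsilon> powr (1 - \<tau>)) + indicator {1..} \<epsilon> * \<epsilon> powr (- 1 - \<tau>))"
      by (rule ennreal_leI)
    then show "ennreal (scale_weight \<tau> \<epsilon> * (1 - exp (- pi * \<epsilon>\<^sup>2))) \<le> ennreal pi * ennreal (indicator {0..1} \<epsilon> * \<epsilon> powr (1 - \<tau>)) + ennreal (indicator {1..} \<epsilon> * \<epsilon> powr (- 1 - \<tau>))"
      by (simp add: ennreal_mult)
  qed
  also have "\<dots> = ennreal pi * (\<integral>\<^sup>+ \<epsilon>. ennreal (indicator {0..1} \<epsilon> * \<epsilon> powr (1 - \<tau>)) \<partial>lborel) + (\<integral>\<^sup>+ \<epsilon>. ennreal (indicator {1..} \<epsilon> * \<epsilon> powr (- 1 - \<tau>)) \<partial>lborel)"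
    by (simp add: nn_integral_add nn_integral_cmult)
  also have "(\<integral>\<^sup>+ \<epsilon>. ennreal (indicator {0..1} \<epsilon> * \<epsilon> powr (1 - \<tau>)) \<partial>lborel) = ennreal (1 powr (1 - \<tau> + 1) / (1 - \<tau> + 1))"
    using assms by (intro nn_integral_has_integral_lborel restrict has_integral_powr_from_0) auto
  also have "(\<integral>\<^sup>+ \<epsilon>. ennreal (indicator {1..} \<epsilon> * \<epsilon> powr (- 1 - \<tau>)) \<partial>lborel) = ennreal (- (1 powr (- 1 - \<tau> + 1)) / (- 1 - \<tau> + 1))"
    using assms by (intro nn_integral_has_integral_lborel restrict has_integral_powr_to_inf) auto
  finally show ?thesis
    by (auto simp: ennreal_mult_less_top intro: le_less_trans)
qed

lemma mixture_const_pos: "0 < mixture_const \<tau>"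
proof (rule ccontr)
  assume "\<not> 0 < mixture_const \<tau>"
  then have "AE \<epsilon> in lborel. scale_weight \<tau> \<epsilon> * (1 - exp (- pi * \<epsilon>\<^sup>2)) \<le> 0"
    by (simp add: mixture_const_def nn_integral_0_iff_AE ennreal_eq_0_iff)
  then have "AE \<epsilon> in lborel. (\<epsilon>::real) \<notin> {1<..<2}"
  proof eventually_elim
    fix \<epsilon> :: real assume le: "scale_weight \<tau> \<epsilon> * (1 - exp (- pi * \<epsilon>\<^sup>2)) \<le> 0"
    have "0 < scale_weight \<tau> \<epsilon> * (1 - exp (- pi * \<epsilon>\<^sup>2))" if "0 < \<epsilon>"
      using that by (simp add: scale_weight_def)
    with le show "\<epsilon> \<notin> {1<..<2}" by fastforce
  qed
  then have "{1<..<2::real} \<in> null_sets lborel"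
    by (subst AE_iff_null_sets) auto
  then have "emeasure lborel {1<..<2::real} = 0" by (rule null_setsD1)
  then show False by simp
qed

text \<open>
  The homogeneous weight \<open>\<rho> powr \<tau>\<close> is a positive mixture of the defects \<open>1 - exp (- \<pi> \<epsilon>\<^sup>2 \<rho>\<^sup>2)\<close>;
  substitute \<open>\<epsilon> = s / \<rho>\<close>.
\<close>

lemma gaussian_mixture_scaling:
  assumes "0 < \<tau>" "0 \<le> \<rho>"
  shows "(\<integral>\<^sup>+ \<epsilon>. ennreal (scale_weight \<tau> \<epsilon> * (1 - exp (- pi * \<epsilon>\<^sup>2 * \<rho>\<^sup>2))) \<partial>lborel)
       = mixture_const \<tau> * ennreal (\<rho> powr \<tau>)"
proof (cases "\<rho> = 0")
  case False
  then have \<rho>: "0 < \<rho>" using assms by simp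
  have "(\<integral>\<^sup>+ \<epsilon>. ennreal (scale_weight \<tau> \<epsilon> * (1 - exp (- pi * \<epsilon>\<^sup>2 * \<rho>\<^sup>2))) \<partial>lborel)
      = ennreal \<bar>1 / \<rho>\<bar> * (\<integral>\<^sup>+ s. ennreal (scale_weight \<tau> (0 + 1 / \<rho> * s) * (1 - exp (- pi * (0 + 1 / \<rho> * s)\<^sup>2 * \<rho>\<^sup>2))) \<partial>lborel)"
    using \<rho> by (intro nn_integral_real_affine) auto
  also have "\<dots> = ennreal (1 / \<rho>) * (\<integral>\<^sup>+ s. ennreal (\<rho> powr (1 + \<tau>)) * ennreal (scale_weight \<tau> s * (1 - exp (- pi * s\<^sup>2))) \<partial>lborel)"
  proof -
    have "scale_weight \<tau> (0 + 1 / \<rho> * s) * (1 - exp (- pi * (0 + 1 / \<rho> * s)\<^sup>2 * \<rho>\<^sup>2))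
        = \<rho> powr (1 + \<tau>) * (scale_weight \<tau> s * (1 - exp (- pi * s\<^sup>2)))" for s
    proof -
      have "scale_weight \<tau> (s / \<rho>) = \<rho> powr (1 + \<tau>) * scale_weight \<tau> s"
        using \<rho> by (auto simp: scale_weight_def powr_divide powr_minus_divide[symmetric] zero_less_divide_iff field_simps
            simp flip: powr_minus_divide) (simp add: powr_diff powr_minus powr_add field_simps)
      moreover have "(s / \<rho>)\<^sup>2 * \<rho>\<^sup>2 = s\<^sup>2" using \<rho> by (simp add: power_divide)
      ultimately show ?thesis by (simp add: mult.assoc)
    qed
    moreover have "0 \<le> scale_weight \<tau> s * (1 - exp (- pi * s\<^sup>2))" for s
      by (simp add: scale_weight_nonneg)
    moreover have "\<bar>1 / \<rho>\<bar> = 1 / \<rho>" using \<rho> by simp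
    ultimately show ?thesis by (simp only: ennreal_mult[OF powr_ge_zero])
  qed
  also have "\<dots> = ennreal (1 / \<rho> * \<rho> powr (1 + \<tau>)) * mixture_const \<tau>"
    using \<rho> by (simp add: nn_integral_cmult mixture_const_def ennreal_mult mult.assoc del: times_divide_eq_left)
  also have "1 / \<rho> * \<rho> powr (1 + \<tau>) = \<rho> powr \<tau>"
    using \<rho> by (simp add: powr_add)
  finally show ?thesis by (simp add: mult.commute)
qed (use assms in simp)

lemma gaussian_mixture:
  fixes v :: "real^2 \<Rightarrow> ennreal" and \<rho> :: "real^2 \<Rightarrow> real"
  assumes [measurable]: "v \<in> borel_measurable borel" "\<rho> \<in> borel_measurable borel"
    and "0 < \<tau>" "\<And>\<xi>. 0 \<le> \<rho> \<xi>"
  shows "(\<integral>\<^sup>+ \<epsilon>. ennreal (scale_weight \<tau> \<epsilon>) * (\<integral>\<^sup>+ \<xi>. ennreal (1 - exp (- pi * \<epsilon>\<^sup>2 * (\<rho> \<xi>)\<^sup>2)) * v \<xi> \<partial>lborel) \<partial>lborel)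
      = mixture_const \<tau> * (\<integral>\<^sup>+ \<xi>. ennreal (\<rho> \<xi> powr \<tau>) * v \<xi> \<partial>lborel)"
proof -
  have "(\<integral>\<^sup>+ \<epsilon>. ennreal (scale_weight \<tau> \<epsilon>) * (\<integral>\<^sup>+ \<xi>. ennreal (1 - exp (- pi * \<epsilon>\<^sup>2 * (\<rho> \<xi>)\<^sup>2)) * v \<xi> \<partial>lborel) \<partial>lborel)
     = (\<integral>\<^sup>+ \<epsilon>. (\<integral>\<^sup>+ \<xi>. ennreal (scale_weight \<tau> \<epsilon> * (1 - exp (- pi * \<epsilon>\<^sup>2 * (\<rho> \<xi>)\<^sup>2))) * v \<xi> \<partial>lborel) \<partial>lborel)"
    by (simp add: nn_integral_cmult[symmetric] ennreal_mult scale_weight_nonneg mult.assoc)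
  also have "\<dots> = (\<integral>\<^sup>+ \<xi>. (\<integral>\<^sup>+ \<epsilon>. ennreal (scale_weight \<tau> \<epsilon> * (1 - exp (- pi * \<epsilon>\<^sup>2 * (\<rho> \<xi>)\<^sup>2))) * v \<xi> \<partial>lborel) \<partial>lborel)"
    by (rule lborel_pair.Fubini') measurable
  also have "\<dots> = (\<integral>\<^sup>+ \<xi>. mixture_const \<tau> * (ennreal (\<rho> \<xi> powr \<tau>) * v \<xi>) \<partial>lborel)"
  proof (rule nn_integral_cong)
    fix \<xi>
    have "(\<integral>\<^sup>+ \<epsilon>. ennreal (scale_weight \<tau> \<epsilon> * (1 - exp (- pi * \<epsilon>\<^sup>2 * (\<rho> \<xi>)\<^sup>2))) * v \<xi> \<partial>lborel)
       = (\<integral>\<^sup>+ \<epsilon>. ennreal (scale_weight \<tau> \<epsilon> * (1 - exp (- pi * \<epsilon>\<^sup>2 * (\<rho> \<xi>)\<^sup>2))) \<partial>lborel) * v \<xi>"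
      by (rule nn_integral_multc) measurable
    then show "(\<integral>\<^sup>+ \<epsilon>. ennreal (scale_weight \<tau> \<epsilon> * (1 - exp (- pi * \<epsilon>\<^sup>2 * (\<rho> \<xi>)\<^sup>2))) * v \<xi> \<partial>lborel)
       = mixture_const \<tau> * (ennreal (\<rho> \<xi> powr \<tau>) * v \<xi>)"
      by (simp only: gaussian_mixture_scaling[OF assms(3,4)] mult.assoc[of "mixture_const \<tau>"])
  qed
  also have "\<dots> = mixture_const \<tau> * (\<integral>\<^sup>+ \<xi>. ennreal (\<rho> \<xi> powr \<tau>) * v \<xi> \<partial>lborel)"
    by (rule nn_integral_cmult) measurable
  finally show ?thesis .
qed

text \<open>The squared homogeneous Sobolev norm of order \<open>\<tau> / 2\<close>.\<close>

definition hom_energy :: "real \<Rightarrow> (real^2 \<Rightarrow> complex) \<Rightarrow> ennreal" where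
  "hom_energy \<tau> f = (\<integral>\<^sup>+ \<xi>. ennreal (norm \<xi> powr \<tau>) * ennreal ((cmod (fourier_L2 f \<xi>))\<^sup>2) \<partial>lborel)"

text \<open>
  The contraction behind the decay. For each \<open>\<epsilon>\<close> the modulus satisfies the estimate with a
  Gaussian centered at \<open>0\<close>, while \<open>u\<close> may be measured with a Gaussian centered at \<open>\<nu>\<close>; where the
  transform of \<open>u\<close> lives, \<open>\<bar>\<xi> - \<nu>\<bar> \<le> \<theta> \<bar>\<xi>\<bar>\<close>. Integrating over \<open>\<epsilon>\<close> turns the factor \<open>\<theta>\<close> inside
  the Gaussian into \<open>\<theta> powr \<tau>\<close>.
\<close>

lemma hom_energy_modulus_le:
  assumes u: "u \<in> L2_space" and \<tau>: "0 < \<tau>" "\<tau> < 2" and \<theta>: "0 < \<theta>"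
    and loc: "AE \<xi> in lborel. fourier_L2 u \<xi> \<noteq> 0 \<longrightarrow> norm (\<xi> - \<nu>) \<le> \<theta> * norm \<xi>"
  shows "hom_energy \<tau> (\<lambda>x. complex_of_real (cmod (u x))) \<le> ennreal (\<theta> powr \<tau>) * hom_energy \<tau> u"
proof -
  let ?h = "\<lambda>x. complex_of_real (cmod (u x))"
  have [measurable]: "fourier_L2 u \<in> borel_measurable borel" "fourier_L2 ?h \<in> borel_measurable borel"
    using fourier_L2_in_L2[OF u] fourier_L2_in_L2[OF modulus_in_L2[OF u]] by (auto simp: L2_space_iff)
  let ?U = "\<lambda>\<xi>. ennreal ((cmod (fourier_L2 u \<xi>))\<^sup>2)" and ?H = "\<lambda>\<xi>. ennreal ((cmod (fourier_L2 ?h \<xi>))\<^sup>2)"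
  have le: "(\<integral>\<^sup>+ \<xi>. ennreal (1 - gauss \<epsilon> \<xi>) * ?H \<xi> \<partial>lborel)
     \<le> (\<integral>\<^sup>+ \<xi>. ennreal (1 - exp (- pi * \<epsilon>\<^sup>2 * (\<theta> * norm \<xi>)\<^sup>2)) * ?U \<xi> \<partial>lborel)" if \<epsilon>: "0 < \<epsilon>" for \<epsilon>
  proof -
    have "(\<integral>\<^sup>+ \<xi>. ennreal (1 - gauss \<epsilon> \<xi>) * ?H \<xi> \<partial>lborel) \<le> (\<integral>\<^sup>+ \<xi>. ennreal (1 - gauss \<epsilon> (\<xi> - \<nu>)) * ?U \<xi> \<partial>lborel)"
      by (rule gaussian_defect_modulus_le[OF u \<epsilon>])
    also have "\<dots> \<le> (\<integral>\<^sup>+ \<xi>. ennreal (1 - exp (- pi * \<epsilon>\<^sup>2 * (\<theta> * norm \<xi>)\<^sup>2)) * ?U \<xi> \<partial>lborel)"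
    proof (rule nn_integral_mono_AE)
      show "AE \<xi> in lborel. ennreal (1 - gauss \<epsilon> (\<xi> - \<nu>)) * ?U \<xi> \<le> ennreal (1 - exp (- pi * \<epsilon>\<^sup>2 * (\<theta> * norm \<xi>)\<^sup>2)) * ?U \<xi>"
        using loc
      proof eventually_elim
        fix \<xi> assume imp: "fourier_L2 u \<xi> \<noteq> 0 \<longrightarrow> norm (\<xi> - \<nu>) \<le> \<theta> * norm \<xi>"
        show "ennreal (1 - gauss \<epsilon> (\<xi> - \<nu>)) * ?U \<xi> \<le> ennreal (1 - exp (- pi * \<epsilon>\<^sup>2 * (\<theta> * norm \<xi>)\<^sup>2)) * ?U \<xi>"
        proof (cases "fourier_L2 u \<xi> = 0")
          case False
          then have "(norm (\<xi> - \<nu>))\<^sup>2 \<le> (\<theta> * norm \<xi>)\<^sup>2" using imp by (intro power_mono) auto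
          then have "pi * \<epsilon>\<^sup>2 * (norm (\<xi> - \<nu>))\<^sup>2 \<le> pi * \<epsilon>\<^sup>2 * (\<theta> * norm \<xi>)\<^sup>2"
            by (rule mult_left_mono) simp
          then have "1 - gauss \<epsilon> (\<xi> - \<nu>) \<le> 1 - exp (- pi * \<epsilon>\<^sup>2 * (\<theta> * norm \<xi>)\<^sup>2)" by simp
          then show ?thesis by (intro mult_right_mono ennreal_leI) auto
        qed simp
      qed
    qed
    finally show ?thesis .
  qed
  have "mixture_const \<tau> * hom_energy \<tau> ?h
      = (\<integral>\<^sup>+ \<epsilon>. ennreal (scale_weight \<tau> \<epsilon>) * (\<integral>\<^sup>+ \<xi>. ennreal (1 - gauss \<epsilon> \<xi>) * ?H \<xi> \<partial>lborel) \<partial>lborel)"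
    unfolding hom_energy_def using \<tau> by (intro gaussian_mixture[symmetric]) auto
  also have "\<dots> \<le> (\<integral>\<^sup>+ \<epsilon>. ennreal (scale_weight \<tau> \<epsilon>) * (\<integral>\<^sup>+ \<xi>. ennreal (1 - exp (- pi * \<epsilon>\<^sup>2 * (\<theta> * norm \<xi>)\<^sup>2)) * ?U \<xi> \<partial>lborel) \<partial>lborel)"
  proof (rule nn_integral_mono)
    fix \<epsilon> :: real
    show "ennreal (scale_weight \<tau> \<epsilon>) * (\<integral>\<^sup>+ \<xi>. ennreal (1 - gauss \<epsilon> \<xi>) * ?H \<xi> \<partial>lborel)
      \<le> ennreal (scale_weight \<tau> \<epsilon>) * (\<integral>\<^sup>+ \<xi>. ennreal (1 - exp (- pi * \<epsilon>\<^sup>2 * (\<theta> * norm \<xi>)\<^sup>2)) * ?U \<xi> \<partial>lborel)"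
    proof (cases "0 < \<epsilon>")
      case True
      then show ?thesis by (intro mult_left_mono le) auto
    next
      case False
      then have "scale_weight \<tau> \<epsilon> = 0" by (simp add: scale_weight_def)
      then show ?thesis by simp
    qed
  qed
  also have "\<dots> = mixture_const \<tau> * (\<integral>\<^sup>+ \<xi>. ennreal ((\<theta> * norm \<xi>) powr \<tau>) * ?U \<xi> \<partial>lborel)"
    using \<tau> \<theta> by (intro gaussian_mixture) auto
  also have "(\<integral>\<^sup>+ \<xi>. ennreal ((\<theta> * norm \<xi>) powr \<tau>) * ?U \<xi> \<partial>lborel) = ennreal (\<theta> powr \<tau>) * hom_energy \<tau> u"
    using \<theta> by (simp add: powr_mult ennreal_mult mult.assoc nn_integral_cmult hom_energy_def)
  finally have "mixture_const \<tau> * hom_energy \<tau> ?h \<le> mixture_const \<tau> * (ennreal (\<theta> powr \<tau>) * hom_energy \<tau> u)" .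
  then show ?thesis
    using mixture_const_pos[of \<tau>] mixture_const_finite[OF \<tau>] by (subst (asm) ennreal_mult_le_mult_iff) auto
qed


section \<open>Energy along scattering paths\<close>

lemma sum_le_infsum_ennreal:
  fixes f :: "'a \<Rightarrow> ennreal"
  assumes "finite F" "F \<subseteq> A"
  shows "sum f F \<le> infsum f A"
  unfolding nonneg_infsum_complete[of A f, OF zero_le] using assms by (intro SUP_upper) simp

lemma infsum_le_ennreal:
  fixes f :: "'a \<Rightarrow> ennreal"
  assumes "\<And>F. finite F \<Longrightarrow> F \<subseteq> A \<Longrightarrow> sum f F \<le> b"
  shows "infsum f A \<le> b"
  unfolding nonneg_infsum_complete[of A f, OF zero_le] by (rule SUP_least) (use assms in simp)

lemma infsum_mono_cmult_ennreal:
  fixes f g :: "'a \<Rightarrow> ennreal"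
  assumes "\<And>x. x \<in> A \<Longrightarrow> f x \<le> c * g x"
  shows "infsum f A \<le> c * infsum g A"
proof (rule infsum_le_ennreal)
  fix F assume F: "finite F" "F \<subseteq> A"
  have "sum f F \<le> (\<Sum>x\<in>F. c * g x)" using F assms by (intro sum_mono) auto
  also have "\<dots> = c * sum g F" by (simp add: sum_distrib_left)
  also have "\<dots> \<le> c * infsum g A" by (intro mult_left_mono sum_le_infsum_ennreal F) auto
  finally show "sum f F \<le> c * infsum g A" .
qed

text \<open>The sum is a supremum over finite subsets, so the index set may be arbitrary.\<close>

lemma infsum_nn_integral_le:
  fixes a :: "'i \<Rightarrow> 'a \<Rightarrow> ennreal"
  assumes [measurable]: "\<And>i. i \<in> A \<Longrightarrow> a i \<in> borel_measurable M" "v \<in> borel_measurable M"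
    and le: "AE x in M. v x * infsum (\<lambda>i. a i x) A \<le> b x"
  shows "(\<Sum>\<^sub>\<infinity>i\<in>A. \<integral>\<^sup>+ x. v x * a i x \<partial>M) \<le> (\<integral>\<^sup>+ x. b x \<partial>M)"
proof (rule infsum_le_ennreal)
  fix F assume F: "finite F" "F \<subseteq> A"
  have "(\<Sum>i\<in>F. \<integral>\<^sup>+ x. v x * a i x \<partial>M) = (\<integral>\<^sup>+ x. (\<Sum>i\<in>F. v x * a i x) \<partial>M)"
    using F by (intro nn_integral_sum[symmetric]) auto
  also have "\<dots> \<le> (\<integral>\<^sup>+ x. b x \<partial>M)"
  proof (rule nn_integral_mono_AE)
    show "AE x in M. (\<Sum>i\<in>F. v x * a i x) \<le> b x"
      using le
    proof eventually_elim
      fix x assume le: "v x * infsum (\<lambda>i. a i x) A \<le> b x"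
      have "(\<Sum>i\<in>F. v x * a i x) = v x * (\<Sum>i\<in>F. a i x)" by (simp add: sum_distrib_left)
      also have "\<dots> \<le> v x * infsum (\<lambda>i. a i x) A" by (intro mult_left_mono sum_le_infsum_ennreal F) auto
      finally show "(\<Sum>i\<in>F. v x * a i x) \<le> b x" using le by (rule order_trans)
    qed
  qed
  finally show "(\<Sum>i\<in>F. \<integral>\<^sup>+ x. v x * a i x \<partial>M) \<le> (\<integral>\<^sup>+ x. b x \<partial>M)" .
qed

lemma paths_0: "paths \<alpha> \<beta> 0 = {[]}"
  by (auto simp: paths_def)

text \<open>
  A path is its first filter followed by a shorter path. The inequality is the half of this
  decomposition on which the induction over the depth rests.
\<close>

lemma infsum_paths_Suc_le:
  fixes g :: "wp_index list \<Rightarrow> ennreal"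
  shows "(\<Sum>\<^sub>\<infinity>p\<in>paths \<alpha> \<beta> (Suc n). g p) \<le> (\<Sum>\<^sub>\<infinity>i\<in>I_star \<alpha> \<beta>. \<Sum>\<^sub>\<infinity>p\<in>paths \<alpha> \<beta> n. g (i # p))"
proof (rule infsum_le_ennreal)
  fix F assume F: "finite F" "F \<subseteq> paths \<alpha> \<beta> (Suc n)"
  have ne: "p = hd p # tl p" "hd p \<in> I_star \<alpha> \<beta>" "tl p \<in> paths \<alpha> \<beta> n" if "p \<in> F" for p
  proof -
    have "length p = Suc n" "set p \<subseteq> I_star \<alpha> \<beta>" using F(2) that by (auto simp: paths_def)
    then show "p = hd p # tl p" "hd p \<in> I_star \<alpha> \<beta>" "tl p \<in> paths \<alpha> \<beta> n"
      by (cases p; simp add: paths_def)+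
  qed
  have sub: "F \<subseteq> (\<lambda>(i, q). i # q) ` (hd ` F \<times> tl ` F)"
  proof
    fix p assume p: "p \<in> F"
    show "p \<in> (\<lambda>(i, q). i # q) ` (hd ` F \<times> tl ` F)"
      by (rule image_eqI[of _ _ "(hd p, tl p)"]) (use ne(1)[OF p] p in auto)
  qed
  have inj: "inj_on (\<lambda>(i, q). i # q) (hd ` F \<times> tl ` F)" by (auto simp: inj_on_def)
  have "sum g F \<le> sum g ((\<lambda>(i, q). i # q) ` (hd ` F \<times> tl ` F))"
    by (rule sum_mono2) (use F(1) sub in auto)
  also have "\<dots> = (\<Sum>(i, q)\<in>hd ` F \<times> tl ` F. g (i # q))"
    unfolding sum.reindex[OF inj] by (rule sum.cong) auto
  also have "\<dots> = (\<Sum>i\<in>hd ` F. \<Sum>q\<in>tl ` F. g (i # q))"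
    by (rule sum.cartesian_product[symmetric])
  also have "\<dots> \<le> (\<Sum>i\<in>hd ` F. \<Sum>\<^sub>\<infinity>q\<in>paths \<alpha> \<beta> n. g (i # q))"
    by (rule sum_mono, rule sum_le_infsum_ennreal) (use F(1) ne in auto)
  also have "\<dots> \<le> (\<Sum>\<^sub>\<infinity>i\<in>I_star \<alpha> \<beta>. \<Sum>\<^sub>\<infinity>p\<in>paths \<alpha> \<beta> n. g (i # p))"
    by (rule sum_le_infsum_ennreal) (use F(1) ne in auto)
  finally show "sum g F \<le> (\<Sum>\<^sub>\<infinity>i\<in>I_star \<alpha> \<beta>. \<Sum>\<^sub>\<infinity>p\<in>paths \<alpha> \<beta> n. g (i # p))" .
qed

lemma U_step_in_L2:
  assumes "g \<in> L2_space" "\<psi> i \<in> L1_space \<inter> L2_space"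
  shows "U_step \<psi> i g \<in> L2_space"
  unfolding U_step_def by (rule modulus_in_L2[OF convol_in_L2[OF assms]])

lemma bank_filter: 
  assumes "wave_packet_bank \<alpha> \<beta> \<epsilon>0 \<phi> \<psi>" "i \<in> I_star \<alpha> \<beta>"
  shows "\<psi> i \<in> L1_space \<inter> L2_space"
  using assms by (auto simp: wave_packet_bank_def)

lemma bank_fourier_measurable:
  assumes "wave_packet_bank \<alpha> \<beta> \<epsilon>0 \<phi> \<psi>" "i \<in> I_star \<alpha> \<beta>"
  shows "fourier (\<psi> i) \<in> borel_measurable borel"
  using bank_filter[OF assms] by (auto simp: L2_space_iff)

lemma bank_sum_le_1:
  assumes "wave_packet_bank \<alpha> \<beta> \<epsilon>0 \<phi> \<psi>"
  shows "AE \<xi> in lborel. (\<Sum>\<^sub>\<infinity>i\<in>I_star \<alpha> \<beta>. ennreal ((cmod (fourier (\<psi> i) \<xi>))\<^sup>2)) \<le> 1"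
proof -
  have "AE \<xi> in lborel. ennreal ((cmod (fourier \<phi> \<xi>))\<^sup>2)
        + (\<Sum>\<^sub>\<infinity>i\<in>I_star \<alpha> \<beta>. ennreal ((cmod (fourier (\<psi> i) \<xi>))\<^sup>2)) = 1"
    using assms by (simp add: wave_packet_bank_def)
  then show ?thesis
    by eventually_elim (metis add.commute le_iff_add)
qed

lemma L2norm_on_U_step:
  assumes g: "g \<in> L2_space" and \<psi>: "\<psi> i \<in> L1_space \<inter> L2_space"
  shows "(L2norm_on lborel (U_step \<psi> i g))\<^sup>2
    = (\<integral>\<^sup>+ \<xi>. ennreal ((cmod (fourier_L2 g \<xi>))\<^sup>2) * ennreal ((cmod (fourier (\<psi> i) \<xi>))\<^sup>2) \<partial>lborel)"
proof -
  have "L2norm_on lborel (U_step \<psi> i g) = L2norm_on lborel (convol g (\<psi> i))"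
    by (simp add: L2norm_on_def U_step_def)
  also have "\<dots> = L2norm_on lborel (fourier_L2 (convol g (\<psi> i)))"
    by (rule Plancherel[OF convol_in_L2[OF g \<psi>], symmetric])
  also have "\<dots> = L2norm_on lborel (\<lambda>\<xi>. fourier_L2 g \<xi> * fourier (\<psi> i) \<xi>)"
    by (rule L2norm_on_cong_AE[OF fourier_L2_convol(2)[OF g \<psi>]])
  finally show ?thesis
    by (simp add: L2norm_on_power2 norm_mult power_mult_distrib ennreal_mult)
qed

lemma hom_energy_U_step_le:
  assumes g: "g \<in> L2_space" and \<psi>: "\<psi> i \<in> L1_space \<inter> L2_space"
    and \<tau>: "0 < \<tau>" "\<tau> < 2" and \<theta>: "0 < \<theta>"
    and loc: "fsupport (fourier (\<psi> i)) \<subseteq> {\<xi>. norm (\<xi> - \<nu>) \<le> \<theta> * norm \<xi>}"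
  shows "hom_energy \<tau> (U_step \<psi> i g) \<le> ennreal (\<theta> powr \<tau>) *
    (\<integral>\<^sup>+ \<xi>. (ennreal (norm \<xi> powr \<tau>) * ennreal ((cmod (fourier_L2 g \<xi>))\<^sup>2)) * ennreal ((cmod (fourier (\<psi> i) \<xi>))\<^sup>2) \<partial>lborel)"
proof -
  note u = convol_in_L2[OF g \<psi>] and eq = fourier_L2_convol(2)[OF g \<psi>]
  have sup: "{\<xi>. fourier (\<psi> i) \<xi> \<noteq> 0} \<subseteq> {\<xi>. norm (\<xi> - \<nu>) \<le> \<theta> * norm \<xi>}"
    using loc closure_subset unfolding fsupport_def by (rule order_trans[rotated])
  have "hom_energy \<tau> (U_step \<psi> i g) \<le> ennreal (\<theta> powr \<tau>) * hom_energy \<tau> (convol g (\<psi> i))"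
    unfolding U_step_def
  proof (rule hom_energy_modulus_le[OF u \<tau> \<theta>])
    show "AE \<xi> in lborel. fourier_L2 (convol g (\<psi> i)) \<xi> \<noteq> 0 \<longrightarrow> norm (\<xi> - \<nu>) \<le> \<theta> * norm \<xi>"
      using eq by eventually_elim (use sup in auto)
  qed
  also have "hom_energy \<tau> (convol g (\<psi> i)) =
    (\<integral>\<^sup>+ \<xi>. (ennreal (norm \<xi> powr \<tau>) * ennreal ((cmod (fourier_L2 g \<xi>))\<^sup>2)) * ennreal ((cmod (fourier (\<psi> i) \<xi>))\<^sup>2) \<partial>lborel)"
    unfolding hom_energy_def
  proof (rule nn_integral_cong_AE)
    show "AE \<xi> in lborel. ennreal (norm \<xi> powr \<tau>) * ennreal ((cmod (fourier_L2 (convol g (\<psi> i)) \<xi>))\<^sup>2)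
       = (ennreal (norm \<xi> powr \<tau>) * ennreal ((cmod (fourier_L2 g \<xi>))\<^sup>2)) * ennreal ((cmod (fourier (\<psi> i) \<xi>))\<^sup>2)"
      using eq by eventually_elim (simp add: norm_mult power_mult_distrib ennreal_mult mult.assoc)
  qed
  finally show ?thesis .
qed

text \<open>
  One layer of the network contracts the homogeneous energy: each filter contributes the factor
  \<open>\<theta> powr \<tau>\<close>, and the filters together do not amplify any frequency.
\<close>

lemma hom_energy_layer_le:
  assumes bank: "wave_packet_bank \<alpha> \<beta> \<epsilon>0 \<phi> \<psi>" and loc: "energy_loc2 \<alpha> \<beta> \<psi> \<theta>"
    and \<tau>: "0 < \<tau>" "\<tau> < 2" and g: "g \<in> L2_space"
  shows "(\<Sum>\<^sub>\<infinity>i\<in>I_star \<alpha> \<beta>. hom_energy \<tau> (U_step \<psi> i g)) \<le> ennreal (\<theta> powr \<tau>) * hom_energy \<tau> g"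
proof -
  obtain \<nu> where \<theta>: "0 < \<theta>" and \<nu>: "\<And>i. i \<in> I_star \<alpha> \<beta> \<Longrightarrow> fsupport (fourier (\<psi> i)) \<subseteq> {\<xi>. norm (\<xi> - \<nu> i) \<le> \<theta> * norm \<xi>}"
    using loc by (auto simp: energy_loc2_def)
  have [measurable]: "fourier_L2 g \<in> borel_measurable borel"
    using fourier_L2_in_L2[OF g] by (simp add: L2_space_iff)
  note [measurable] = bank_fourier_measurable[OF bank]
  let ?v = "\<lambda>\<xi>. ennreal (norm \<xi> powr \<tau>) * ennreal ((cmod (fourier_L2 g \<xi>))\<^sup>2)"
  have sum_le: "(\<Sum>\<^sub>\<infinity>i\<in>I_star \<alpha> \<beta>. \<integral>\<^sup>+ \<xi>. ?v \<xi> * ennreal ((cmod (fourier (\<psi> i) \<xi>))\<^sup>2) \<partial>lborel) \<le> (\<integral>\<^sup>+ \<xi>. ?v \<xi> \<partial>lborel)"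
  proof (rule infsum_nn_integral_le)
    show "AE \<xi> in lborel. ?v \<xi> * (\<Sum>\<^sub>\<infinity>i\<in>I_star \<alpha> \<beta>. ennreal ((cmod (fourier (\<psi> i) \<xi>))\<^sup>2)) \<le> ?v \<xi>"
      using bank_sum_le_1[OF bank]
    proof eventually_elim
      fix \<xi> assume "(\<Sum>\<^sub>\<infinity>i\<in>I_star \<alpha> \<beta>. ennreal ((cmod (fourier (\<psi> i) \<xi>))\<^sup>2)) \<le> 1"
      then have "?v \<xi> * (\<Sum>\<^sub>\<infinity>i\<in>I_star \<alpha> \<beta>. ennreal ((cmod (fourier (\<psi> i) \<xi>))\<^sup>2)) \<le> ?v \<xi> * 1"
        by (rule mult_left_mono) simp
      then show "?v \<xi> * (\<Sum>\<^sub>\<infinity>i\<in>I_star \<alpha> \<beta>. ennreal ((cmod (fourier (\<psi> i) \<xi>))\<^sup>2)) \<le> ?v \<xi>" by simp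
    qed
  qed measurable
  have "(\<Sum>\<^sub>\<infinity>i\<in>I_star \<alpha> \<beta>. hom_energy \<tau> (U_step \<psi> i g))
      \<le> ennreal (\<theta> powr \<tau>) * (\<Sum>\<^sub>\<infinity>i\<in>I_star \<alpha> \<beta>. \<integral>\<^sup>+ \<xi>. ?v \<xi> * ennreal ((cmod (fourier (\<psi> i) \<xi>))\<^sup>2) \<partial>lborel)"
    by (rule infsum_mono_cmult_ennreal, rule hom_energy_U_step_le[OF g bank_filter[OF bank] \<tau> \<theta> \<nu>])
  also have "\<dots> \<le> ennreal (\<theta> powr \<tau>) * (\<integral>\<^sup>+ \<xi>. ?v \<xi> \<partial>lborel)"
    by (rule mult_left_mono[OF sum_le]) simp
  finally show ?thesis unfolding hom_energy_def .
qed

text \<open>The filters ignore the frequencies below \<open>r\<close>, and \<open>1 \<le> r powr (- \<tau>) * \<bar>\<xi>\<bar> powr \<tau>\<close> on all others.\<close>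

lemma L2_layer_le:
  assumes bank: "wave_packet_bank \<alpha> \<beta> \<epsilon>0 \<phi> \<psi>" and gap: "energy_loc1 \<alpha> \<beta> \<psi> r"
    and \<tau>: "0 < \<tau>" and g: "g \<in> L2_space"
  shows "(\<Sum>\<^sub>\<infinity>i\<in>I_star \<alpha> \<beta>. (L2norm_on lborel (U_step \<psi> i g))\<^sup>2) \<le> ennreal (r powr (- \<tau>)) * hom_energy \<tau> g"
proof -
  have r: "0 < r" using gap by (simp add: energy_loc1_def)
  have [measurable]: "fourier_L2 g \<in> borel_measurable borel"
    using fourier_L2_in_L2[OF g] by (simp add: L2_space_iff)
  note [measurable] = bank_fourier_measurable[OF bank]
  let ?v = "\<lambda>\<xi>. ennreal ((cmod (fourier_L2 g \<xi>))\<^sup>2)"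
  have "(\<Sum>\<^sub>\<infinity>i\<in>I_star \<alpha> \<beta>. (L2norm_on lborel (U_step \<psi> i g))\<^sup>2)
      = (\<Sum>\<^sub>\<infinity>i\<in>I_star \<alpha> \<beta>. \<integral>\<^sup>+ \<xi>. ?v \<xi> * ennreal ((cmod (fourier (\<psi> i) \<xi>))\<^sup>2) \<partial>lborel)"
    by (intro infsum_cong L2norm_on_U_step g bank_filter[OF bank])
  also have "\<dots> \<le> (\<integral>\<^sup>+ \<xi>. ennreal (r powr (- \<tau>)) * (ennreal (norm \<xi> powr \<tau>) * ?v \<xi>) \<partial>lborel)"
  proof (rule infsum_nn_integral_le)
    show "AE \<xi> in lborel. ?v \<xi> * (\<Sum>\<^sub>\<infinity>i\<in>I_star \<alpha> \<beta>. ennreal ((cmod (fourier (\<psi> i) \<xi>))\<^sup>2))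
        \<le> ennreal (r powr (- \<tau>)) * (ennreal (norm \<xi> powr \<tau>) * ?v \<xi>)"
      using bank_sum_le_1[OF bank]
    proof eventually_elim
      fix \<xi> assume le: "(\<Sum>\<^sub>\<infinity>i\<in>I_star \<alpha> \<beta>. ennreal ((cmod (fourier (\<psi> i) \<xi>))\<^sup>2)) \<le> 1" (is "?S \<le> 1")
      have "?S \<le> ennreal (r powr (- \<tau>) * norm \<xi> powr \<tau>)"
      proof (cases "norm \<xi> < r")
        case True
        then have "?S = 0" using gap by (simp add: energy_loc1_def)
        then show ?thesis by simp
      next
        case False
        then have "r powr \<tau> \<le> norm \<xi> powr \<tau>" using r \<tau> by (intro powr_mono2) auto
        then have "1 \<le> r powr (- \<tau>) * norm \<xi> powr \<tau>" using r by (simp add: powr_minus field_simps)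
        then have "ennreal 1 \<le> ennreal (r powr (- \<tau>) * norm \<xi> powr \<tau>)" by (rule ennreal_leI)
        with le show ?thesis unfolding ennreal_1 by (rule order_trans)
      qed
      then have "?v \<xi> * ?S \<le> ?v \<xi> * ennreal (r powr (- \<tau>) * norm \<xi> powr \<tau>)" by (rule mult_left_mono) simp
      also have "\<dots> = ennreal (r powr (- \<tau>)) * (ennreal (norm \<xi> powr \<tau>) * ?v \<xi>)"
        by (simp add: ennreal_mult mult_ac)
      finally show "?v \<xi> * ?S \<le> ennreal (r powr (- \<tau>)) * (ennreal (norm \<xi> powr \<tau>) * ?v \<xi>)" .
    qed
  qed measurable
  also have "\<dots> = ennreal (r powr (- \<tau>)) * hom_energy \<tau> g"
    unfolding hom_energy_def by (rule nn_integral_cmult) measurable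
  finally show ?thesis .
qed

lemma hom_energy_paths_le:
  assumes bank: "wave_packet_bank \<alpha> \<beta> \<epsilon>0 \<phi> \<psi>" and loc: "energy_loc2 \<alpha> \<beta> \<psi> \<theta>"
    and \<tau>: "0 < \<tau>" "\<tau> < 2" and "f \<in> L2_space"
  shows "(\<Sum>\<^sub>\<infinity>p\<in>paths \<alpha> \<beta> n. hom_energy \<tau> (U_path \<psi> p f)) \<le> ennreal (\<theta> powr \<tau>) ^ n * hom_energy \<tau> f"
  using \<open>f \<in> L2_space\<close>
proof (induction n arbitrary: f)
  case 0
  then show ?case by (simp add: paths_0)
next
  case (Suc n)
  have "(\<Sum>\<^sub>\<infinity>p\<in>paths \<alpha> \<beta> (Suc n). hom_energy \<tau> (U_path \<psi> p f))
      \<le> (\<Sum>\<^sub>\<infinity>i\<in>I_star \<alpha> \<beta>. \<Sum>\<^sub>\<infinity>p\<in>paths \<alpha> \<beta> n. hom_energy \<tau> (U_path \<psi> p (U_step \<psi> i f)))"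
    using infsum_paths_Suc_le[of "\<lambda>p. hom_energy \<tau> (U_path \<psi> p f)"] by simp
  also have "\<dots> \<le> ennreal (\<theta> powr \<tau>) ^ n * (\<Sum>\<^sub>\<infinity>i\<in>I_star \<alpha> \<beta>. hom_energy \<tau> (U_step \<psi> i f))"
    by (intro infsum_mono_cmult_ennreal Suc.IH U_step_in_L2 Suc.prems bank_filter[OF bank])
  also have "\<dots> \<le> ennreal (\<theta> powr \<tau>) ^ n * (ennreal (\<theta> powr \<tau>) * hom_energy \<tau> f)"
    by (intro mult_left_mono hom_energy_layer_le[OF bank loc \<tau>] Suc.prems) auto
  finally show ?case by (simp add: mult_ac)
qed

text \<open>
  The contraction of the homogeneous energy is used on all layers but the last, on which the gap
  turns it into a bound for the \<open>L\<^sup>2\<close>-energy. Following the head of a path, the last layer is the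
  base case of the induction.
\<close>

lemma L2_paths_le:
  assumes bank: "wave_packet_bank \<alpha> \<beta> \<epsilon>0 \<phi> \<psi>"
    and gap: "energy_loc1 \<alpha> \<beta> \<psi> r" and loc: "energy_loc2 \<alpha> \<beta> \<psi> \<theta>"
    and \<tau>: "0 < \<tau>" "\<tau> < 2" and "f \<in> L2_space"
  shows "(\<Sum>\<^sub>\<infinity>p\<in>paths \<alpha> \<beta> (Suc n). (L2norm_on lborel (U_path \<psi> p f))\<^sup>2)
      \<le> ennreal (r powr (- \<tau>)) * ennreal (\<theta> powr \<tau>) ^ n * hom_energy \<tau> f"
  using \<open>f \<in> L2_space\<close>
proof (induction n arbitrary: f)
  case 0
  have "(\<Sum>\<^sub>\<infinity>p\<in>paths \<alpha> \<beta> (Suc 0). (L2norm_on lborel (U_path \<psi> p f))\<^sup>2)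
      \<le> (\<Sum>\<^sub>\<infinity>i\<in>I_star \<alpha> \<beta>. (L2norm_on lborel (U_step \<psi> i f))\<^sup>2)"
    using infsum_paths_Suc_le[of "\<lambda>p. (L2norm_on lborel (U_path \<psi> p f))\<^sup>2" \<alpha> \<beta> 0] by (simp add: paths_0)
  also have "\<dots> \<le> ennreal (r powr (- \<tau>)) * hom_energy \<tau> f"
    by (rule L2_layer_le[OF bank gap \<tau>(1) 0])
  finally show ?case by simp
next
  case (Suc n)
  have "(\<Sum>\<^sub>\<infinity>p\<in>paths \<alpha> \<beta> (Suc (Suc n)). (L2norm_on lborel (U_path \<psi> p f))\<^sup>2)
      \<le> (\<Sum>\<^sub>\<infinity>i\<in>I_star \<alpha> \<beta>. \<Sum>\<^sub>\<infinity>p\<in>paths \<alpha> \<beta> (Suc n). (L2norm_on lborel (U_path \<psi> p (U_step \<psi> i f)))\<^sup>2)"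
    using infsum_paths_Suc_le[of "\<lambda>p. (L2norm_on lborel (U_path \<psi> p f))\<^sup>2" \<alpha> \<beta> "Suc n"] by simp
  also have "\<dots> \<le> ennreal (r powr (- \<tau>)) * ennreal (\<theta> powr \<tau>) ^ n * (\<Sum>\<^sub>\<infinity>i\<in>I_star \<alpha> \<beta>. hom_energy \<tau> (U_step \<psi> i f))"
    by (intro infsum_mono_cmult_ennreal Suc.IH U_step_in_L2 Suc.prems bank_filter[OF bank])
  also have "\<dots> \<le> ennreal (r powr (- \<tau>)) * ennreal (\<theta> powr \<tau>) ^ n * (ennreal (\<theta> powr \<tau>) * hom_energy \<tau> f)"
    by (intro mult_left_mono hom_energy_layer_le[OF bank loc \<tau>] Suc.prems) auto
  finally show ?case by (simp add: mult_ac)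
qed

lemma U_path_in_L2:
  assumes bank: "wave_packet_bank \<alpha> \<beta> \<epsilon>0 \<phi> \<psi>" and "f \<in> L2_space" "set p \<subseteq> I_star \<alpha> \<beta>"
  shows "U_path \<psi> p f \<in> L2_space"
  using assms(2,3)
proof (induction p arbitrary: f)
  case (Cons i p)
  have "U_step \<psi> i f \<in> L2_space"
    using Cons.prems by (intro U_step_in_L2 bank_filter[OF bank]) simp_all
  then show ?case using Cons by simp
qed simp

text \<open>
  If the gap exceeded the radius of \<^const>\<open>cover_set0\<close>, no filter would be supported on the
  annulus in between.
\<close>

lemma gap_le_4:
  assumes bank: "wave_packet_bank \<alpha> \<beta> \<epsilon>0 \<phi> \<psi>" and gap: "energy_loc1 \<alpha> \<beta> \<psi> r"
  shows "r \<le> 4"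
proof (rule ccontr)
  assume "\<not> r \<le> 4"
  \<comment> \<open>On this annulus both the low-pass filter and, by (E1), all other filters vanish.\<close>
  define V where "V = ball 0 r - cball (0::real^2) 4"
  have "open V" by (simp add: V_def open_Diff)
  have "((4 + r) / 2) *\<^sub>R axis 1 1 \<in> V"
    using \<open>\<not> r \<le> 4\<close> by (simp add: V_def)
  then have "V \<noteq> {}" by blast
  have "AE \<xi> in lborel. ennreal ((cmod (fourier \<phi> \<xi>))\<^sup>2)
        + (\<Sum>\<^sub>\<infinity>i\<in>I_star \<alpha> \<beta>. ennreal ((cmod (fourier (\<psi> i) \<xi>))\<^sup>2)) = 1"
    using bank by (simp add: wave_packet_bank_def)
  then have "AE \<xi> in lborel. \<xi> \<notin> V"
  proof eventually_elim
    fix \<xi> assume sum1: "ennreal ((cmod (fourier \<phi> \<xi>))\<^sup>2)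
        + (\<Sum>\<^sub>\<infinity>i\<in>I_star \<alpha> \<beta>. ennreal ((cmod (fourier (\<psi> i) \<xi>))\<^sup>2)) = 1"
    show "\<xi> \<notin> V"
    proof
      assume "\<xi> \<in> V"
      then have "norm \<xi> < r" "4 < norm \<xi>" by (auto simp: V_def)
      have "fsupport (fourier \<phi>) \<subseteq> ball 0 4"
        using bank by (simp add: wave_packet_bank_def cover_set0_def)
      then have "\<xi> \<notin> fsupport (fourier \<phi>)" using \<open>4 < norm \<xi>\<close> by auto
      then have "fourier \<phi> \<xi> = 0"
        using closure_subset[of "{\<xi>. fourier \<phi> \<xi> \<noteq> 0}"] unfolding fsupport_def by auto
      moreover have "(\<Sum>\<^sub>\<infinity>i\<in>I_star \<alpha> \<beta>. ennreal ((cmod (fourier (\<psi> i) \<xi>))\<^sup>2)) = 0"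
        using gap \<open>norm \<xi> < r\<close> by (simp add: energy_loc1_def)
      ultimately show False using sum1 by simp
    qed
  qed
  then have "V \<in> null_sets lborel"
    using \<open>open V\<close> by (subst AE_iff_null_sets) auto
  then have "negligible V"
    by (simp add: negligible_iff_null_sets null_sets_completionI)
  with open_not_negligible[OF \<open>open V\<close> \<open>V \<noteq> {}\<close>] show False by simp
qed

lemma Hs_norm_power2:
  "(Hs_norm s f)\<^sup>2 = (\<integral>\<^sup>+ \<xi>. ennreal ((1 + (norm \<xi>)\<^sup>2) powr s) * ennreal ((cmod (fourier_L2 f \<xi>))\<^sup>2) \<partial>lborel)"
proof -
  have "((1 + (norm \<xi>)\<^sup>2) powr (s / 2))\<^sup>2 = (1 + (norm \<xi>)\<^sup>2) powr s" for \<xi> :: "real^2"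
    by (simp add: power2_eq_square flip: powr_add)
  then show ?thesis
    by (simp add: Hs_norm_def L2_norm_eq_L2norm_on L2norm_on_power2 norm_mult power_mult_distrib ennreal_mult)
qed

lemma norm_powr_le: "0 \<le> \<tau> \<Longrightarrow> norm \<xi> powr \<tau> \<le> (1 + (norm \<xi>)\<^sup>2) powr (\<tau> / 2)"
proof -
  assume "0 \<le> \<tau>"
  have "norm \<xi> powr \<tau> = ((norm \<xi>)\<^sup>2) powr (\<tau> / 2)"
    by (cases "norm \<xi> = 0") (simp_all add: powr_powr flip: powr_numeral)
  also have "\<dots> \<le> (1 + (norm \<xi>)\<^sup>2) powr (\<tau> / 2)"
    using \<open>0 \<le> \<tau>\<close> by (intro powr_mono2) auto
  finally show ?thesis .
qed

lemma hom_energy_le_Hs_norm: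
  assumes "0 \<le> \<tau>" "\<tau> / 2 \<le> s"
  shows "hom_energy \<tau> f \<le> (Hs_norm s f)\<^sup>2"
  unfolding hom_energy_def Hs_norm_power2
proof (rule nn_integral_mono)
  fix \<xi> :: "real^2"
  have "norm \<xi> powr \<tau> \<le> (1 + (norm \<xi>)\<^sup>2) powr s"
    using assms by (intro order_trans[OF norm_powr_le] powr_mono) auto
  then show "ennreal (norm \<xi> powr \<tau>) * ennreal ((cmod (fourier_L2 f \<xi>))\<^sup>2)
    \<le> ennreal ((1 + (norm \<xi>)\<^sup>2) powr s) * ennreal ((cmod (fourier_L2 f \<xi>))\<^sup>2)"
    by (intro mult_right_mono ennreal_leI) auto
qed

lemma Hs_norm_mono:
  assumes "\<sigma> \<le> s"
  shows "Hs_norm \<sigma> f \<le> Hs_norm s f"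
  unfolding power2_le_iff_ennreal[of "Hs_norm \<sigma> f", symmetric] Hs_norm_power2 using assms
  by (intro nn_integral_mono mult_right_mono ennreal_leI powr_mono) auto

text \<open>
  The inhomogeneous weight is comparable with \<open>1\<close> plus the homogeneous one, so both energies that
  decay along paths control the Sobolev norm.
\<close>

lemma Hs_norm_power2_le:
  assumes "0 \<le> \<sigma>" "\<sigma> \<le> 1" and f: "f \<in> L2_space"
  shows "(Hs_norm \<sigma> f)\<^sup>2 \<le> 2 * ((L2norm_on lborel f)\<^sup>2 + hom_energy (2 * \<sigma>) f)"
proof -
  have [measurable]: "fourier_L2 f \<in> borel_measurable borel"
    using fourier_L2_in_L2[OF f] by (simp add: L2_space_iff)
  have pt: "(1 + (norm \<xi>)\<^sup>2) powr \<sigma> \<le> 2 * (1 + norm \<xi> powr (2 * \<sigma>))" for \<xi> :: "real^2"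
  proof -
    \<comment> \<open>Replacing \<open>1 + \<bar>\<xi>\<bar>\<^sup>2\<close> by \<open>2 t\<^sup>2\<close> reduces the comparison of the weights to \<open>max 1 a \<le> 1 + a\<close>.\<close>
    define t where "t = max 1 (norm \<xi>)"
    have t: "1 \<le> t" "1 \<le> t\<^sup>2" "(norm \<xi>)\<^sup>2 \<le> t\<^sup>2" by (auto simp: t_def intro: power_mono)
    have "1 + (norm \<xi>)\<^sup>2 \<le> 2 * t\<^sup>2" using t(2,3) by linarith
    then have "(1 + (norm \<xi>)\<^sup>2) powr \<sigma> \<le> (2 * t\<^sup>2) powr \<sigma>"
      using assms by (intro powr_mono2) auto
    also have "\<dots> = 2 powr \<sigma> * t powr (2 * \<sigma>)"
      using t by (simp add: powr_mult powr_powr flip: powr_numeral)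
    also have "\<dots> \<le> 2 powr 1 * t powr (2 * \<sigma>)"
      using assms by (intro mult_right_mono powr_mono) auto
    also have "\<dots> = 2 * t powr (2 * \<sigma>)" by simp
    also have "\<dots> \<le> 2 * (1 + norm \<xi> powr (2 * \<sigma>))"
      by (intro mult_left_mono) (simp_all add: t_def max_def)
    finally show ?thesis .
  qed
  have "(Hs_norm \<sigma> f)\<^sup>2 \<le> (\<integral>\<^sup>+ \<xi>. 2 * (ennreal ((cmod (fourier_L2 f \<xi>))\<^sup>2) + ennreal (norm \<xi> powr (2 * \<sigma>)) * ennreal ((cmod (fourier_L2 f \<xi>))\<^sup>2)) \<partial>lborel)"
    unfolding Hs_norm_power2
  proof (rule nn_integral_mono)
    fix \<xi> :: "real^2"
    have "ennreal ((1 + (norm \<xi>)\<^sup>2) powr \<sigma>) \<le> ennreal (2 * (1 + norm \<xi> powr (2 * \<sigma>)))"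
      by (rule ennreal_leI[OF pt])
    also have "\<dots> = 2 * (1 + ennreal (norm \<xi> powr (2 * \<sigma>)))"
      by (simp add: ennreal_mult)
    finally have "ennreal ((1 + (norm \<xi>)\<^sup>2) powr \<sigma>) * ennreal ((cmod (fourier_L2 f \<xi>))\<^sup>2)
       \<le> 2 * (1 + ennreal (norm \<xi> powr (2 * \<sigma>))) * ennreal ((cmod (fourier_L2 f \<xi>))\<^sup>2)"
      by (rule mult_right_mono) simp
    then show "ennreal ((1 + (norm \<xi>)\<^sup>2) powr \<sigma>) * ennreal ((cmod (fourier_L2 f \<xi>))\<^sup>2)
       \<le> 2 * (ennreal ((cmod (fourier_L2 f \<xi>))\<^sup>2) + ennreal (norm \<xi> powr (2 * \<sigma>)) * ennreal ((cmod (fourier_L2 f \<xi>))\<^sup>2))"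
      by (simp only: mult.assoc distrib_right mult_1)
  qed
  also have "\<dots> = 2 * ((L2norm_on lborel f)\<^sup>2 + hom_energy (2 * \<sigma>) f)"
    unfolding Plancherel[OF f, symmetric] L2norm_on_power2 hom_energy_def
    by (simp add: nn_integral_cmult nn_integral_add)
  finally show ?thesis .
qed


section \<open>Decay and summability\<close>

lemma U_norm_power2: "(U_norm \<alpha> \<beta> \<psi> N n f)\<^sup>2 = (\<Sum>\<^sub>\<infinity>p\<in>paths \<alpha> \<beta> n. (N (U_path \<psi> p f))\<^sup>2)"
  by (simp add: U_norm_def ell2_norm_def)

text \<open>
  The homogeneous weight \<open>\<bar>\<xi>\<bar> powr s\<close> is that of order \<open>s / 2\<close>. With this choice the constant is
  \<open>r powr (- s)\<close>, which is at most \<open>1 / r\<close> for \<open>r \<le> 1\<close>, and at most \<open>1 \<le> 4 / r\<close> for \<open>1 \<le> r \<le> 4\<close>.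
\<close>

lemma U_norm_L2_decay:
  assumes bank: "wave_packet_bank \<alpha> \<beta> \<epsilon>0 \<phi> \<psi>"
    and gap: "energy_loc1 \<alpha> \<beta> \<psi> r" and loc: "energy_loc2 \<alpha> \<beta> \<psi> \<theta>"
    and s: "0 < s" "s \<le> 1" and n: "1 \<le> n" and f: "f \<in> L2_space"
  shows "(U_norm \<alpha> \<beta> \<psi> L2_norm n f)\<^sup>2
           \<le> ennreal (4 / r * \<theta> powr (s * (real n - 1))) * (Hs_norm s f)\<^sup>2"
proof -
  obtain m where m: "n = Suc m" using n by (cases n) auto
  have r: "0 < r" "r \<le> 4" using gap gap_le_4[OF bank gap] by (auto simp: energy_loc1_def)
  have \<theta>: "0 < \<theta>" using loc by (simp add: energy_loc2_def)
  have "r powr (- s) \<le> 4 / r"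
  proof (cases "r \<le> 1")
    case True
    have "r powr (- s) \<le> r powr (- 1)"
      using True r s by (intro powr_mono') auto
    also have "\<dots> \<le> 4 / r" using r by (simp add: powr_minus field_simps)
    finally show ?thesis .
  next
    case False
    then have "r powr (- s) \<le> r powr 0" using s by (intro powr_mono) auto
    also have "\<dots> \<le> 4 / r" using r by simp
    finally show ?thesis .
  qed
  then have const: "r powr (- s) * (\<theta> powr s) ^ m \<le> 4 / r * (\<theta> powr s) ^ m"
    by (rule mult_right_mono) simp
  have pow: "(\<theta> powr s) ^ m = \<theta> powr (s * (real n - 1))"
    using \<theta> by (simp add: m powr_powr flip: powr_realpow)
  have "(U_norm \<alpha> \<beta> \<psi> L2_norm n f)\<^sup>2 = (\<Sum>\<^sub>\<infinity>p\<in>paths \<alpha> \<beta> (Suc m). (L2norm_on lborel (U_path \<psi> p f))\<^sup>2)"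
    by (simp add: U_norm_power2 L2_norm_eq_L2norm_on m)
  also have "\<dots> \<le> ennreal (r powr (- s)) * ennreal (\<theta> powr s) ^ m * hom_energy s f"
    using s by (intro L2_paths_le[OF bank gap loc] f) auto
  also have "\<dots> \<le> ennreal (4 / r * (\<theta> powr s) ^ m) * (Hs_norm s f)\<^sup>2"
  proof (rule mult_mono)
    show "ennreal (r powr (- s)) * ennreal (\<theta> powr s) ^ m \<le> ennreal (4 / r * (\<theta> powr s) ^ m)"
      using ennreal_leI[OF const] by (simp only: ennreal_mult ennreal_power powr_ge_zero zero_le_power)
    show "hom_energy s f \<le> (Hs_norm s f)\<^sup>2"
      using s by (intro hom_energy_le_Hs_norm) auto
  qed auto
  finally show ?thesis unfolding pow .
qed

text \<open>
  The constant collects both energies for the exponent \<open>2 * \<sigma>\<close>; the extra \<open>\<theta>\<close> in it accounts for the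
  \<open>L\<^sup>2\<close>-energy decaying one layer later than the homogeneous one.
\<close>

lemma U_norm_Hs_decay:
  assumes bank: "wave_packet_bank \<alpha> \<beta> \<epsilon>0 \<phi> \<psi>"
    and gap: "energy_loc1 \<alpha> \<beta> \<psi> r" and loc: "energy_loc2 \<alpha> \<beta> \<psi> \<theta>"
    and \<sigma>: "0 < \<sigma>" "\<sigma> < 1" "\<sigma> \<le> s" and f: "f \<in> L2_space"
  shows "U_norm \<alpha> \<beta> \<psi> (Hs_norm \<sigma>) n f
     \<le> ennreal (sqrt (2 * ((r * \<theta>) powr (- (2 * \<sigma>)) + 1))) * ennreal (\<theta> powr \<sigma>) ^ n * Hs_norm s f"
proof (cases n)
  case 0
  have "U_norm \<alpha> \<beta> \<psi> (Hs_norm \<sigma>) 0 f = Hs_norm \<sigma> f"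
    by (simp add: U_norm_def ell2_norm_def paths_0 esqrt_unique)
  also have "\<dots> \<le> 1 * Hs_norm s f" using Hs_norm_mono[OF \<sigma>(3)] by simp
  also have "\<dots> \<le> ennreal (sqrt (2 * ((r * \<theta>) powr (- (2 * \<sigma>)) + 1))) * Hs_norm s f"
  proof (rule mult_right_mono)
    have "1 \<le> sqrt (2 * ((r * \<theta>) powr (- (2 * \<sigma>)) + 1))" by simp
    then show "1 \<le> ennreal (sqrt (2 * ((r * \<theta>) powr (- (2 * \<sigma>)) + 1)))"
      using ennreal_leI by fastforce
  qed simp
  finally show ?thesis using 0 by simp
next
  case (Suc m)
  define \<tau> where "\<tau> = 2 * \<sigma>"
  define q where "q = \<theta> powr \<tau>"
  have \<tau>: "0 < \<tau>" "\<tau> < 2" using \<sigma> by (auto simp: \<tau>_def)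
  have r: "0 < r" using gap by (simp add: energy_loc1_def)
  have \<theta>: "0 < \<theta>" using loc by (simp add: energy_loc2_def)
  have q: "0 < q" "q = (\<theta> powr \<sigma>)\<^sup>2"
    using \<theta> by (auto simp: q_def \<tau>_def power2_eq_square simp flip: powr_add)
  have c: "r powr (- \<tau>) * q ^ m = (r * \<theta>) powr (- \<tau>) * q ^ n"
    using r \<theta> q(1) by (simp add: Suc powr_mult powr_minus q_def field_simps)
  have sum_eq: "2 * (r powr (- \<tau>) * q ^ m + q ^ n) = (sqrt (2 * ((r * \<theta>) powr (- \<tau>) + 1)) * (\<theta> powr \<sigma>) ^ n)\<^sup>2"
    unfolding c by (simp add: power_mult_distrib q(2) algebra_simps flip: power_mult)
  have "(U_norm \<alpha> \<beta> \<psi> (Hs_norm \<sigma>) n f)\<^sup>2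
      \<le> 2 * (\<Sum>\<^sub>\<infinity>p\<in>paths \<alpha> \<beta> n. (L2norm_on lborel (U_path \<psi> p f))\<^sup>2 + hom_energy \<tau> (U_path \<psi> p f))"
    unfolding U_norm_power2 \<tau>_def using \<sigma>
    by (intro infsum_mono_cmult_ennreal Hs_norm_power2_le U_path_in_L2[OF bank f]) (auto simp: paths_def)
  also have "(\<Sum>\<^sub>\<infinity>p\<in>paths \<alpha> \<beta> n. (L2norm_on lborel (U_path \<psi> p f))\<^sup>2 + hom_energy \<tau> (U_path \<psi> p f))
      = (\<Sum>\<^sub>\<infinity>p\<in>paths \<alpha> \<beta> n. (L2norm_on lborel (U_path \<psi> p f))\<^sup>2) + (\<Sum>\<^sub>\<infinity>p\<in>paths \<alpha> \<beta> n. hom_energy \<tau> (U_path \<psi> p f))"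
    by (intro infsum_add nonneg_summable_on_complete) auto
  finally have "(U_norm \<alpha> \<beta> \<psi> (Hs_norm \<sigma>) n f)\<^sup>2
      \<le> 2 * ((\<Sum>\<^sub>\<infinity>p\<in>paths \<alpha> \<beta> n. (L2norm_on lborel (U_path \<psi> p f))\<^sup>2) + (\<Sum>\<^sub>\<infinity>p\<in>paths \<alpha> \<beta> n. hom_energy \<tau> (U_path \<psi> p f)))" .
  also have "\<dots> \<le> 2 * (ennreal (r powr (- \<tau>)) * ennreal q ^ m * (Hs_norm s f)\<^sup>2 + ennreal q ^ n * (Hs_norm s f)\<^sup>2)"
  proof (intro mult_left_mono add_mono)
    have hom: "hom_energy \<tau> f \<le> (Hs_norm s f)\<^sup>2"
      using \<sigma> by (intro hom_energy_le_Hs_norm) (auto simp: \<tau>_def)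
    show "(\<Sum>\<^sub>\<infinity>p\<in>paths \<alpha> \<beta> n. (L2norm_on lborel (U_path \<psi> p f))\<^sup>2) \<le> ennreal (r powr (- \<tau>)) * ennreal q ^ m * (Hs_norm s f)\<^sup>2"
      unfolding Suc q_def by (rule order_trans[OF L2_paths_le[OF bank gap loc \<tau> f] mult_left_mono[OF hom]]) simp
    show "(\<Sum>\<^sub>\<infinity>p\<in>paths \<alpha> \<beta> n. hom_energy \<tau> (U_path \<psi> p f)) \<le> ennreal q ^ n * (Hs_norm s f)\<^sup>2"
      unfolding q_def by (rule order_trans[OF hom_energy_paths_le[OF bank loc \<tau> f] mult_left_mono[OF hom]]) simp
  qed simp
  also have "\<dots> = ennreal (2 * (r powr (- \<tau>) * q ^ m + q ^ n)) * (Hs_norm s f)\<^sup>2"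
    using q(1) by (simp add: ennreal_mult ennreal_power distrib_right mult.assoc)
  also have "\<dots> = (ennreal (sqrt (2 * ((r * \<theta>) powr (- \<tau>) + 1)) * (\<theta> powr \<sigma>) ^ n) * Hs_norm s f)\<^sup>2"
    unfolding sum_eq power_mult_distrib[of "ennreal _"] by (subst ennreal_power) auto
  finally have "U_norm \<alpha> \<beta> \<psi> (Hs_norm \<sigma>) n f \<le> ennreal (sqrt (2 * ((r * \<theta>) powr (- \<tau>) + 1)) * (\<theta> powr \<sigma>) ^ n) * Hs_norm s f"
    by (simp only: power2_le_iff_ennreal)
  then show ?thesis
    by (simp add: \<tau>_def ennreal_mult ennreal_power)
qed

lemma scat_energy_bound:
  assumes bank: "wave_packet_bank \<alpha> \<beta> \<epsilon>0 \<phi> \<psi>"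
    and gap: "energy_loc1 \<alpha> \<beta> \<psi> r" and loc: "energy_loc2 \<alpha> \<beta> \<psi> \<theta>"
    and \<sigma>: "0 < \<sigma>" "\<sigma> < 1" "\<sigma> \<le> s"
  shows "\<exists>C>0. \<forall>f\<in>L2_space. scat_energy \<alpha> \<beta> \<psi> \<sigma> f \<le> ennreal C * Hs_norm s f"
proof -
  have \<theta>: "0 < \<theta>" "\<theta> < 1" using loc by (auto simp: energy_loc2_def)
  define K where "K = sqrt (2 * ((r * \<theta>) powr (- (2 * \<sigma>)) + 1))"
  define q where "q = \<theta> powr \<sigma>"
  have q: "0 < q" "q < 1" using \<theta> \<sigma> powr_less_mono2[of \<sigma> \<theta> 1] by (auto simp: q_def)
  have K: "0 < K" by (simp add: K_def add_nonneg_pos)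
  have "scat_energy \<alpha> \<beta> \<psi> \<sigma> f \<le> ennreal (K / (1 - q)) * Hs_norm s f" if f: "f \<in> L2_space" for f
  proof -
    have "scat_energy \<alpha> \<beta> \<psi> \<sigma> f \<le> (\<Sum>n. ennreal (K * q ^ n) * Hs_norm s f)"
      unfolding scat_energy_def
    proof (rule suminf_le)
      show "U_norm \<alpha> \<beta> \<psi> (Hs_norm \<sigma>) n f \<le> ennreal (K * q ^ n) * Hs_norm s f" for n
        using U_norm_Hs_decay[OF bank gap loc \<sigma> f, of n] K q
        by (simp add: K_def q_def ennreal_mult ennreal_power)
    qed auto
    also have "\<dots> = (\<Sum>n. ennreal (K * q ^ n)) * Hs_norm s f"
      by (rule ennreal_suminf_multc)
    also have "(\<Sum>n. ennreal (K * q ^ n)) = ennreal (K / (1 - q))"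
    proof (rule suminf_ennreal_eq)
      show "(\<lambda>n. K * q ^ n) sums (K / (1 - q))"
        using sums_mult[OF geometric_sums[of q], of K] q by simp
    qed (use K q in auto)
    finally show ?thesis .
  qed
  moreover have "0 < K / (1 - q)" using K q by simp
  ultimately show ?thesis by blast
qed

theorem lemma6p10:
  fixes \<alpha> \<beta> \<epsilon>0 r_gap \<theta> :: real
    and \<phi> :: "real^2 \<Rightarrow> complex"
    and \<psi> :: "wp_index \<Rightarrow> real^2 \<Rightarrow> complex"
  assumes "0 \<le> \<beta>" and "\<beta> \<le> \<alpha>" and "\<alpha> \<le> 1" and "\<beta> < 1"
    and "0 < \<epsilon>0" and "\<epsilon>0 < 1/32"
    and "wave_packet_bank \<alpha> \<beta> \<epsilon>0 \<phi> \<psi>"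
    and "energy_loc1 \<alpha> \<beta> \<psi> r_gap"
    and "energy_loc2 \<alpha> \<beta> \<psi> \<theta>"
  shows "(\<forall>s. 0 < s \<and> s \<le> 1 \<longrightarrow>
            (\<forall>n\<ge>1. \<forall>f\<in>Hs_space s.
               (U_norm \<alpha> \<beta> \<psi> L2_norm n f)\<^sup>2
                 \<le> ennreal (4 / r_gap * \<theta> powr (s * (real n - 1))) * (Hs_norm s f)\<^sup>2))
       \<and> (\<forall>s. 1 - \<beta> < s \<and> s \<le> 1 \<longrightarrow>
            (\<exists>C>0. \<forall>f\<in>Hs_space s.
               scat_energy \<alpha> \<beta> \<psi> (1 - \<beta>) f \<le> ennreal C * Hs_norm s f))"
proof (intro conjI allI impI ballI)
  fix s :: real and n :: nat and f :: "real^2 \<Rightarrow> complex"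
  assume "0 < s \<and> s \<le> 1" "1 \<le> n" "f \<in> Hs_space s"
  then show "(U_norm \<alpha> \<beta> \<psi> L2_norm n f)\<^sup>2
       \<le> ennreal (4 / r_gap * \<theta> powr (s * (real n - 1))) * (Hs_norm s f)\<^sup>2"
    by (intro U_norm_L2_decay[OF assms(7-9)]) (auto simp: Hs_space_def)
next
  fix s assume "1 - \<beta> < s \<and> s \<le> 1"
  then have "\<exists>C>0. \<forall>f\<in>L2_space. scat_energy \<alpha> \<beta> \<psi> (1 - \<beta>) f \<le> ennreal C * Hs_norm s f"
    using assms(4) by (intro scat_energy_bound[OF assms(7-9)]) auto
  then show "\<exists>C>0. \<forall>f\<in>Hs_space s. scat_energy \<alpha> \<beta> \<psi> (1 - \<beta>) f \<le> ennreal C * Hs_norm s f"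
    by (auto simp: Hs_space_def)
qed

end
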